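(* Let $(M,[\lambda,\mu])$ be a structure of an oriented congruence with nonvanishing twist and vanishing shear, and let $[g_t]$ ($t$ a nonzero real constant) be the associated conformal classes of Lorentzian metrics on the 4-manifold $N$. If $t=-\frac13$ or $t=1$ and the relative invariant $K_1\equiv0$, then the conformal metrics $[g_t]$ satisfy the Bach condition. If in addition the relative invariant $K_2\neq0$, the metrics are not conformally flat and do not satisfy the Cotton condition. If $K_1\equiv K_2\equiv0$ the conformal metrics $g_{-1/3}$ and $g_1$ have $F_t\equiv0$, i.e. they are conformally flat.
   Context: All objects are smooth; $\alpha\beta=\frac12(\alpha\otimes\beta+\beta\otimes\alpha)$ for 1-forms. A structure of an oriented congruence $(M,[\lambda,\mu])$ on a 3-manifold $M$ is an equivalence class of pairs of 1-forms $(\lambda,\mu)$, $\lambda$ real, $\mu$ complex, with $\lambda\wedge\mu\wedge\bar\mu\neq 0$ everywhere, where $(\lambda,\mu)\sim(\lambda',\mu')$ iff $\lambda'=f\lambda$, $\mu'=h\mu$ for nonvanishing functions $f$ (real), $h$ (complex). For a representative write $d\lambda=ia\,\mu\wedge\bar\mu+b\,\mu\wedge\lambda+\bar b\,\bar\mu\wedge\lambda$, $d\mu=p\,\mu\wedge\bar\mu+q\,\mu\wedge\lambda+s\,\bar\mu\wedge\lambda$; $a$ is the twist, $s$ the shear. If $a\ne0$ everywhere and $s\equiv0$, then on $P$, locally $M\times\mathbb{C}^*$ with fibre coordinate $\rho e^{i\phi}$, there is a unique coframe $(\omega,\omega_1,\bar\omega_1,\Omega,\bar\Omega)$, with $\omega=\frac{\rho^2}{a}\lambda$,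 $\omega_1=\rho e^{i\phi}\mu$, satisfying $$d\omega=i\omega_1\wedge\bar\omega_1+(\Omega+\bar\Omega)\wedge\omega,\quad d\omega_1=\Omega\wedge\omega_1,\quad d\Omega=K_1\omega_1\wedge\bar\omega_1+K_2\omega_1\wedge\omega,$$ with $K_1=\rho^{-2}k_1$ real, $K_2=\rho^{-3}e^{-i\phi}k_2$, and $k_1,k_2$ functions on $M$. For a real constant $t\neq0$ the degenerate bilinear form $G_t=2\omega_1\bar\omega_1+2ti\,\omega(\bar\Omega-\Omega)$ on $P$ equals $\rho^2$ times a form independent of $\rho$, $d\rho$; hence it descends to a conformal class $[g_t]$ of Lorentzian metrics on the 4-dimensional leaf space $N$ of the integral curves of $\rho\partial_\rho$ (locally $N=M\times S^1$ with fibre coordinate $\phi$). Explicitly $[g_t]$ is represented by $2\mu\bar\mu+\frac{2ti}{a}\lambda(\bar\Omega-\Omega)$ with $\Omega-\bar\Omega=2i\,d\phi+(2\bar p+b-\frac{a_\mu}{a})\mu-(2p+\bar b-\frac{a_{\bar\mu}}{a})\bar\mu+(\bar q-q)\lambda$, where $da=a_\lambda\lambda+a_\mu\mu+a_{\bar\mu}\bar\mu$. $F_t$ denotes the curvature 2-form ($6\times6$-matrix valued) of the Cartan normal conformal connection $\omega_{[g_t]}$ of $[g_t]$. The Bach condition is $D{*F_t}=d{*F_t}+\omega_{[g_t]}\wedge{*F_t}-{*F_t}\wedge\omega_{[g_t]}=0$, which is equivalent to vanishing of the Bach tensor. The Cotton condition is: decomposing $F_t=F^+\oplus F^-$ with $*F^\pm=\pm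 iF^\pm$ and expanding $F^\pm=\frac12F^\pm_{ij}\theta^i\wedge\theta^j$ in a coframe $\theta^i$, one has $[F^+_{ij},F^-_{kl}]=0$ for all $i,j,k,l=1,\dots,4$ (commutators of $6\times6$ matrices). *)

theory Defs
  imports "HOL-Analysis.Analysis"
begin

section \<open>Smooth functions and differential forms on open sets of Euclidean spaces\<close>

text \<open>\<open>C\<^sup>\<infinity>\<close> on an open set: all iterated directional derivatives exist and are differentiable.\<close>

definition smooth_on :: "'e::real_normed_vector set \<Rightarrow> ('e \<Rightarrow> 'b::real_normed_vector) \<Rightarrow> bool" where
  "smooth_on S f \<longleftrightarrow>
     (\<forall>vs. \<forall>x\<in>S. foldr (\<lambda>v h y. frechet_derivative h (at y) v) vs f differentiable (at x))"

text \<open>A 1-form \<open>\<alpha>\<close> is given by its values \<open>\<alpha> x v\<close> at a point \<open>x\<close> on a tangent vector \<open>v\<close>,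
  a 2-form by values \<open>\<beta> x u v\<close>, with the convention
  \<open>(\<alpha> \<and> \<beta>)(u, v) = \<alpha>(u) \<beta>(v) - \<alpha>(v) \<beta>(u)\<close>. In the exterior derivatives the vectors
  \<open>u\<close>, \<open>v\<close>, \<open>w\<close> are held constant.\<close>

type_synonym ('e, 'b) form1 = "'e \<Rightarrow> 'e \<Rightarrow> 'b"
type_synonym ('e, 'b) form2 = "'e \<Rightarrow> 'e \<Rightarrow> 'e \<Rightarrow> 'b"

definition smooth_form :: "'e::real_normed_vector set \<Rightarrow> ('e, 'b::real_normed_vector) form1 \<Rightarrow> bool" where
  "smooth_form S \<alpha> \<longleftrightarrow> (\<forall>x\<in>S. linear (\<alpha> x)) \<and> (\<forall>v. smooth_on S (\<lambda>x. \<alpha> x v))"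

definition ext_d :: "('e::real_normed_vector, 'b::real_normed_vector) form1 \<Rightarrow> ('e, 'b) form2" where
  "ext_d \<alpha> x u v =
     frechet_derivative (\<lambda>y. \<alpha> y v) (at x) u - frechet_derivative (\<lambda>y. \<alpha> y u) (at x) v"

definition ext_d2 :: "('e::real_normed_vector, 'b::real_normed_vector) form2 \<Rightarrow> 'e \<Rightarrow> 'e \<Rightarrow> 'e \<Rightarrow> 'e \<Rightarrow> 'b" where
  "ext_d2 \<beta> x u v w =
     frechet_derivative (\<lambda>y. \<beta> y v w) (at x) u
   + frechet_derivative (\<lambda>y. \<beta> y w u) (at x) v
   + frechet_derivative (\<lambda>y. \<beta> y u v) (at x) w"

definition wedge :: "('e \<Rightarrow> 'b::comm_ring) \<Rightarrow> ('e \<Rightarrow> 'b) \<Rightarrow> 'e \<Rightarrow> 'e \<Rightarrow> 'b" where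
  "wedge \<alpha> \<beta> u v = \<alpha> u * \<beta> v - \<alpha> v * \<beta> u"

definition wedge12 :: "('e \<Rightarrow> 'b::comm_ring) \<Rightarrow> ('e \<Rightarrow> 'e \<Rightarrow> 'b) \<Rightarrow> 'e \<Rightarrow> 'e \<Rightarrow> 'e \<Rightarrow> 'b" where
  "wedge12 \<alpha> \<beta> u v w = \<alpha> u * \<beta> v w + \<alpha> v * \<beta> w u + \<alpha> w * \<beta> u v"

definition sym_prod :: "('e \<Rightarrow> complex) \<Rightarrow> ('e \<Rightarrow> complex) \<Rightarrow> 'e \<Rightarrow> 'e \<Rightarrow> complex" where
  "sym_prod \<alpha> \<beta> u v = (\<alpha> u * \<beta> v + \<beta> u * \<alpha> v) / 2"

definition cplx :: "('e, real) form1 \<Rightarrow> ('e, complex) form1" where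
  "cplx \<alpha> x v = complex_of_real (\<alpha> x v)"

definition conj_form :: "('e, complex) form1 \<Rightarrow> ('e, complex) form1" where
  "conj_form \<alpha> x v = cnj (\<alpha> x v)"


section \<open>Smooth 3-manifolds and their 1-forms\<close>

type_synonym 'p chart = "'p set \<times> ('p \<Rightarrow> real^3)"

abbreviation cdom :: "'p chart \<Rightarrow> 'p set" where "cdom c \<equiv> fst c"
abbreviation cmap :: "'p chart \<Rightarrow> 'p \<Rightarrow> real^3" where "cmap c \<equiv> snd c"

definition img :: "'p chart \<Rightarrow> (real^3) set" where
  "img c = cmap c ` cdom c"

definition cinv :: "'p chart \<Rightarrow> real^3 \<Rightarrow> 'p" where
  "cinv c = inv_into (cdom c) (cmap c)"

definition smooth_3manifold :: "'p topology \<Rightarrow> 'p chart set \<Rightarrow> bool" where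
  "smooth_3manifold X \<A> \<longleftrightarrow>
     Hausdorff_space X \<and> second_countable X \<and> topspace X = (\<Union>c\<in>\<A>. cdom c) \<and>
     (\<forall>c\<in>\<A>. openin X (cdom c) \<and> open (img c) \<and>
        homeomorphic_map (subtopology X (cdom c)) (top_of_set (img c)) (cmap c)) \<and>
     (\<forall>c\<in>\<A>. \<forall>c'\<in>\<A>. smooth_on (cmap c ` (cdom c \<inter> cdom c')) (cmap c' \<circ> cinv c))"

definition smooth_fun :: "'p chart set \<Rightarrow> ('p \<Rightarrow> 'b::real_normed_vector) \<Rightarrow> bool" where
  "smooth_fun \<A> f \<longleftrightarrow> (\<forall>c\<in>\<A>. smooth_on (img c) (f \<circ> cinv c))"

text \<open>A 1-form on the manifold is the family of its coordinate expressions in the charts of the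
  atlas, related by pullback along the transition maps.\<close>

type_synonym ('p, 'b) mform = "'p chart \<Rightarrow> (real^3, 'b) form1"

definition manifold_form :: "'p chart set \<Rightarrow> ('p, 'b::real_normed_vector) mform \<Rightarrow> bool" where
  "manifold_form \<A> \<alpha> \<longleftrightarrow>
     (\<forall>c\<in>\<A>. smooth_form (img c) (\<alpha> c)) \<and>
     (\<forall>c\<in>\<A>. \<forall>c'\<in>\<A>. \<forall>z \<in> cdom c \<inter> cdom c'. \<forall>v.
        \<alpha> c (cmap c z) v
          = \<alpha> c' (cmap c' z) (frechet_derivative (cmap c' \<circ> cinv c) (at (cmap c z)) v))"


section \<open>Oriented congruences\<close>

definition oc_pair :: "'p chart set \<Rightarrow> ('p, real) mform \<times> ('p, complex) mform \<Rightarrow> bool" where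
  "oc_pair \<A> = (\<lambda>(lam, \<mu>).
     manifold_form \<A> lam \<and> manifold_form \<A> \<mu> \<and>
     (\<forall>c\<in>\<A>. \<forall>x\<in>img c. \<exists>u v w.
        wedge12 (cplx (lam c) x) (wedge (\<mu> c x) (conj_form (\<mu> c) x)) u v w \<noteq> 0))"

definition oc_rel ::
  "'p chart set \<Rightarrow> (('p, real) mform \<times> ('p, complex) mform) rel" where
  "oc_rel \<A> = {((lam, \<mu>), (lam', \<mu>')).
     oc_pair \<A> (lam, \<mu>) \<and> oc_pair \<A> (lam', \<mu>') \<and>
     (\<exists>(f :: 'p \<Rightarrow> real) (h :: 'p \<Rightarrow> complex).
        smooth_fun \<A> f \<and> smooth_fun \<A> h \<and>
        (\<forall>c\<in>\<A>. \<forall>z\<in>cdom c. f z \<noteq> 0 \<and> h z \<noteq> 0 \<and>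
           (\<forall>v. lam' c (cmap c z) v = f z * lam c (cmap c z) v \<and>
                \<mu>' c (cmap c z) v = h z * \<mu> c (cmap c z) v)))}"

definition oriented_congruence ::
  "'p chart set \<Rightarrow> (('p, real) mform \<times> ('p, complex) mform) set \<Rightarrow> bool" where
  "oriented_congruence \<A> S \<longleftrightarrow> S \<in> Collect (oc_pair \<A>) // oc_rel \<A>"

definition structure_functions ::
  "'p chart set \<Rightarrow> ('p, real) mform \<Rightarrow> ('p, complex) mform \<Rightarrow>
   ('p \<Rightarrow> real) \<Rightarrow> ('p \<Rightarrow> complex) \<Rightarrow> ('p \<Rightarrow> complex) \<Rightarrow> ('p \<Rightarrow> complex) \<Rightarrow> ('p \<Rightarrow> complex) \<Rightarrow> bool" where
  "structure_functions \<A> lam \<mu> a b p q s \<longleftrightarrow>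
     smooth_fun \<A> a \<and> smooth_fun \<A> b \<and> smooth_fun \<A> p \<and> smooth_fun \<A> q \<and> smooth_fun \<A> s \<and>
     (\<forall>c\<in>\<A>. \<forall>z\<in>cdom c. let x = cmap c z; l = cplx (lam c) x; m = \<mu> c x; m' = conj_form (\<mu> c) x in
        (\<forall>u v. ext_d (cplx (lam c)) x u v
           = \<i> * of_real (a z) * wedge m m' u v + b z * wedge m l u v + cnj (b z) * wedge m' l u v) \<and>
        (\<forall>u v. ext_d (\<mu> c) x u v
           = p z * wedge m m' u v + q z * wedge m l u v + s z * wedge m' l u v))"


section \<open>The invariant coframe on P\<close>

text \<open>Over a chart \<open>c\<close> of \<open>M\<close> the coordinates on \<open>P\<close> are \<open>(x, \<rho>, \<phi>)\<close> with fibre coordinate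
  \<open>\<rho> e\<^sup>i\<^sup>\<phi>\<close>, \<open>\<rho> > 0\<close>, and those on the leaf space \<open>N\<close> of the integral curves of \<open>\<rho> \<partial>\<^sub>\<rho>\<close> are
  \<open>(x, \<phi>)\<close>. The angle \<open>\<phi>\<close> ranges over the real line, i.e. fibre circles are replaced by their
  universal covers; everything defined below is local in \<open>\<phi>\<close>.\<close>

type_synonym p_space = "(real^3) \<times> real \<times> real"
type_synonym n_space = "(real^3) \<times> real"

definition pdom :: "'p chart \<Rightarrow> p_space set" where
  "pdom c = img c \<times> {0<..} \<times> UNIV"

definition ndom :: "'p chart \<Rightarrow> n_space set" where
  "ndom c = img c \<times> UNIV"

definition proj_n :: "p_space \<Rightarrow> n_space" where
  "proj_n = (\<lambda>(x, \<rho>, \<phi>). (x, \<phi>))"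

definition omega :: "'p chart \<Rightarrow> ('p \<Rightarrow> real) \<Rightarrow> ('p, real) mform \<Rightarrow> (p_space, real) form1" where
  "omega c a lam = (\<lambda>(x, \<rho>, \<phi>) v. \<rho>\<^sup>2 / a (cinv c x) * lam c x (fst v))"

definition omega1 :: "'p chart \<Rightarrow> ('p, complex) mform \<Rightarrow> (p_space, complex) form1" where
  "omega1 c \<mu> = (\<lambda>(x, \<rho>, \<phi>) v. of_real \<rho> * cis \<phi> * \<mu> c x (fst v))"

definition invariant_coframe ::
  "'p chart set \<Rightarrow> ('p \<Rightarrow> real) \<Rightarrow> ('p, real) mform \<Rightarrow> ('p, complex) mform \<Rightarrow>
   ('p chart \<Rightarrow> (p_space, complex) form1) \<Rightarrow> ('p \<Rightarrow> real) \<Rightarrow> ('p \<Rightarrow> complex) \<Rightarrow> bool" where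
  "invariant_coframe \<A> a lam \<mu> \<Omega> k1 k2 \<longleftrightarrow>
     smooth_fun \<A> k1 \<and> smooth_fun \<A> k2 \<and>
     (\<forall>c\<in>\<A>. smooth_form (pdom c) (\<Omega> c) \<and>
       (\<forall>(x, \<rho>, \<phi>) \<in> pdom c.
         let y = (x, \<rho>, \<phi>);
             w = cplx (omega c a lam) y; w1 = omega1 c \<mu> y; w1' = conj_form (omega1 c \<mu>) y;
             W = \<Omega> c y; W' = conj_form (\<Omega> c) y;
             K1 = complex_of_real (k1 (cinv c x) / \<rho>\<^sup>2);
             K2 = cis (- \<phi>) * k2 (cinv c x) / of_real (\<rho> ^ 3)
         in (\<forall>v. w v = 0 \<and> w1 v = 0 \<and> W v = 0 \<longrightarrow> v = 0) \<and>
            (\<forall>u v. ext_d (cplx (omega c a lam)) y u v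
               = \<i> * wedge w1 w1' u v + wedge (\<lambda>z. W z + W' z) w u v) \<and>
            (\<forall>u v. ext_d (omega1 c \<mu>) y u v = wedge W w1 u v) \<and>
            (\<forall>u v. ext_d (\<Omega> c) y u v = K1 * wedge w1 w1' u v + K2 * wedge w1 w u v)))"


section \<open>The conformal classes on N\<close>

definition G_form ::
  "real \<Rightarrow> 'p chart \<Rightarrow> ('p \<Rightarrow> real) \<Rightarrow> ('p, real) mform \<Rightarrow> ('p, complex) mform \<Rightarrow>
   ('p chart \<Rightarrow> (p_space, complex) form1) \<Rightarrow> p_space \<Rightarrow> p_space \<Rightarrow> p_space \<Rightarrow> complex" where
  "G_form t c a lam \<mu> \<Omega> y u v =
     2 * sym_prod (omega1 c \<mu> y) (conj_form (omega1 c \<mu>) y) u v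
   + 2 * of_real t * \<i> *
       sym_prod (cplx (omega c a lam) y) (\<lambda>z. conj_form (\<Omega> c) y z - \<Omega> c y z) u v"

type_synonym metric = "n_space \<Rightarrow> n_space \<Rightarrow> n_space \<Rightarrow> real"

definition smooth_bilinear_on :: "n_space set \<Rightarrow> metric \<Rightarrow> bool" where
  "smooth_bilinear_on V g \<longleftrightarrow>
     (\<forall>x\<in>V. bilinear (g x) \<and> (\<forall>u v. g x u v = g x v u)) \<and> (\<forall>u v. smooth_on V (\<lambda>x. g x u v))"

text \<open>The metrics on \<open>V\<close> belonging to \<open>[g\<^sub>t]\<close>: those whose pullback to \<open>P\<close> is a positive multiple
  of \<open>G\<^sub>t\<close>. They are automatically Lorentzian, and any two of them are conformal.\<close>

definition g_class ::
  "real \<Rightarrow> 'p chart \<Rightarrow> ('p \<Rightarrow> real) \<Rightarrow> ('p, real) mform \<Rightarrow> ('p, complex) mform \<Rightarrow>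
   ('p chart \<Rightarrow> (p_space, complex) form1) \<Rightarrow> n_space set \<Rightarrow> metric set" where
  "g_class t c a lam \<mu> \<Omega> V = {g. smooth_bilinear_on V g \<and>
     (\<exists>f. \<forall>y\<in>pdom c. proj_n y \<in> V \<longrightarrow> f y > 0 \<and>
        (\<forall>u v. complex_of_real (g (proj_n y) (proj_n u) (proj_n v))
                 = of_real (f y) * G_form t c a lam \<mu> \<Omega> y u v))}"


section \<open>The Cartan normal conformal connection in dimension four\<close>

text \<open>A coframe \<open>\<theta>\<close> with dual frame \<open>e\<close> in which \<open>g = \<eta>\<^sub>i\<^sub>j \<theta>\<^sup>i \<theta>\<^sup>j\<close> has constant coefficients.\<close>

definition adapted_coframe ::
  "n_space set \<Rightarrow> metric \<Rightarrow> real^4^4 \<Rightarrow> (4 \<Rightarrow> (n_space, real) form1) \<Rightarrow> (4 \<Rightarrow> n_space \<Rightarrow> n_space) \<Rightarrow> bool" where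
  "adapted_coframe V g \<eta> \<theta> e \<longleftrightarrow>
     transpose \<eta> = \<eta> \<and> (\<forall>i. smooth_form V (\<theta> i)) \<and>
     (\<forall>x\<in>V. \<forall>i j. \<theta> i x (e j x) = (if i = j then 1 else 0)) \<and>
     (\<forall>x\<in>V. \<forall>u v. g x u v = (\<Sum>i\<in>UNIV. \<Sum>j\<in>UNIV. \<eta> $ i $ j * \<theta> i x u * \<theta> j x v))"

text \<open>\<open>\<Gamma> i j\<close> is the connection 1-form \<open>\<Gamma>\<^sup>i\<^sub>j\<close>.\<close>

definition levi_civita ::
  "n_space set \<Rightarrow> real^4^4 \<Rightarrow> (4 \<Rightarrow> (n_space, real) form1) \<Rightarrow> (4 \<Rightarrow> 4 \<Rightarrow> (n_space, real) form1) \<Rightarrow> bool" where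
  "levi_civita V \<eta> \<theta> \<Gamma> \<longleftrightarrow>
     (\<forall>i j. smooth_form V (\<Gamma> i j)) \<and>
     (\<forall>x\<in>V. \<forall>i u v. ext_d (\<theta> i) x u v + (\<Sum>j\<in>UNIV. wedge (\<Gamma> i j x) (\<theta> j x) u v) = 0) \<and>
     (\<forall>x\<in>V. \<forall>i j v. (\<Sum>k\<in>UNIV. \<eta> $ i $ k * \<Gamma> k j x v + \<eta> $ j $ k * \<Gamma> k i x v) = 0)"

definition curv_form ::
  "(4 \<Rightarrow> 4 \<Rightarrow> (n_space, real) form1) \<Rightarrow> 4 \<Rightarrow> 4 \<Rightarrow> (n_space, real) form2" where
  "curv_form \<Gamma> i j x u v = ext_d (\<Gamma> i j) x u v + (\<Sum>k\<in>UNIV. wedge (\<Gamma> i k x) (\<Gamma> k j x) u v)"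

text \<open>\<open>R\<^sub>j\<^sub>l = R\<^sup>i\<^sub>j\<^sub>i\<^sub>l\<close>, where the curvature form is \<open>\<onehalf> R\<^sup>i\<^sub>j\<^sub>k\<^sub>l \<theta>\<^sup>k \<and> \<theta>\<^sup>l\<close>.\<close>

definition ricci ::
  "(4 \<Rightarrow> n_space \<Rightarrow> n_space) \<Rightarrow> (4 \<Rightarrow> 4 \<Rightarrow> (n_space, real) form1) \<Rightarrow> 4 \<Rightarrow> 4 \<Rightarrow> n_space \<Rightarrow> real" where
  "ricci e \<Gamma> j l x = (\<Sum>i\<in>UNIV. curv_form \<Gamma> i j x (e i x) (e l x))"

definition scalar_curv ::
  "real^4^4 \<Rightarrow> (4 \<Rightarrow> n_space \<Rightarrow> n_space) \<Rightarrow> (4 \<Rightarrow> 4 \<Rightarrow> (n_space, real) form1) \<Rightarrow> n_space \<Rightarrow> real" where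
  "scalar_curv \<eta> e \<Gamma> x = (\<Sum>j\<in>UNIV. \<Sum>l\<in>UNIV. matrix_inv \<eta> $ j $ l * ricci e \<Gamma> j l x)"

text \<open>The Schouten 1-forms \<open>P\<^sub>j = P\<^sub>j\<^sub>l \<theta>\<^sup>l\<close>, with the sign \<open>P\<^sub>j\<^sub>l = R/12 \<eta>\<^sub>j\<^sub>l - \<onehalf> R\<^sub>j\<^sub>l\<close>. This is the
  choice for which the middle block \<open>d\<Gamma>\<^sup>i\<^sub>j + \<Gamma>\<^sup>i\<^sub>k \<and> \<Gamma>\<^sup>k\<^sub>j + \<theta>\<^sup>i \<and> P\<^sub>j + P\<^sup>i \<and> \<theta>\<^sub>j\<close> of the curvature of
  the connection below is the (trace-free) Weyl form.\<close>

definition schouten ::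
  "real^4^4 \<Rightarrow> (4 \<Rightarrow> (n_space, real) form1) \<Rightarrow> (4 \<Rightarrow> n_space \<Rightarrow> n_space) \<Rightarrow>
   (4 \<Rightarrow> 4 \<Rightarrow> (n_space, real) form1) \<Rightarrow> 4 \<Rightarrow> (n_space, real) form1" where
  "schouten \<eta> \<theta> e \<Gamma> j x v =
     (\<Sum>l\<in>UNIV. (scalar_curv \<eta> e \<Gamma> x / 12 * \<eta> $ j $ l - ricci e \<Gamma> j l x / 2) * \<theta> l x v)"

text \<open>Rows and columns of the \<open>6 \<times> 6\<close> matrices are indexed in block form \<open>1 + 4 + 1\<close>. The
  connection has the blocks
  \<open>(0, P\<^sub>j, 0)\<close>, \<open>(\<theta>\<^sup>i, \<Gamma>\<^sup>i\<^sub>j, \<eta>\<^sup>i\<^sup>j P\<^sub>j)\<close>, \<open>(0, \<eta>\<^sub>i\<^sub>j \<theta>\<^sup>i, 0)\<close>.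
  The entries are real, but the complex type is needed for the decomposition of the curvature into
  eigenforms of the Hodge star.\<close>

type_synonym idx6 = "unit + 4 + unit"
type_synonym mat6 = "complex^idx6^idx6"

definition normal_connection ::
  "real^4^4 \<Rightarrow> (4 \<Rightarrow> (n_space, real) form1) \<Rightarrow> (4 \<Rightarrow> n_space \<Rightarrow> n_space) \<Rightarrow>
   (4 \<Rightarrow> 4 \<Rightarrow> (n_space, real) form1) \<Rightarrow> (n_space, mat6) form1" where
  "normal_connection \<eta> \<theta> e \<Gamma> x v = (\<chi> r s. complex_of_real (case r of
       Inl _ \<Rightarrow> (case s of
          Inl _ \<Rightarrow> 0
        | Inr (Inl j) \<Rightarrow> schouten \<eta> \<theta> e \<Gamma> j x v
        | Inr (Inr _) \<Rightarrow> 0)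
     | Inr (Inl i) \<Rightarrow> (case s of
          Inl _ \<Rightarrow> \<theta> i x v
        | Inr (Inl j) \<Rightarrow> \<Gamma> i j x v
        | Inr (Inr _) \<Rightarrow> (\<Sum>j\<in>UNIV. matrix_inv \<eta> $ i $ j * schouten \<eta> \<theta> e \<Gamma> j x v))
     | Inr (Inr _) \<Rightarrow> (case s of
          Inl _ \<Rightarrow> 0
        | Inr (Inl j) \<Rightarrow> (\<Sum>i\<in>UNIV. \<eta> $ i $ j * \<theta> i x v)
        | Inr (Inr _) \<Rightarrow> 0)))"

definition conn_curvature :: "(n_space, mat6) form1 \<Rightarrow> (n_space, mat6) form2" where
  "conn_curvature A x u v = ext_d A x u v + (A x u ** A x v - A x v ** A x u)"

definition cov_d2 :: "(n_space, mat6) form1 \<Rightarrow> (n_space, mat6) form2 \<Rightarrow>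
    n_space \<Rightarrow> n_space \<Rightarrow> n_space \<Rightarrow> n_space \<Rightarrow> mat6" where
  "cov_d2 A B x u v w = ext_d2 B x u v w
     + (A x u ** B x v w + A x v ** B x w u + A x w ** B x u v)
     - (B x u v ** A x w + B x v w ** A x u + B x w u ** A x v)"


subsection \<open>Hodge star\<close>

definition eps4 :: "4 \<Rightarrow> 4 \<Rightarrow> 4 \<Rightarrow> 4 \<Rightarrow> real" where
  "eps4 i j k l = det ((\<chi> r. if r = 0 then axis i 1 else if r = 1 then axis j 1
                              else if r = 2 then axis k 1 else axis l 1) :: real^4^4)"

text \<open>\<open>*B = \<onehalf> (*B)\<^sub>k\<^sub>l \<theta>\<^sup>k \<and> \<theta>\<^sup>l\<close> with \<open>(*B)\<^sub>k\<^sub>l = \<onehalf> |det \<eta>|\<^sup>\<onehalf> \<epsilon>\<^sub>i\<^sub>j\<^sub>k\<^sub>l B\<^sup>i\<^sup>j\<close>, for the orientation of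
  the coframe. Reversing the orientation changes the sign of the star and exchanges \<open>F\<^sup>+\<close> and \<open>F\<^sup>-\<close>,
  which affects neither the Bach nor the Cotton condition.\<close>

definition hodge ::
  "real^4^4 \<Rightarrow> (4 \<Rightarrow> (n_space, real) form1) \<Rightarrow> (4 \<Rightarrow> n_space \<Rightarrow> n_space) \<Rightarrow>
   (n_space, mat6) form2 \<Rightarrow> (n_space, mat6) form2" where
  "hodge \<eta> \<theta> e B x u v =
     (\<Sum>k\<in>UNIV. \<Sum>l\<in>UNIV. (\<theta> k x u * \<theta> l x v) *\<^sub>R
        (\<Sum>i\<in>UNIV. \<Sum>j\<in>UNIV. \<Sum>m\<in>UNIV. \<Sum>n\<in>UNIV.
           (sqrt \<bar>det \<eta>\<bar> / 2 * eps4 i j k l * matrix_inv \<eta> $ i $ m * matrix_inv \<eta> $ j $ n)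
             *\<^sub>R B x (e m x) (e n x)))"

text \<open>\<open>F\<^sup>\<plusminus> = \<onehalf> (F \<mp> i *F)\<close> are the components of \<open>F\<close> with \<open>*F\<^sup>\<plusminus> = \<plusminus> i F\<^sup>\<plusminus>\<close>, since \<open>**F = -F\<close> in
  Lorentzian signature; the two signs correspond to \<open>\<sigma> = 1\<close> and \<open>\<sigma> = -1\<close>.\<close>

definition dual_part ::
  "real \<Rightarrow> real^4^4 \<Rightarrow> (4 \<Rightarrow> (n_space, real) form1) \<Rightarrow> (4 \<Rightarrow> n_space \<Rightarrow> n_space) \<Rightarrow>
   (n_space, mat6) form2 \<Rightarrow> (n_space, mat6) form2" where
  "dual_part \<sigma> \<eta> \<theta> e F x u v =
     (\<chi> r s. (F x u v $ r $ s - of_real \<sigma> * \<i> * hodge \<eta> \<theta> e F x u v $ r $ s) / 2)"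


subsection \<open>Conditions on a conformal class\<close>

text \<open>A conformal class \<open>C\<close> is given by the set \<open>C V\<close> of its metrics on each open set \<open>V\<close>. The
  conditions are required for every choice of a local metric in the class and of an adapted
  coframe; being invariant under gauge transformations \<open>F \<mapsto> h\<^sup>-\<^sup>1 F h\<close> of the connection, they
  hold for all choices near a point as soon as they hold for one.\<close>

definition cartan_gauge ::
  "(n_space set \<Rightarrow> metric set) \<Rightarrow> n_space set \<Rightarrow> real^4^4 \<Rightarrow> (4 \<Rightarrow> (n_space, real) form1) \<Rightarrow>
   (4 \<Rightarrow> n_space \<Rightarrow> n_space) \<Rightarrow> (4 \<Rightarrow> 4 \<Rightarrow> (n_space, real) form1) \<Rightarrow> bool" where
  "cartan_gauge C V \<eta> \<theta> e \<Gamma> \<longleftrightarrow>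
     open V \<and> (\<exists>g\<in>C V. adapted_coframe V g \<eta> \<theta> e) \<and> levi_civita V \<eta> \<theta> \<Gamma>"

definition curvature_vanishes :: "(n_space set \<Rightarrow> metric set) \<Rightarrow> n_space set \<Rightarrow> bool" where
  "curvature_vanishes C W \<longleftrightarrow>
     (\<forall>V \<eta> \<theta> e \<Gamma>. V \<subseteq> W \<longrightarrow> cartan_gauge C V \<eta> \<theta> e \<Gamma> \<longrightarrow>
        (\<forall>x\<in>V. \<forall>u v. conn_curvature (normal_connection \<eta> \<theta> e \<Gamma>) x u v = 0))"

definition bach_condition :: "(n_space set \<Rightarrow> metric set) \<Rightarrow> n_space set \<Rightarrow> bool" where
  "bach_condition C W \<longleftrightarrow>
     (\<forall>V \<eta> \<theta> e \<Gamma>. V \<subseteq> W \<longrightarrow> cartan_gauge C V \<eta> \<theta> e \<Gamma> \<longrightarrow>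
        (let A = normal_connection \<eta> \<theta> e \<Gamma>; F = conn_curvature A in
          \<forall>x\<in>V. \<forall>u v w. cov_d2 A (hodge \<eta> \<theta> e F) x u v w = 0))"

definition cotton_condition :: "(n_space set \<Rightarrow> metric set) \<Rightarrow> n_space set \<Rightarrow> bool" where
  "cotton_condition C W \<longleftrightarrow>
     (\<forall>V \<eta> \<theta> e \<Gamma>. V \<subseteq> W \<longrightarrow> cartan_gauge C V \<eta> \<theta> e \<Gamma> \<longrightarrow>
        (let F = conn_curvature (normal_connection \<eta> \<theta> e \<Gamma>);
             Fp = dual_part 1 \<eta> \<theta> e F; Fm = dual_part (-1) \<eta> \<theta> e F in
          \<forall>x\<in>V. \<forall>i j k l.
            Fp x (e i x) (e j x) ** Fm x (e k x) (e l x)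
              - Fm x (e k x) (e l x) ** Fp x (e i x) (e j x) = 0))"

definition minkowski :: "real^4 \<Rightarrow> real^4 \<Rightarrow> real" where
  "minkowski u v = - (u $ 0 * v $ 0) + u $ 1 * v $ 1 + u $ 2 * v $ 2 + u $ 3 * v $ 3"

text \<open>Near every point the pullback of the Minkowski metric by some smooth map \<open>y\<close> into \<open>\<real>\<^sup>4\<close> belongs
  to the class. For the (nondegenerate) classes \<open>[g\<^sub>t]\<close> such a \<open>y\<close> is a local coordinate system.\<close>

definition conformally_flat :: "(n_space set \<Rightarrow> metric set) \<Rightarrow> n_space set \<Rightarrow> bool" where
  "conformally_flat C W \<longleftrightarrow>
     (\<forall>z\<in>W. \<exists>V (y :: n_space \<Rightarrow> real^4). open V \<and> z \<in> V \<and> V \<subseteq> W \<and> smooth_on V y \<and>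
        (\<lambda>x u v. minkowski (frechet_derivative y (at x) u) (frechet_derivative y (at x) v)) \<in> C V)"

end

theory Submission
  imports Defs
begin

text \<open>On the slice \<open>\<rho> = 1\<close> of \<open>P\<close> the invariant coframe restricts to \<open>\<omega>, \<omega>\<^sub>1, \<Omega>\<close> on \<open>N\<close> with
  \<open>d\<omega> = i \<omega>\<^sub>1 \<and> \<omega>\<^sub>1' + (\<Omega> + \<Omega>') \<and> \<omega>\<close>, \<open>d\<omega>\<^sub>1 = \<Omega> \<and> \<omega>\<^sub>1\<close>, \<open>d\<Omega> = K \<omega>\<^sub>1 \<and> \<omega>\<close> (primes denote conjugates), and
  every metric of \<open>[g\<^sub>t]\<close> has this shape after a rescaling of the coframe. In the null coframe
  \<open>\<omega>\<^sub>1, \<omega>\<^sub>1', \<omega>, Im \<Omega>\<close> one can write down a \<open>6 \<times> 6\<close> connection explicitly; it is gauge equivalent to the normal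
  conformal connection of any adapted coframe, because the Levi-Civita connection is unique and the
  Weyl trace vanishes. For \<open>t = 1\<close> and \<open>t = -1/3\<close> its curvature is a sum of two parts of opposite duality,
  proportional to \<open>K\<close> and to its conjugate, with constant matrix values up to covariant derivatives of \<open>K\<close>; the
  Bach condition is the Bianchi identity together with \<open>d\<^sup>2\<Omega> = 0\<close>, and the commutators of the two parts
  do not vanish where \<open>K \<noteq> 0\<close>. If \<open>K = 0\<close>, then \<open>\<Omega>\<close> is closed, and successive applications of the
  Poincare lemma give coordinates in which the metric is a multiple of the Minkowski metric.\<close>

section \<open>Smooth functions\<close>

text \<open>The conditions are required for every adapted coframe, and in such a coframe the
  curvature is unmanageable. The explicit connection therefore lives in a Weyl gauge: the real part
  of \<Omega> stays in the corner entry instead of being normalised to zero. All entries are then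
  multiples, with coefficients depending only on t, of the invariant forms and of K times such
  forms, so that exterior derivatives use nothing but the structure equations. The change to an
  adapted coframe is one block triangular matrix, a complex change of coframe combined with a
  conformal translation that removes the corner entry. The Bianchi identity only says that the
  covariant derivatives of the two dual parts of the curvature cancel each other; the Bach condition
  needs each of them to vanish. In the top row of the derivative of the K-part one term is left,
  with coefficient (1 - t)(1 + 3t)/4 times |K|^2. This is the origin of the two values of t. The
  Weyl part carries the factor (3t - 1)/4, which is nonzero at both values and yields the negative
  statements.\<close>

primrec nsmooth_on :: "nat \<Rightarrow> 'e::real_normed_vector set \<Rightarrow> ('e \<Rightarrow> 'b::real_normed_vector) \<Rightarrow> bool" where
  "nsmooth_on 0 S f \<longleftrightarrow> (\<forall>x\<in>S. f differentiable at x)"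
| "nsmooth_on (Suc n) S f \<longleftrightarrow> (\<forall>x\<in>S. f differentiable at x) \<and>
     (\<forall>v. nsmooth_on n S (\<lambda>x. frechet_derivative f (at x) v))"

text \<open>\<open>foldr\<close> applies the last entry of the list first, so the innermost
  derivative is peeled off by splitting the list at its end.\<close>

lemma smooth_on_step:
  "smooth_on S f \<longleftrightarrow> (\<forall>x\<in>S. f differentiable at x) \<and>
     (\<forall>v. smooth_on S (\<lambda>x. frechet_derivative f (at x) v))"
proof
  assume f: "smooth_on S f"
  show "(\<forall>x\<in>S. f differentiable at x) \<and> (\<forall>v. smooth_on S (\<lambda>x. frechet_derivative f (at x) v))"
  proof (intro conjI allI)
    show "\<forall>x\<in>S. f differentiable at x"
      using f[unfolded smooth_on_def, rule_format, of _ "[]"] by simp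
    show "smooth_on S (\<lambda>x. frechet_derivative f (at x) v)" for v
      unfolding smooth_on_def
      using f[unfolded smooth_on_def, rule_format, of _ "_ @ [v]"] by simp
  qed
next
  assume *: "(\<forall>x\<in>S. f differentiable at x) \<and> (\<forall>v. smooth_on S (\<lambda>x. frechet_derivative f (at x) v))"
  show "smooth_on S f"
    unfolding smooth_on_def
  proof (intro allI)
    fix vs :: "'a list"
    show "\<forall>x\<in>S. foldr (\<lambda>v h y. frechet_derivative h (at y) v) vs f differentiable (at x)"
    proof (cases vs rule: rev_cases)
      case Nil
      then show ?thesis using * by simp
    next
      case (snoc ys v)
      then show ?thesis using *[unfolded smooth_on_def] by simp
    qed
  qed
qed

text \<open>Induction on the order \<open>n\<close> with the function arbitrary replaces induction
  on lists of directions; the closure properties below are proved for \<open>nsmooth_on\<close> and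
  transferred.\<close>

lemma smooth_on_iff_nsmooth_on: "smooth_on S f \<longleftrightarrow> (\<forall>n. nsmooth_on n S f)"
proof
  have "nsmooth_on n S f" if "smooth_on S f" for n
    using that
  proof (induction n arbitrary: f)
    case 0
    then show ?case using smooth_on_step[of S f] by simp
  next
    case (Suc n)
    then show ?case using smooth_on_step[of S f] by simp
  qed
  then show "smooth_on S f \<Longrightarrow> \<forall>n. nsmooth_on n S f" by simp
next
  have "\<forall>x\<in>S. foldr (\<lambda>v h y. frechet_derivative h (at y) v) vs f differentiable (at x)"
    if "\<forall>n. nsmooth_on n S f" for vs
    using that
  proof (induction vs arbitrary: f rule: rev_induct)
    case Nil
    then show ?case using nsmooth_on.simps(1)[of S f] by simp
  next
    case (snoc v vs)
    have "\<forall>n. nsmooth_on n S (\<lambda>x. frechet_derivative f (at x) v)"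
      using snoc.prems nsmooth_on.simps(2)[of _ S f] by blast
    from snoc.IH[OF this] show ?case by simp
  qed
  then show "\<forall>n. nsmooth_on n S f \<Longrightarrow> smooth_on S f"
    by (simp add: smooth_on_def)
qed

lemma smooth_on_differentiable: "smooth_on S f \<Longrightarrow> x \<in> S \<Longrightarrow> f differentiable at x"
  by (subst (asm) smooth_on_step) simp

lemma smooth_on_has_derivative:
  "smooth_on S f \<Longrightarrow> x \<in> S \<Longrightarrow> (f has_derivative frechet_derivative f (at x)) (at x)"
  using smooth_on_differentiable frechet_derivative_works by blast

lemma smooth_on_frechet_derivative:
  "smooth_on S f \<Longrightarrow> smooth_on S (\<lambda>x. frechet_derivative f (at x) v)"
  by (subst (asm) smooth_on_step) simp

lemma smooth_on_continuous_on: "smooth_on S f \<Longrightarrow> continuous_on S f"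
  by (meson continuous_at_imp_continuous_on differentiable_imp_continuous_within smooth_on_differentiable)

lemma smooth_on_subset: "smooth_on S f \<Longrightarrow> T \<subseteq> S \<Longrightarrow> smooth_on T f"
  by (auto simp: smooth_on_def)

lemma nsmooth_on_differentiable: "nsmooth_on n S f \<Longrightarrow> x \<in> S \<Longrightarrow> f differentiable at x"
  by (cases n) auto

lemma nsmooth_on_SucD: "nsmooth_on (Suc n) S f \<Longrightarrow> nsmooth_on n S f"
  by (induction n arbitrary: f) auto

lemma has_derivative_cong_open:
  assumes "open S" "x \<in> S" "\<And>y. y \<in> S \<Longrightarrow> f y = g y" "(f has_derivative D) (at x)"
  shows "(g has_derivative D) (at x)"
  by (rule has_derivative_transform_within_open[OF assms(4) assms(1,2,3)])

text \<open>\<open>frechet_derivative\<close> is a choice from the predicate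
  \<open>has_derivative\<close>; both functions satisfy this predicate for the same maps, so the
  choices agree even where no derivative exists.\<close>

lemma frechet_derivative_cong_open:
  assumes "open S" "x \<in> S" "\<And>y. y \<in> S \<Longrightarrow> f y = g y"
  shows "frechet_derivative f (at x) = frechet_derivative g (at x)"
proof -
  have "(f has_derivative D) (at x) \<longleftrightarrow> (g has_derivative D) (at x)" for D
    by (rule iffI; erule has_derivative_cong_open[OF assms(1,2), rotated]; simp only: assms(3))
  then show ?thesis by (simp only: frechet_derivative_def)
qed

lemma differentiable_cong_open:
  assumes "open S" "x \<in> S" "\<And>y. y \<in> S \<Longrightarrow> f y = g y" "f differentiable at x"
  shows "g differentiable at x"
proof -
  obtain D where D: "(f has_derivative D) (at x)" using assms(4) unfolding differentiable_def by (rule exE)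
  show ?thesis by (rule differentiableI, rule has_derivative_cong_open[OF assms(1,2,3) D])
qed

lemma nsmooth_on_cong:
  assumes "open S" "nsmooth_on n S f" "\<And>x. x \<in> S \<Longrightarrow> f x = g x"
  shows "nsmooth_on n S g"
  using assms(2,3)
proof (induction n arbitrary: f g)
  case 0
  show ?case
    unfolding nsmooth_on.simps
    by (rule ballI, rule differentiable_cong_open[OF assms(1) _ 0(2)], assumption, assumption,
        rule nsmooth_on_differentiable[OF 0(1)])
next
  case (Suc n)
  have "\<forall>x\<in>S. g differentiable at x"
    by (rule ballI, rule differentiable_cong_open[OF assms(1) _ Suc.prems(2)], assumption, assumption,
        rule nsmooth_on_differentiable[OF Suc.prems(1)])
  moreover have "nsmooth_on n S (\<lambda>x. frechet_derivative g (at x) v)" for v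
  proof (rule Suc.IH)
    show "nsmooth_on n S (\<lambda>x. frechet_derivative f (at x) v)"
      using Suc.prems(1) by simp
    show "frechet_derivative f (at x) v = frechet_derivative g (at x) v" if "x \<in> S" for x
      by (rule fun_cong[OF frechet_derivative_cong_open[OF assms(1) that Suc.prems(2)]])
  qed
  ultimately show ?case by simp
qed

lemma smooth_on_cong:
  assumes "open S" "smooth_on S f" "\<And>x. x \<in> S \<Longrightarrow> f x = g x"
  shows "smooth_on S g"
  unfolding smooth_on_iff_nsmooth_on
  by (rule allI, rule nsmooth_on_cong[OF assms(1) _ assms(3)])
    (use assms(2) in \<open>simp_all add: smooth_on_iff_nsmooth_on\<close>)

text \<open>Lets an induction step work with an explicit formula for the derivative, which has to be
  correct on \<open>S\<close> only.\<close>

lemma nsmooth_on_SucI: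
  assumes "open S" "\<And>x. x \<in> S \<Longrightarrow> (f has_derivative f' x) (at x)"
    "\<And>v. nsmooth_on n S (\<lambda>x. f' x v)"
  shows "nsmooth_on (Suc n) S f"
proof -
  have "f' x v = frechet_derivative f (at x) v" if "x \<in> S" for x v
    by (rule fun_cong[OF frechet_derivative_at[OF assms(2)[OF that]]])
  then have "nsmooth_on n S (\<lambda>x. frechet_derivative f (at x) v)" for v
    by (rule nsmooth_on_cong[OF assms(1) assms(3)[of v]])
  moreover have "f differentiable at x" if "x \<in> S" for x
    using assms(2)[OF that] by (rule differentiableI)
  ultimately show ?thesis by simp
qed

lemma nsmooth_on_const: "nsmooth_on n S (\<lambda>x. c)"
  by (induction n arbitrary: c) (auto simp: frechet_derivative_const)

lemma smooth_on_const [intro, simp]: "smooth_on S (\<lambda>x. c)"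
  by (simp add: smooth_on_iff_nsmooth_on nsmooth_on_const)

lemma nsmooth_on_has_derivative:
  "nsmooth_on n S f \<Longrightarrow> x \<in> S \<Longrightarrow> (f has_derivative frechet_derivative f (at x)) (at x)"
  using nsmooth_on_differentiable frechet_derivative_works by blast

lemma nsmooth_on_linear:
  assumes "bounded_linear L" "open S"
  shows "nsmooth_on n S f \<Longrightarrow> nsmooth_on n S (\<lambda>x. L (f x))"
proof (induction n arbitrary: f)
  case 0
  show ?case
    unfolding nsmooth_on.simps
    by (intro ballI differentiableI, rule bounded_linear.has_derivative[OF assms(1)],
        rule nsmooth_on_has_derivative[OF 0])
next
  case (Suc n)
  show ?case
  proof (rule nsmooth_on_SucI[OF assms(2)])
    show "((\<lambda>x. L (f x)) has_derivative (\<lambda>v. L (frechet_derivative f (at x) v))) (at x)" if "x \<in> S" for x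
      by (rule bounded_linear.has_derivative[OF assms(1)], rule nsmooth_on_has_derivative[OF Suc.prems that])
    show "nsmooth_on n S (\<lambda>x. L (frechet_derivative f (at x) v))" for v
      by (rule Suc.IH) (use Suc.prems in simp)
  qed
qed

lemma nsmooth_on_id: "open S \<Longrightarrow> nsmooth_on n S (\<lambda>x. x)"
  by (cases n) (auto simp: frechet_derivative_ident nsmooth_on_const)

lemma nsmooth_on_bounded_linear: "bounded_linear L \<Longrightarrow> open S \<Longrightarrow> nsmooth_on n S L"
  by (rule nsmooth_on_linear[OF _ _ nsmooth_on_id])

lemma nsmooth_on_add:
  assumes "open S"
  shows "nsmooth_on n S f \<Longrightarrow> nsmooth_on n S g \<Longrightarrow> nsmooth_on n S (\<lambda>x. f x + g x)"
proof (induction n arbitrary: f g)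
  case (Suc n)
  show ?case
  proof (rule nsmooth_on_SucI[OF assms])
    show "((\<lambda>x. f x + g x) has_derivative
        (\<lambda>v. frechet_derivative f (at x) v + frechet_derivative g (at x) v)) (at x)" if "x \<in> S" for x
      by (rule has_derivative_add; rule nsmooth_on_has_derivative[OF _ that], rule Suc.prems)
    show "nsmooth_on n S (\<lambda>x. frechet_derivative f (at x) v + frechet_derivative g (at x) v)" for v
      by (rule Suc.IH) (use Suc.prems in simp_all)
  qed
qed simp

lemma nsmooth_on_bilinear:
  assumes "bounded_bilinear p" "open S"
  shows "nsmooth_on n S f \<Longrightarrow> nsmooth_on n S g \<Longrightarrow> nsmooth_on n S (\<lambda>x. p (f x) (g x))"
proof (induction n arbitrary: f g)
  case 0
  show ?case
    unfolding nsmooth_on.simps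
    by (intro ballI differentiableI, rule bounded_bilinear.FDERIV[OF assms(1)];
        rule nsmooth_on_has_derivative, rule 0)
next
  case (Suc n)
  show ?case
  proof (rule nsmooth_on_SucI[OF assms(2)])
    show "((\<lambda>x. p (f x) (g x)) has_derivative (\<lambda>v. p (f x) (frechet_derivative g (at x) v)
        + p (frechet_derivative f (at x) v) (g x))) (at x)" if "x \<in> S" for x
      by (rule bounded_bilinear.FDERIV[OF assms(1)]; rule nsmooth_on_has_derivative[OF _ that], rule Suc.prems)
    show "nsmooth_on n S (\<lambda>x. p (f x) (frechet_derivative g (at x) v)
        + p (frechet_derivative f (at x) v) (g x))" for v
      using Suc.prems nsmooth_on_SucD[OF Suc.prems(1)] nsmooth_on_SucD[OF Suc.prems(2)]
      by (intro nsmooth_on_add[OF assms(2)]; intro Suc.IH) simp_all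
  qed
qed

lemma nsmooth_on_sum:
  assumes "open S" "\<And>i. i \<in> I \<Longrightarrow> nsmooth_on n S (f i)"
  shows "nsmooth_on n S (\<lambda>x. \<Sum>i\<in>I. f i x)"
  using assms(2)
proof (induction I rule: infinite_finite_induct)
  case (insert i I)
  then show ?case by (simp add: nsmooth_on_add[OF assms(1), of n "f i" "\<lambda>x. \<Sum>i\<in>I. f i x"])
qed (simp_all add: nsmooth_on_const)

text \<open>By the chain rule the derivative of \<open>g\<close> is taken in a direction that varies
  with \<open>x\<close>, whereas the induction hypothesis speaks of fixed directions. Expanding the
  direction in \<open>Basis\<close> leaves products of scalar functions with derivatives of
  \<open>g\<close> in fixed directions; this is why the middle space is Euclidean.\<close>

lemma nsmooth_on_compose:
  fixes f :: "'a::real_normed_vector \<Rightarrow> 'c::euclidean_space" and g :: "'c \<Rightarrow> 'b::real_normed_vector"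
  assumes "open S" "\<And>x. x \<in> S \<Longrightarrow> f x \<in> T"
  shows "nsmooth_on n S f \<Longrightarrow> nsmooth_on n T g \<Longrightarrow> nsmooth_on n S (\<lambda>x. g (f x))"
proof (induction n arbitrary: g)
  case 0
  show ?case
    unfolding nsmooth_on.simps
  proof
    fix x assume x: "x \<in> S"
    show "(\<lambda>x. g (f x)) differentiable at x"
      using differentiable_chain_at[OF nsmooth_on_differentiable[OF 0(1) x]
          nsmooth_on_differentiable[OF 0(2) assms(2)[OF x]]]
      by (simp only: o_def)
  qed
next
  case (Suc n)
  show ?case
  proof (rule nsmooth_on_SucI[OF assms(1)])
    fix x assume x: "x \<in> S"
    have df: "(f has_derivative frechet_derivative f (at x)) (at x)"
      by (rule nsmooth_on_has_derivative[OF Suc.prems(1) x])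
    have dg: "(g has_derivative frechet_derivative g (at (f x))) (at (f x))"
      by (rule nsmooth_on_has_derivative[OF Suc.prems(2) assms(2)[OF x]])
    have *: "frechet_derivative g (at (f x)) w = (\<Sum>b\<in>Basis. (w \<bullet> b) *\<^sub>R frechet_derivative g (at (f x)) b)" for w
    proof -
      interpret bounded_linear "frechet_derivative g (at (f x))"
        using dg by (rule has_derivative_bounded_linear)
      have "frechet_derivative g (at (f x)) (\<Sum>b\<in>Basis. (w \<bullet> b) *\<^sub>R b)
          = (\<Sum>b\<in>Basis. (w \<bullet> b) *\<^sub>R frechet_derivative g (at (f x)) b)"
        by (simp only: sum scaleR)
      then show ?thesis by (simp only: euclidean_representation)
    qed
    show "((\<lambda>x. g (f x)) has_derivative (\<lambda>v. \<Sum>b\<in>Basis.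
        (frechet_derivative f (at x) v \<bullet> b) *\<^sub>R frechet_derivative g (at (f x)) b)) (at x)"
      using diff_chain_at[OF df dg] unfolding o_def *[symmetric] .
  next
    fix v
    have "nsmooth_on n S f" using Suc.prems(1) nsmooth_on_SucD by blast
    then have g: "nsmooth_on n S (\<lambda>x. frechet_derivative g (at (f x)) b)" for b
      by (rule Suc.IH) (use Suc.prems(2) in simp)
    have f: "nsmooth_on n S (\<lambda>x. frechet_derivative f (at x) v \<bullet> b)" for b
      by (rule nsmooth_on_linear[OF bounded_linear_inner_left assms(1)]) (use Suc.prems(1) in simp)
    show "nsmooth_on n S (\<lambda>x. \<Sum>b\<in>Basis. (frechet_derivative f (at x) v \<bullet> b) *\<^sub>R frechet_derivative g (at (f x)) b)"
      by (rule nsmooth_on_sum[OF assms(1)], rule nsmooth_on_bilinear[OF bounded_bilinear_scaleR assms(1) f g])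
  qed
qed

section \<open>Closure properties of smooth functions\<close>

context
  fixes S :: "'a::real_normed_vector set"
  assumes S: "open S"
begin

lemma smooth_on_linear: "bounded_linear L \<Longrightarrow> smooth_on S f \<Longrightarrow> smooth_on S (\<lambda>x. L (f x))"
  unfolding smooth_on_iff_nsmooth_on by (rule allI, rule nsmooth_on_linear) (simp_all add: S)

lemma smooth_on_bounded_linear: "bounded_linear L \<Longrightarrow> smooth_on S L"
  unfolding smooth_on_iff_nsmooth_on by (rule allI, rule nsmooth_on_bounded_linear) (simp_all add: S)

lemma smooth_on_bilinear:
  "bounded_bilinear p \<Longrightarrow> smooth_on S f \<Longrightarrow> smooth_on S g \<Longrightarrow> smooth_on S (\<lambda>x. p (f x) (g x))"
  unfolding smooth_on_iff_nsmooth_on by (rule allI, rule nsmooth_on_bilinear) (simp_all add: S)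

lemma smooth_on_add: "smooth_on S f \<Longrightarrow> smooth_on S g \<Longrightarrow> smooth_on S (\<lambda>x. f x + g x)"
  unfolding smooth_on_iff_nsmooth_on by (rule allI, rule nsmooth_on_add) (simp_all add: S)

lemma smooth_on_minus: "smooth_on S f \<Longrightarrow> smooth_on S (\<lambda>x. - f x)"
  by (rule smooth_on_linear[OF bounded_linear_minus[OF bounded_linear_ident]])

lemma smooth_on_diff: "smooth_on S f \<Longrightarrow> smooth_on S g \<Longrightarrow> smooth_on S (\<lambda>x. f x - g x)"
  using smooth_on_add[of f "\<lambda>x. - g x"] smooth_on_minus[of g] by simp

lemma smooth_on_mult:
  fixes f g :: "'a \<Rightarrow> 'b::real_normed_algebra"
  shows "smooth_on S f \<Longrightarrow> smooth_on S g \<Longrightarrow> smooth_on S (\<lambda>x. f x * g x)"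
  by (rule smooth_on_bilinear[OF bounded_bilinear_mult])

lemma smooth_on_sum: "(\<And>i. i \<in> I \<Longrightarrow> smooth_on S (f i)) \<Longrightarrow> smooth_on S (\<lambda>x. \<Sum>i\<in>I. f i x)"
  unfolding smooth_on_iff_nsmooth_on by (rule allI, rule nsmooth_on_sum) (simp_all add: S)

lemma smooth_on_prod:
  fixes f :: "'i \<Rightarrow> 'a \<Rightarrow> 'b::{real_normed_algebra, comm_ring_1}"
  shows "(\<And>i. i \<in> I \<Longrightarrow> smooth_on S (f i)) \<Longrightarrow> smooth_on S (\<lambda>x. \<Prod>i\<in>I. f i x)"
proof (induction I rule: infinite_finite_induct)
  case (insert i I)
  then show ?case by (simp add: smooth_on_mult[of "f i" "\<lambda>x. \<Prod>i\<in>I. f i x"])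
qed simp_all

lemma smooth_on_power:
  fixes f :: "'a \<Rightarrow> 'b::{real_normed_algebra, comm_ring_1}"
  shows "smooth_on S f \<Longrightarrow> smooth_on S (\<lambda>x. f x ^ n)"
proof (induction n)
  case (Suc n)
  show ?case unfolding power_Suc by (rule smooth_on_mult[OF Suc.prems Suc.IH[OF Suc.prems]])
qed simp

lemma smooth_on_of_real: "smooth_on S f \<Longrightarrow> smooth_on S (\<lambda>x. of_real (f x) :: 'b::{real_normed_algebra_1})"
  by (rule smooth_on_linear[OF bounded_linear_of_real])

lemma smooth_on_cnj: "smooth_on S f \<Longrightarrow> smooth_on S (\<lambda>x. cnj (f x))"
  by (rule smooth_on_linear[OF bounded_linear_cnj])

lemma smooth_on_Re: "smooth_on S f \<Longrightarrow> smooth_on S (\<lambda>x. Re (f x))"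
  by (rule smooth_on_linear[OF bounded_linear_Re])

lemma smooth_on_Im: "smooth_on S f \<Longrightarrow> smooth_on S (\<lambda>x. Im (f x))"
  by (rule smooth_on_linear[OF bounded_linear_Im])

lemma smooth_on_vec_nth: "smooth_on S f \<Longrightarrow> smooth_on S (\<lambda>x. f x $ i)"
  by (rule smooth_on_linear[OF bounded_linear_vec_nth])

lemma smooth_on_compose:
  fixes f :: "'a \<Rightarrow> 'c::euclidean_space"
  shows "smooth_on S f \<Longrightarrow> smooth_on T g \<Longrightarrow> (\<And>x. x \<in> S \<Longrightarrow> f x \<in> T) \<Longrightarrow> smooth_on S (\<lambda>x. g (f x))"
  unfolding smooth_on_iff_nsmooth_on
  by (rule allI, erule allE, erule allE, rule nsmooth_on_compose[OF S])

end

text \<open>The function is the finite sum of its components, each embedded by a bounded linear map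
  \<open>L i\<close>.\<close>

lemma smooth_on_vec:
  fixes f :: "'a::real_normed_vector \<Rightarrow> 'b::real_normed_vector^'n"
  assumes S: "open S" and "\<And>i. smooth_on S (\<lambda>x. f x $ i)"
  shows "smooth_on S f"
proof -
  define L where "L i y = (\<chi> j. if j = i then y else (0 :: 'b))" for i :: 'n and y :: 'b
  have L_nth: "L i y $ j = (if j = i then y else 0)" for i j y
    by (simp add: L_def)
  have "bounded_linear (L i)" for i
  proof (rule bounded_linear_intro[where K = 1])
    show "L i (x + y) = L i x + L i y" for x y
      by (simp add: vec_eq_iff L_nth)
    show "L i (r *\<^sub>R x) = r *\<^sub>R L i x" for r x
      by (simp add: vec_eq_iff L_nth)
    show "norm (L i x) \<le> norm x * 1" for x
    proof -
      have "norm (L i x) \<le> (\<Sum>j\<in>UNIV. norm (L i x $ j))"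
        unfolding norm_vec_def by (rule L2_set_le_sum) simp
      also have "\<dots> = (\<Sum>j\<in>UNIV. if j = i then norm x else 0)"
        by (rule sum.cong) (simp_all add: L_nth)
      finally show ?thesis by simp
    qed
  qed
  from smooth_on_linear[OF S this assms(2)]
  have "smooth_on S (\<lambda>x. L i (f x $ i))" for i .
  then have "smooth_on S (\<lambda>x. \<Sum>i\<in>UNIV. L i (f x $ i))"
    by (rule smooth_on_sum[OF S])
  moreover have "(\<Sum>i\<in>UNIV. L i (f x $ i)) = f x" for x
    by (simp add: vec_eq_iff L_nth)
  ultimately show ?thesis by (simp only:)
qed

text \<open>A bootstrap for functions satisfying a differential equation: if the derivative is built
  from \<open>f\<close> by operations preserving order \<open>n\<close>, then order \<open>n\<close>
  of \<open>f\<close> gives order \<open>n + 1\<close>. Applied to \<open>exp\<close>,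
  \<open>inverse\<close> and \<open>tan\<close>.\<close>

lemma smooth_onI_recursive:
  fixes f :: "'a::real_normed_vector \<Rightarrow> 'b::real_normed_vector"
  assumes "open S" "\<And>x. x \<in> S \<Longrightarrow> (f has_derivative f' x) (at x)"
    and "\<And>n v. nsmooth_on n S f \<Longrightarrow> nsmooth_on n S (\<lambda>x. f' x v)"
  shows "smooth_on S f"
proof -
  have "nsmooth_on n S f" for n
  proof (induction n)
    case 0
    show ?case unfolding nsmooth_on.simps by (rule ballI, rule differentiableI, rule assms(2))
  next
    case (Suc n)
    show ?case by (rule nsmooth_on_SucI[OF assms(1,2) assms(3)[OF Suc]])
  qed
  then show ?thesis by (simp add: smooth_on_iff_nsmooth_on)
qed

lemma smooth_onI_deriv:
  assumes "open S" "\<And>x. x \<in> S \<Longrightarrow> (f has_derivative f' x) (at x)" "\<And>v. smooth_on S (\<lambda>x. f' x v)"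
  shows "smooth_on S f"
  by (rule smooth_onI_recursive[OF assms(1,2)], assumption)
    (rule assms(3)[unfolded smooth_on_iff_nsmooth_on, rule_format])

section \<open>Smoothness of elementary functions\<close>

lemma smooth_on_exp_UNIV: "smooth_on UNIV (exp :: 'a::{real_normed_field, banach} \<Rightarrow> 'a)"
proof (rule smooth_onI_recursive)
  show "(exp has_derivative (\<lambda>v. exp x * v)) (at x)" for x :: 'a
    using DERIV_exp[of x] by (simp add: has_field_derivative_def)
  show "nsmooth_on n UNIV (\<lambda>x. exp x * v)" if "nsmooth_on n UNIV (exp :: 'a \<Rightarrow> 'a)" for n and v :: 'a
    by (rule nsmooth_on_linear[OF bounded_linear_mult_left open_UNIV that])
qed simp

lemma smooth_on_inverse_nonzero: "smooth_on (- {0}) (inverse :: 'a::real_normed_field \<Rightarrow> 'a)"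
proof (rule smooth_onI_recursive[where f' = "\<lambda>x v. - (inverse x * v * inverse x)"])
  show o: "open (- {0::'a})" by (rule open_Compl[OF closed_singleton])
  show "(inverse has_derivative (\<lambda>v. - (inverse x * v * inverse x))) (at x)" if "x \<in> - {0}" for x :: 'a
    using that has_derivative_inverse'[of x UNIV] by simp
  show "nsmooth_on n (- {0}) (\<lambda>x. - (inverse x * v * inverse x))"
    if "nsmooth_on n (- {0}) (inverse :: 'a \<Rightarrow> 'a)" for n and v :: 'a
    by (rule nsmooth_on_linear[OF bounded_linear_minus[OF bounded_linear_ident] o]
        nsmooth_on_bilinear[OF bounded_bilinear_mult o] that nsmooth_on_const)+
qed

lemma smooth_on_exp:
  fixes f :: "'a::real_normed_vector \<Rightarrow> 'b::{real_normed_field, euclidean_space}"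
  shows "open S \<Longrightarrow> smooth_on S f \<Longrightarrow> smooth_on S (\<lambda>x. exp (f x))"
  by (rule smooth_on_compose[OF _ _ smooth_on_exp_UNIV]) simp_all

lemma smooth_on_inverse:
  fixes f :: "'a::real_normed_vector \<Rightarrow> 'b::{real_normed_field, euclidean_space}"
  shows "open S \<Longrightarrow> smooth_on S f \<Longrightarrow> (\<And>x. x \<in> S \<Longrightarrow> f x \<noteq> 0) \<Longrightarrow> smooth_on S (\<lambda>x. inverse (f x))"
  by (rule smooth_on_compose[OF _ _ smooth_on_inverse_nonzero]) simp_all

lemma smooth_on_divide:
  fixes f g :: "'a::real_normed_vector \<Rightarrow> 'b::{real_normed_field, euclidean_space}"
  shows "open S \<Longrightarrow> smooth_on S f \<Longrightarrow> smooth_on S g \<Longrightarrow> (\<And>x. x \<in> S \<Longrightarrow> g x \<noteq> 0)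
    \<Longrightarrow> smooth_on S (\<lambda>x. f x / g x)"
  unfolding divide_inverse by (intro smooth_on_mult smooth_on_inverse)

lemma smooth_on_ln:
  fixes f :: "'a::real_normed_vector \<Rightarrow> real"
  assumes "open S" "smooth_on S f" "\<And>x. x \<in> S \<Longrightarrow> f x > 0"
  shows "smooth_on S (\<lambda>x. ln (f x))"
proof (rule smooth_onI_deriv[where f' = "\<lambda>x v. inverse (f x) * frechet_derivative f (at x) v"])
  show "((\<lambda>x. ln (f x)) has_derivative (\<lambda>v. inverse (f x) * frechet_derivative f (at x) v)) (at x)"
    if "x \<in> S" for x
    using assms that
    by (auto intro!: derivative_eq_intros smooth_on_has_derivative simp: field_simps fun_eq_iff)
  show "smooth_on S (\<lambda>x. inverse (f x) * frechet_derivative f (at x) v)" for v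
    using smooth_on_mult[OF assms(1) smooth_on_inverse[OF assms(1,2)] smooth_on_frechet_derivative[OF assms(2)]]
      assms(3) by force
qed fact

text \<open>The derivative 1 + tan^2 is polynomial in \<open>tan\<close>. The tangent enters through
  the flattening coordinates in the case of vanishing K.\<close>

lemma smooth_on_tan_cos_nonzero: "smooth_on {x::real. cos x \<noteq> 0} tan"
proof (rule smooth_onI_recursive[where f' = "\<lambda>x v. (1 + tan x * tan x) * v"])
  show o: "open {x::real. cos x \<noteq> 0}"
    by (intro open_Collect_neq continuous_intros)
  show "(tan has_derivative (\<lambda>v. (1 + tan x * tan x) * v)) (at x)" if "x \<in> {x::real. cos x \<noteq> 0}" for x
    using that DERIV_tan[of x] tan_sec[of x]
    by (simp add: has_field_derivative_def power2_eq_square)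
  show "nsmooth_on n {x::real. cos x \<noteq> 0} (\<lambda>x. (1 + tan x * tan x) * v)"
    if "nsmooth_on n {x::real. cos x \<noteq> 0} tan" for n v
    by (rule nsmooth_on_add[OF o] nsmooth_on_bilinear[OF bounded_bilinear_mult o] that nsmooth_on_const)+
qed

section \<open>Exterior derivatives\<close>

text \<open>Symmetry of second derivatives along the two-parameter family \<open>?p s t\<close>,
  obtained by differentiating under an integral sign. It is the source of every identity d^2 = 0
  below.\<close>

lemma frechet_derivative_commute:
  fixes f :: "'a::real_normed_vector \<Rightarrow> 'b::banach"
  assumes S: "open S" "x \<in> S" and f: "smooth_on S f"
  shows "frechet_derivative (\<lambda>y. frechet_derivative f (at y) v) (at x) u
       = frechet_derivative (\<lambda>y. frechet_derivative f (at y) u) (at x) v"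
proof -
  let ?p = "\<lambda>s t. x + s *\<^sub>R u + t *\<^sub>R v"
  define fu where "fu y = frechet_derivative f (at y) u" for y
  define fv where "fv y = frechet_derivative f (at y) v" for y
  define fuv where "fuv y = frechet_derivative fu (at y) v" for y
  have sm: "smooth_on S fu" "smooth_on S fv" "smooth_on S fuv"
    unfolding fu_def[abs_def] fv_def[abs_def] fuv_def[abs_def]
    by (intro smooth_on_frechet_derivative f)+
  have "open ((\<lambda>z. ?p (fst z) (snd z)) -` S)"
    by (intro continuous_open_vimage S continuous_intros)
  moreover have "(0, 0) \<in> (\<lambda>z. ?p (fst z) (snd z)) -` S" using S by simp
  ultimately obtain A B where AB: "open A" "open B" "(0::real) \<in> A" "(0::real) \<in> B"
    "A \<times> B \<subseteq> (\<lambda>z. ?p (fst z) (snd z)) -` S"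
    by (rule open_prod_elim) force
  obtain e1 where e1: "e1 > 0" "cball 0 e1 \<subseteq> A" using AB open_contains_cball by blast
  obtain e2 where e2: "e2 > 0" "cball 0 e2 \<subseteq> B" using AB open_contains_cball by blast
  define e where "e = min e1 e2"
  have e: "e > 0" using e1 e2 by (simp add: e_def)
  have inS: "?p s t \<in> S" if "\<bar>s\<bar> \<le> e" "\<bar>t\<bar> \<le> e" for s t
  proof -
    have "s \<in> A" "t \<in> B" using e1 e2 that by (auto simp: e_def subset_eq)
    then have "(s, t) \<in> A \<times> B" by simp
    then show ?thesis using AB(5) by fastforce
  qed
  have deriv_s: "((\<lambda>s. g (?p s t)) has_vector_derivative frechet_derivative g (at (?p s t)) u) (at s within T)"
    if "smooth_on S g" "?p s t \<in> S" for g :: "'a \<Rightarrow> 'b" and s t T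
  proof -
    have "((\<lambda>s. ?p s t) has_vector_derivative u) (at s within T)"
      by (auto intro!: derivative_eq_intros)
    from vector_derivative_diff_chain_within[OF this, of g "frechet_derivative g (at (?p s t))"]
    show ?thesis
      using smooth_on_has_derivative[OF that] by (auto simp: o_def intro: has_derivative_at_withinI)
  qed
  have deriv_t: "((\<lambda>t. g (?p s t)) has_vector_derivative frechet_derivative g (at (?p s t)) v) (at t within T)"
    if "smooth_on S g" "?p s t \<in> S" for g :: "'a \<Rightarrow> 'b" and s t T
  proof -
    have "((\<lambda>t. ?p s t) has_vector_derivative v) (at t within T)"
      by (auto intro!: derivative_eq_intros)
    from vector_derivative_diff_chain_within[OF this, of g "frechet_derivative g (at (?p s t))"]
    show ?thesis
      using smooth_on_has_derivative[OF that] by (auto simp: o_def intro: has_derivative_at_withinI)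
  qed
  \<comment> \<open>The fundamental theorem of calculus in the \<open>u\<close> direction, at each
    height \<open>t\<close>.\<close>
  have integ: "((\<lambda>r. fu (?p r t)) has_integral f (?p s t) - f (?p 0 t)) {0..s}"
    if "0 \<le> s" "s \<le> e" "\<bar>t\<bar> \<le> e" for s t
    unfolding fu_def
    by (rule fundamental_theorem_of_calculus[OF that(1)]) (rule deriv_s[OF f], rule inS, use that in auto)
  \<comment> \<open>The \<open>t\<close>-derivative of \<open>integ\<close> at 0 is computed once
    under the integral sign and once from the boundary values; uniqueness of the derivative equates
    the two.\<close>
  have eq: "fv (?p s 0) - fv x = integral {0..s} (\<lambda>r. fuv (?p r 0))" if s: "s \<in> {0..e}" for s
  proof -
    let ?T = "{-e..e}"
    have "((\<lambda>t. integral (cbox 0 s) (\<lambda>r. fu (?p r t))) has_vector_derivative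
        integral (cbox 0 s) (\<lambda>r. fuv (?p r 0))) (at 0 within ?T)"
    proof (rule leibniz_rule_vector_derivative)
      show "((\<lambda>t. fu (?p r t)) has_vector_derivative fuv (?p r t)) (at t within ?T)"
        if "t \<in> ?T" "r \<in> cbox 0 s" for t r
        unfolding fuv_def using that s by (intro deriv_t sm inS) auto
      show "(\<lambda>r. fu (?p r t)) integrable_on cbox 0 s" if "t \<in> ?T" for t
        using has_integral_integrable[OF integ[of s t]] s that by auto
      have "continuous_on (?T \<times> cbox 0 s) (\<lambda>z. fuv (?p (snd z) (fst z)))"
        by (rule continuous_on_compose2[OF smooth_on_continuous_on[OF sm(3)]])
          (use s in \<open>auto intro!: continuous_intros inS\<close>)
      then show "continuous_on (?T \<times> cbox 0 s) (\<lambda>(t, r). fuv (?p r t))"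
        by (simp add: case_prod_unfold)
    qed (use e in auto)
    moreover have "((\<lambda>t. integral (cbox 0 s) (\<lambda>r. fu (?p r t))) has_vector_derivative
        fv (?p s 0) - fv (?p 0 0)) (at 0 within ?T)"
    proof (rule has_vector_derivative_transform[where f = "\<lambda>t. f (?p s t) - f (?p 0 t)"])
      show "integral (cbox 0 s) (\<lambda>r. fu (?p r t)) = f (?p s t) - f (?p 0 t)" if "t \<in> ?T" for t
        using integral_unique[OF integ[of s t]] s that by auto
      show "((\<lambda>t. f (?p s t) - f (?p 0 t)) has_vector_derivative fv (?p s 0) - fv (?p 0 0)) (at 0 within ?T)"
        unfolding fv_def using s e by (intro has_vector_derivative_diff deriv_t f inS) auto
    qed (use e in auto)
    ultimately have "integral (cbox 0 s) (\<lambda>r. fuv (?p r 0)) = fv (?p s 0) - fv (?p 0 0)"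
      by (rule vector_derivative_unique_within_closed_interval[unfolded box_real, rotated 2]) (use e in auto)
    then show ?thesis by simp
  qed
  \<comment> \<open>Now \<open>eq\<close> is differentiated at \<open>s = 0\<close>: the integral
    gives \<open>fuv\<close>, the left side gives the derivative of \<open>fv\<close> in direction
    \<open>u\<close>. One-sided derivatives on \<open>{0..e}\<close> are enough for
    uniqueness.\<close>
  have "((\<lambda>s. fv (?p s 0) - fv x) has_vector_derivative fuv (?p 0 0)) (at 0 within {0..e})"
  proof (rule has_vector_derivative_transform[OF _ eq])
    have "continuous_on {0..e} (\<lambda>r. fuv (?p r 0))"
      by (rule continuous_on_compose2[OF smooth_on_continuous_on[OF sm(3)]])
        (use e in \<open>auto intro!: continuous_intros inS[of _ 0, simplified]\<close>)
    then show "((\<lambda>s. integral {0..s} (\<lambda>r. fuv (?p r 0))) has_vector_derivative fuv (?p 0 0)) (at 0 within {0..e})"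
      by (rule integral_has_vector_derivative) (use e in simp)
  qed (use e in auto)
  moreover have "((\<lambda>s. fv (?p s 0) - fv x) has_vector_derivative frechet_derivative fv (at (?p 0 0)) u - 0) (at 0 within {0..e})"
    by (intro has_vector_derivative_diff has_vector_derivative_const deriv_s sm) (use S in simp)
  ultimately have "fuv (?p 0 0) = frechet_derivative fv (at (?p 0 0)) u - 0"
    by (rule vector_derivative_unique_within_closed_interval[unfolded box_real, rotated 2]) (use e in auto)
  then show ?thesis by (simp add: fuv_def fu_def[abs_def] fv_def[abs_def])
qed

lemma ext_d_exact:
  fixes f :: "'a::real_normed_vector \<Rightarrow> 'b::banach"
  assumes "open S" "x \<in> S" "smooth_on S f"
  shows "ext_d (\<lambda>y v. frechet_derivative f (at y) v) x u v = 0"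
  using frechet_derivative_commute[OF assms, of v u] by (simp add: ext_d_def)

lemma smooth_form_exact:
  assumes "smooth_on S f"
  shows "smooth_form S (\<lambda>y v. frechet_derivative f (at y) v)"
  unfolding smooth_form_def
  using smooth_on_frechet_derivative[OF assms] has_derivative_linear[OF smooth_on_has_derivative[OF assms]]
  by blast

lemma smooth_formD:
  assumes "smooth_form S \<alpha>"
  shows "x \<in> S \<Longrightarrow> linear (\<alpha> x)" "smooth_on S (\<lambda>x. \<alpha> x v)"
    "x \<in> S \<Longrightarrow> (\<lambda>x. \<alpha> x v) differentiable at x"
  using assms smooth_on_differentiable unfolding smooth_form_def by blast+

lemma smooth_form_subset: "smooth_form S \<alpha> \<Longrightarrow> T \<subseteq> S \<Longrightarrow> smooth_form T \<alpha>"
  unfolding smooth_form_def using smooth_on_subset by blast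

text \<open>The primitive is the integral of \<alpha> along the straight segment from
  \<open>x0\<close>. Closedness turns the derivative of the integrand into a total derivative in the
  segment parameter.\<close>

lemma poincare_lemma:
  fixes \<alpha> :: "('a::euclidean_space, 'b::banach) form1"
  assumes S: "open S" "convex S" "x0 \<in> S" and \<alpha>: "smooth_form S \<alpha>"
    and closed: "\<And>x u v. x \<in> S \<Longrightarrow> ext_d \<alpha> x u v = 0"
  obtains F where "\<And>x. x \<in> S \<Longrightarrow> (F has_derivative \<alpha> x) (at x)" "F x0 = 0"
proof -
  define c where "c x s = x0 + s *\<^sub>R (x - x0)" for x s
  have cS: "c x s \<in> S" if "x \<in> S" "s \<in> {0..1}" for x s
  proof -
    have "c x s = (1 - s) *\<^sub>R x0 + s *\<^sub>R x" by (simp add: c_def algebra_simps)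
    then show ?thesis using S(2) that S(3) by (simp add: convex_alt)
  qed
  define d\<alpha> where "d\<alpha> y b = frechet_derivative (\<lambda>y. \<alpha> y b) (at y)" for y b
  have d\<alpha>: "((\<lambda>y. \<alpha> y b) has_derivative d\<alpha> y b) (at y)" if "y \<in> S" for y b
    unfolding d\<alpha>_def by (rule smooth_on_has_derivative[OF smooth_formD(2)[OF \<alpha>] that])
  have lin: "\<alpha> y w = (\<Sum>b\<in>Basis. (w \<bullet> b) *\<^sub>R \<alpha> y b)" if "y \<in> S" for y w
  proof -
    interpret linear "\<alpha> y" by (rule smooth_formD(1)[OF \<alpha> that])
    have "\<alpha> y (\<Sum>b\<in>Basis. (w \<bullet> b) *\<^sub>R b) = (\<Sum>b\<in>Basis. (w \<bullet> b) *\<^sub>R \<alpha> y b)"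
      by (simp only: sum scaleR)
    then show ?thesis by (simp only: euclidean_representation)
  qed
  have sym: "d\<alpha> y b u = d\<alpha> y u b" if "y \<in> S" for y b u
    using closed[OF that, of u b] by (simp add: ext_d_def d\<alpha>_def)
  have linear_d\<alpha>: "linear (d\<alpha> y b)" if "y \<in> S" for y b
    using has_derivative_linear[OF d\<alpha>[OF that]] .
  \<comment> \<open>The \<open>x\<close>-derivative of the integrand, with value slot and direction
    slot already interchanged by \<open>sym\<close>. In this form \<open>D x s u\<close> is the
    \<open>s\<close>-derivative of \<open>s *\<^sub>R \<alpha> (c x s) u\<close>.\<close>
  define D where "D x s u = s *\<^sub>R d\<alpha> (c x s) u (x - x0) + \<alpha> (c x s) u" for x s u
  have D_lin: "bounded_linear (D x s)" if "x \<in> S" "s \<in> {0..1}" for x s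
  proof -
    have "linear (D x s)"
    proof (rule linearI)
      note l = linear_d\<alpha>[OF cS[OF that]] smooth_formD(1)[OF \<alpha> cS[OF that]]
      show "D x s (u + v) = D x s u + D x s v" for u v
        by (simp add: D_def sym[OF cS[OF that], of _ "x - x0"] linear_add[OF l(1)] linear_add[OF l(2)] algebra_simps)
      show "D x s (r *\<^sub>R v) = r *\<^sub>R D x s v" for r v
        by (simp add: D_def sym[OF cS[OF that], of _ "x - x0"] linear_scale[OF l(1)] linear_scale[OF l(2)] algebra_simps)
    qed
    then show ?thesis by (simp add: linear_conv_bounded_linear)
  qed
  define F where "F x = integral (cbox 0 1) (\<lambda>s. \<alpha> (c x s) (x - x0))" for x
  have deriv: "((\<lambda>x. \<alpha> (c x s) (x - x0)) has_derivative D x s) (at x)" if "x \<in> S" "s \<in> {0..1}" for x s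
  proof -
    have dc: "((\<lambda>x. c x s) has_derivative (\<lambda>u. s *\<^sub>R u)) (at x)"
      unfolding c_def by (auto intro!: derivative_eq_intros simp: algebra_simps)
    have db: "((\<lambda>x. \<alpha> (c x s) b) has_derivative (\<lambda>u. d\<alpha> (c x s) b (s *\<^sub>R u))) (at x)" for b
      using diff_chain_at[OF dc d\<alpha>[OF cS[OF that]], of b] by (simp only: o_def)
    have *: "((\<lambda>x. \<Sum>b\<in>Basis. ((x - x0) \<bullet> b) *\<^sub>R \<alpha> (c x s) b) has_derivative
        (\<lambda>u. \<Sum>b\<in>Basis. ((x - x0) \<bullet> b) *\<^sub>R d\<alpha> (c x s) b (s *\<^sub>R u) + (u \<bullet> b) *\<^sub>R \<alpha> (c x s) b)) (at x)"
      by (rule has_derivative_sum, rule has_derivative_scaleR[OF _ db])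
        (auto intro!: derivative_eq_intros)
    have "(\<Sum>b\<in>Basis. ((x - x0) \<bullet> b) *\<^sub>R d\<alpha> (c x s) b (s *\<^sub>R u) + (u \<bullet> b) *\<^sub>R \<alpha> (c x s) b) = D x s u" for u
    proof -
      note l = linear_d\<alpha>[OF cS[OF that]]
      have "(\<Sum>b\<in>Basis. ((x - x0) \<bullet> b) *\<^sub>R d\<alpha> (c x s) b (s *\<^sub>R u))
          = (\<Sum>b\<in>Basis. ((x - x0) \<bullet> b) *\<^sub>R s *\<^sub>R d\<alpha> (c x s) u b)"
        by (rule sum.cong) (simp_all only: linear_scale[OF l] sym[OF cS[OF that], of _ u])
      also have "\<dots> = s *\<^sub>R (\<Sum>b\<in>Basis. ((x - x0) \<bullet> b) *\<^sub>R d\<alpha> (c x s) u b)"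
        by (simp add: scaleR_sum_right mult.commute)
      also have "(\<Sum>b\<in>Basis. ((x - x0) \<bullet> b) *\<^sub>R d\<alpha> (c x s) u b) = d\<alpha> (c x s) u (\<Sum>b\<in>Basis. ((x - x0) \<bullet> b) *\<^sub>R b)"
        by (simp only: linear_sum[OF l] linear_scale[OF l])
      finally show ?thesis
        by (simp only: sum.distrib D_def euclidean_representation lin[OF cS[OF that], of u])
    qed
    then have "((\<lambda>x. \<Sum>b\<in>Basis. ((x - x0) \<bullet> b) *\<^sub>R \<alpha> (c x s) b) has_derivative D x s) (at x)"
      using * by (simp only:)
    then show ?thesis
      by (rule has_derivative_transform_within_open[OF _ S(1) that(1)])
        (use lin[OF cS[OF _ that(2)]] in metis)
  qed
  have cont_c: "continuous_on (S \<times> cbox 0 1) (\<lambda>z. c (fst z) (snd z))"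
    unfolding c_def by (intro continuous_intros)
  have cont: "continuous_on (S \<times> cbox 0 1) (\<lambda>z. g (c (fst z) (snd z)))" if "smooth_on S g" for g :: "'a \<Rightarrow> 'b"
    by (rule continuous_on_compose2[OF smooth_on_continuous_on[OF that] cont_c]) (use cS in auto)
  \<comment> \<open>The Leibniz rule used below takes its derivatives in the space of bounded linear
    functions, so \<open>D x s\<close> is packed into it; continuity is then checked on basis
    vectors.\<close>
  define BD where "BD x s = Blinfun (D x s)" for x s
  have BD: "blinfun_apply (BD x s) = D x s" if "x \<in> S" "s \<in> {0..1}" for x s
    using D_lin[OF that] by (simp add: BD_def bounded_linear_Blinfun_apply)
  have cont_D: "continuous_on (S \<times> cbox 0 1) (\<lambda>(x, s). BD x s)"
    unfolding case_prod_unfold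
  proof (rule continuous_on_blinfun_componentwise)
    fix i :: 'a assume "i \<in> Basis"
    have "continuous_on (S \<times> cbox 0 1) (\<lambda>z. snd z *\<^sub>R
        (\<Sum>b\<in>Basis. ((fst z - x0) \<bullet> b) *\<^sub>R d\<alpha> (c (fst z) (snd z)) i b) + \<alpha> (c (fst z) (snd z)) i)"
      unfolding d\<alpha>_def
      by (intro continuous_intros cont smooth_on_frechet_derivative smooth_formD(2)[OF \<alpha>])
    moreover have "blinfun_apply (BD (fst z) (snd z)) i = snd z *\<^sub>R
        (\<Sum>b\<in>Basis. ((fst z - x0) \<bullet> b) *\<^sub>R d\<alpha> (c (fst z) (snd z)) i b) + \<alpha> (c (fst z) (snd z)) i"
      if "z \<in> S \<times> cbox 0 1" for z
    proof -
      have z: "fst z \<in> S" "snd z \<in> {0..1}" using that by auto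
      note l = linear_d\<alpha>[OF cS[OF z]]
      have "d\<alpha> (c (fst z) (snd z)) i (\<Sum>b\<in>Basis. ((fst z - x0) \<bullet> b) *\<^sub>R b)
          = (\<Sum>b\<in>Basis. ((fst z - x0) \<bullet> b) *\<^sub>R d\<alpha> (c (fst z) (snd z)) i b)"
        by (simp only: linear_sum[OF l] linear_scale[OF l])
      then show ?thesis by (simp only: BD[OF z] D_def euclidean_representation)
    qed
    ultimately show "continuous_on (S \<times> cbox 0 1) (\<lambda>z. blinfun_apply (BD (fst z) (snd z)) i)"
      by (simp cong: continuous_on_cong)
  qed
  have cont_x: "continuous_on (cbox 0 1) (\<lambda>s. \<alpha> (c x s) w)" if "x \<in> S" for x w
    by (rule continuous_on_compose2[OF smooth_on_continuous_on[OF smooth_formD(2)[OF \<alpha>]]])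
      (use cS that in \<open>auto simp: c_def intro!: continuous_intros\<close>)
  have "(F has_derivative \<alpha> x) (at x)" if x: "x \<in> S" for x
  proof -
    have "(F has_derivative blinfun_apply (integral (cbox 0 1) (BD x))) (at x within S)"
      unfolding F_def[abs_def]
    proof (rule leibniz_rule[where fx = BD, OF _ _ cont_D x S(2)])
      show "((\<lambda>x. \<alpha> (c x s) (x - x0)) has_derivative blinfun_apply (BD x s)) (at x within S)"
        if "x \<in> S" "s \<in> cbox 0 1" for x s
        using deriv[of x s] BD[of x s] that by (simp add: has_derivative_at_withinI)
      show "(\<lambda>s. \<alpha> (c x s) (x - x0)) integrable_on cbox 0 1" if "x \<in> S" for x
        by (rule integrable_continuous[OF cont_x[OF that]])
    qed
    then have *: "(F has_derivative blinfun_apply (integral (cbox 0 1) (BD x))) (at x)"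
      using at_within_open[OF x S(1)] by simp
    have "blinfun_apply (integral (cbox 0 1) (BD x)) u = \<alpha> x u" for u
    proof -
      have p: "continuous_on (cbox 0 (1::real)) (\<lambda>s. (x, s))" by (intro continuous_intros)
      have "continuous_on (cbox 0 1) (\<lambda>s. BD x s)"
        using continuous_on_compose2[OF cont_D p] x by (simp add: image_subset_iff)
      then have "BD x integrable_on cbox 0 1" by (rule integrable_continuous)
      then have "blinfun_apply (integral (cbox 0 1) (BD x)) u = integral (cbox 0 1) (\<lambda>s. blinfun_apply (BD x s) u)"
        by (rule blinfun_apply_integral)
      also have "\<dots> = integral (cbox 0 1) (\<lambda>s. D x s u)"
        by (rule integral_cong) (use BD[OF x] in simp)
      \<comment> \<open>The boundary term at 1 is \<alpha> at \<open>x\<close>, and the one at 0 is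
        killed by the factor \<open>s\<close>.\<close>
      also have "((\<lambda>s. D x s u) has_integral 1 *\<^sub>R \<alpha> (c x 1) u - 0 *\<^sub>R \<alpha> (c x 0) u) {0..1}"
      proof (rule fundamental_theorem_of_calculus)
        fix s :: real assume s: "s \<in> {0..1}"
        have "((\<lambda>s. c x s) has_vector_derivative (x - x0)) (at s within {0..1})"
          unfolding c_def by (auto intro!: derivative_eq_intros)
        from vector_derivative_diff_chain_within[OF this, of "\<lambda>y. \<alpha> y u" "d\<alpha> (c x s) u"]
        have "((\<lambda>s. \<alpha> (c x s) u) has_vector_derivative d\<alpha> (c x s) u (x - x0)) (at s within {0..1})"
          using d\<alpha>[OF cS[OF x s]] by (auto simp: o_def intro: has_derivative_at_withinI)
        then have "((\<lambda>s. s *\<^sub>R \<alpha> (c x s) u) has_vector_derivative s *\<^sub>R d\<alpha> (c x s) u (x - x0) + 1 *\<^sub>R \<alpha> (c x s) u) (at s within {0..1})"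
          by (intro has_vector_derivative_scaleR) (auto intro!: derivative_eq_intros)
        then show "((\<lambda>s. s *\<^sub>R \<alpha> (c x s) u) has_vector_derivative D x s u) (at s within {0..1})"
          by (simp add: D_def)
      qed simp
      then have "integral (cbox 0 1) (\<lambda>s. D x s u) = \<alpha> (c x 1) u"
        by (simp add: integral_unique)
      finally show ?thesis by (simp add: c_def)
    qed
    with * show ?thesis by (metis (no_types, lifting) ext)
  qed
  moreover have "F x0 = 0"
    using linear_0[OF smooth_formD(1)[OF \<alpha>]] cS[OF S(3)]
    by (simp add: F_def c_def S(3))
  ultimately show ?thesis by (rule that)
qed


section \<open>Smooth forms under algebraic operations\<close>

context
  fixes S :: "'a::real_normed_vector set"
  assumes S: "open S"
begin

lemma smooth_form_linear:
  assumes "bounded_linear L" "smooth_form S \<alpha>"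
  shows "smooth_form S (\<lambda>x v. L (\<alpha> x v))"
  unfolding smooth_form_def
proof (intro conjI ballI allI)
  show "linear (\<lambda>v. L (\<alpha> x v))" if "x \<in> S" for x
    using linear_compose[OF smooth_formD(1)[OF assms(2) that] bounded_linear.linear[OF assms(1)]]
    by (simp only: o_def)
  show "smooth_on S (\<lambda>x. L (\<alpha> x v))" for v
    by (rule smooth_on_linear[OF S assms(1) smooth_formD(2)[OF assms(2)]])
qed

lemma smooth_form_add:
  assumes "smooth_form S \<alpha>" "smooth_form S \<beta>"
  shows "smooth_form S (\<lambda>x v. \<alpha> x v + \<beta> x v)"
  unfolding smooth_form_def
  using smooth_formD[OF assms(1)] smooth_formD[OF assms(2)] smooth_on_add[OF S] linear_compose_add
  by blast

lemma smooth_form_mult: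
  fixes \<alpha> :: "('a, 'b::real_normed_algebra) form1"
  assumes "smooth_on S f" "smooth_form S \<alpha>"
  shows "smooth_form S (\<lambda>x v. f x * \<alpha> x v)"
  unfolding smooth_form_def
proof (intro conjI ballI allI)
  show "linear (\<lambda>v. f x * \<alpha> x v)" if "x \<in> S" for x
    using linear_compose[OF smooth_formD(1)[OF assms(2) that] bounded_linear.linear[OF bounded_linear_mult_right[of "f x"]]]
    by (simp only: o_def)
  show "smooth_on S (\<lambda>x. f x * \<alpha> x v)" for v
    by (rule smooth_on_mult[OF S assms(1) smooth_formD(2)[OF assms(2)]])
qed

lemma smooth_form_const_mult:
  fixes \<alpha> :: "('a, 'b::real_normed_algebra) form1"
  shows "smooth_form S \<alpha> \<Longrightarrow> smooth_form S (\<lambda>x v. c * \<alpha> x v)"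
  by (rule smooth_form_mult[OF smooth_on_const])

lemma smooth_form_zero: "smooth_form S (\<lambda>x v. 0)"
  by (simp add: smooth_form_def linear_zero)

lemma smooth_form_sum:
  "(\<And>i. i \<in> I \<Longrightarrow> smooth_form S (\<alpha> i)) \<Longrightarrow> smooth_form S (\<lambda>x v. \<Sum>i\<in>I. \<alpha> i x v)"
proof (induction I rule: infinite_finite_induct)
  case (insert i I)
  then show ?case by (simp add: smooth_form_add[of "\<alpha> i" "\<lambda>x v. \<Sum>i\<in>I. \<alpha> i x v"])
qed (simp_all add: smooth_form_zero)

lemma smooth_form_minus: "smooth_form S \<alpha> \<Longrightarrow> smooth_form S (\<lambda>x v. - \<alpha> x v)"
  by (rule smooth_form_linear[OF bounded_linear_minus[OF bounded_linear_ident]])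

lemma smooth_form_vec:
  fixes \<alpha> :: "('a, 'b::real_normed_vector^'n) form1"
  assumes "\<And>i. smooth_form S (\<lambda>x v. \<alpha> x v $ i)"
  shows "smooth_form S \<alpha>"
  unfolding smooth_form_def
proof (intro conjI ballI allI)
  show "linear (\<alpha> x)" if "x \<in> S" for x
    using smooth_formD(1)[OF assms that] by (auto simp: linear_iff vec_eq_iff)
  show "smooth_on S (\<lambda>x. \<alpha> x v)" for v
    by (rule smooth_on_vec[OF S]) (rule smooth_formD(2)[OF assms])
qed

end

section \<open>Linearity and Leibniz rules for derivatives of functions and forms\<close>

lemma frechet_derivative_linear:
  assumes "bounded_linear L" "f differentiable at x"
  shows "frechet_derivative (\<lambda>y. L (f y)) (at x) u = L (frechet_derivative f (at x) u)"
  by (rule fun_cong[OF frechet_derivative_at[symmetric]],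
      rule bounded_linear.has_derivative[OF assms(1)])
    (use assms(2) frechet_derivative_works in blast)

lemma frechet_derivative_add:
  assumes "f differentiable at x" "g differentiable at x"
  shows "frechet_derivative (\<lambda>y. f y + g y) (at x) u = frechet_derivative f (at x) u + frechet_derivative g (at x) u"
  by (rule fun_cong[OF frechet_derivative_at[symmetric]], rule has_derivative_add)
    (use assms frechet_derivative_works in blast)+

lemma frechet_derivative_diff:
  assumes "f differentiable at x" "g differentiable at x"
  shows "frechet_derivative (\<lambda>y. f y - g y) (at x) u = frechet_derivative f (at x) u - frechet_derivative g (at x) u"
  by (rule fun_cong[OF frechet_derivative_at[symmetric]], rule has_derivative_diff)
    (use assms frechet_derivative_works in blast)+

lemma frechet_derivative_bilinear:
  assumes "bounded_bilinear p" "f differentiable at x" "g differentiable at x"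
  shows "frechet_derivative (\<lambda>y. p (f y) (g y)) (at x) u
    = p (f x) (frechet_derivative g (at x) u) + p (frechet_derivative f (at x) u) (g x)"
  by (rule fun_cong[OF frechet_derivative_at[symmetric]], rule bounded_bilinear.FDERIV[OF assms(1)])
    (use assms(2,3) frechet_derivative_works in blast)+

lemma differentiable_bilinear:
  assumes "bounded_bilinear p" "f differentiable at x" "g differentiable at x"
  shows "(\<lambda>y. p (f y) (g y)) differentiable at x"
  using bounded_bilinear.FDERIV[OF assms(1)] assms(2,3) unfolding differentiable_def by fast

lemmas frechet_derivative_mult = frechet_derivative_bilinear[OF bounded_bilinear_mult]

lemma frechet_derivative_nth:
  assumes "f differentiable at x"
  shows "frechet_derivative f (at x) u $ i = frechet_derivative (\<lambda>y. f y $ i) (at x) u"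
  using frechet_derivative_linear[OF bounded_linear_vec_nth assms] by (rule sym)

lemma differentiable_vec_nth: "f differentiable at x \<Longrightarrow> (\<lambda>y. f y $ i) differentiable at x"
  unfolding differentiable_def using bounded_linear.has_derivative[OF bounded_linear_vec_nth] by fast

lemma frechet_derivative_nth2:
  assumes "f differentiable at x"
  shows "frechet_derivative f (at x) u $ i $ j = frechet_derivative (\<lambda>y. f y $ i $ j) (at x) u"
  by (simp only: frechet_derivative_nth[OF assms] frechet_derivative_nth[OF differentiable_vec_nth[OF assms]])

lemma ext_d_cong:
  assumes "open S" "x \<in> S" "\<And>y v. y \<in> S \<Longrightarrow> \<alpha> y v = \<beta> y v"
  shows "ext_d \<alpha> x u v = ext_d \<beta> x u v"
  unfolding ext_d_def
  using frechet_derivative_cong_open[OF assms(1,2), of "\<lambda>y. \<alpha> y _" "\<lambda>y. \<beta> y _"] assms(3) by (metis (no_types, lifting))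

lemma ext_d_linear:
  assumes "bounded_linear L" "\<And>v. (\<lambda>y. \<alpha> y v) differentiable at x"
  shows "ext_d (\<lambda>y v. L (\<alpha> y v)) x u v = L (ext_d \<alpha> x u v)"
  using bounded_linear.linear[OF assms(1)]
  by (simp add: ext_d_def frechet_derivative_linear[OF assms] linear_diff)

lemma ext_d_add:
  assumes "\<And>v. (\<lambda>y. \<alpha> y v) differentiable at x" "\<And>v. (\<lambda>y. \<beta> y v) differentiable at x"
  shows "ext_d (\<lambda>y v. \<alpha> y v + \<beta> y v) x u v = ext_d \<alpha> x u v + ext_d \<beta> x u v"
  by (simp add: ext_d_def frechet_derivative_add[OF assms])

lemma ext_d_mult:
  fixes \<alpha> :: "('a::real_normed_vector, 'b::real_normed_field) form1"
  assumes "f differentiable at x" "\<And>v. (\<lambda>y. \<alpha> y v) differentiable at x"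
  shows "ext_d (\<lambda>y v. f y * \<alpha> y v) x u v = wedge (frechet_derivative f (at x)) (\<alpha> x) u v + f x * ext_d \<alpha> x u v"
  by (simp add: ext_d_def wedge_def frechet_derivative_mult[OF assms] algebra_simps)

lemma ext_d2_mult:
  fixes B :: "('a::real_normed_vector, 'b::real_normed_field) form2"
  assumes "f differentiable at x" "\<And>u v. (\<lambda>y. B y u v) differentiable at x"
  shows "ext_d2 (\<lambda>y u v. f y * B y u v) x u v w
    = wedge12 (frechet_derivative f (at x)) (B x) u v w + f x * ext_d2 B x u v w"
  by (simp add: ext_d2_def wedge12_def frechet_derivative_mult[OF assms] algebra_simps)

lemma ext_d2_add:
  assumes "\<And>u v. (\<lambda>y. B y u v) differentiable at x" "\<And>u v. (\<lambda>y. C y u v) differentiable at x"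
  shows "ext_d2 (\<lambda>y u v. B y u v + C y u v) x u v w = ext_d2 B x u v w + ext_d2 C x u v w"
  by (simp add: ext_d2_def frechet_derivative_add[OF assms] algebra_simps)

lemma ext_d2_linear:
  assumes "bounded_linear L" "\<And>u v. (\<lambda>y. B y u v) differentiable at x"
  shows "ext_d2 (\<lambda>y u v. L (B y u v)) x u v w = L (ext_d2 B x u v w)"
  using bounded_linear.linear[OF assms(1)]
  by (simp add: ext_d2_def frechet_derivative_linear[OF assms] linear_add)

lemma differentiable_wedge:
  fixes \<alpha> \<beta> :: "('a::real_normed_vector, 'b::real_normed_field) form1"
  assumes "\<And>v. (\<lambda>y. \<alpha> y v) differentiable at x" "\<And>v. (\<lambda>y. \<beta> y v) differentiable at x"
  shows "(\<lambda>y. wedge (\<alpha> y) (\<beta> y) u v) differentiable at x"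
  unfolding wedge_def by (intro differentiable_diff differentiable_mult assms)

lemma ext_d2_wedge:
  fixes \<alpha> \<beta> :: "('a::real_normed_vector, 'b::real_normed_field) form1"
  assumes "\<And>v. (\<lambda>y. \<alpha> y v) differentiable at x" "\<And>v. (\<lambda>y. \<beta> y v) differentiable at x"
  shows "ext_d2 (\<lambda>y. wedge (\<alpha> y) (\<beta> y)) x u v w
    = wedge12 (\<beta> x) (ext_d \<alpha> x) u v w - wedge12 (\<alpha> x) (ext_d \<beta> x) u v w"
proof -
  have *: "(\<lambda>y. \<alpha> y p * \<beta> y q) differentiable at x" for p q
    by (intro differentiable_mult assms)
  show ?thesis
    by (simp add: ext_d2_def ext_d_def wedge_def wedge12_def frechet_derivative_diff[OF * *]
        frechet_derivative_mult[OF assms(1) assms(2)] algebra_simps)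
qed

section \<open>Matrix-valued forms and gauge transformations\<close>

lemma bounded_bilinear_matrix_mult:
  "bounded_bilinear ((**) :: complex^'n^'m \<Rightarrow> complex^'p^'n \<Rightarrow> complex^'p^'m)"
proof -
  have "bilinear ((**) :: complex^'n^'m \<Rightarrow> complex^'p^'n \<Rightarrow> complex^'p^'m)"
    unfolding bilinear_def linear_iff
    by (simp add: vec_eq_iff matrix_matrix_mult_def sum.distrib algebra_simps scaleR_sum_right)
  then show ?thesis by (simp add: bilinear_conv_bounded_bilinear)
qed

interpretation matrix_mult: bounded_bilinear "(**) :: complex^'n^'m \<Rightarrow> complex^'p^'n \<Rightarrow> complex^'p^'m"
  by (rule bounded_bilinear_matrix_mult)

lemmas matrix_distribs = matrix_mult.add_left matrix_mult.add_right matrix_mult.diff_left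
  matrix_mult.diff_right matrix_mult.minus_left matrix_mult.minus_right

lemmas frechet_derivative_matrix_mult = frechet_derivative_bilinear[OF bounded_bilinear_matrix_mult]

section \<open>Gauge transformations of connections and curvatures\<close>

context
  fixes V :: "n_space set" and A A' :: "(n_space, mat6) form1" and h :: "n_space \<Rightarrow> mat6"
  assumes V: "open V" and A: "smooth_form V A" and A': "smooth_form V A'" and h: "smooth_on V h"
    and gauge: "\<And>x v. x \<in> V \<Longrightarrow> A' x v ** h x = h x ** A x v - frechet_derivative h (at x) v"
begin

text \<open>The gauge law is differentiated in the form in which \<open>h\<close> multiplies from
  the right, so no inverse of \<open>h\<close> is differentiated. After antisymmetrisation the mixed
  terms cancel, and the second derivatives of \<open>h\<close> drop out by symmetry.\<close>

lemma conn_curvature_gauge: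
  assumes x: "x \<in> V"
  shows "conn_curvature A' x u v ** h x = h x ** conn_curvature A x u v"
proof -
  let ?dh = "\<lambda>v. frechet_derivative h (at x) v"
  let ?d = "\<lambda>A v u. frechet_derivative (\<lambda>y. A y v) (at x) u"
  note diff = smooth_formD(3)[OF A x] smooth_formD(3)[OF A' x] smooth_on_differentiable[OF h x]
    smooth_on_differentiable[OF smooth_on_frechet_derivative[OF h] x]
  have 1: "A' x v ** ?dh u + ?d A' v u ** h x = h x ** ?d A v u + ?dh u ** A x v
      - frechet_derivative (\<lambda>y. frechet_derivative h (at y) v) (at x) u" for u v
  proof -
    have "frechet_derivative (\<lambda>y. A' y v ** h y) (at x) u
        = frechet_derivative (\<lambda>y. h y ** A y v - frechet_derivative h (at y) v) (at x) u"
      by (rule fun_cong[OF frechet_derivative_cong_open[OF V x gauge]])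
    then show ?thesis
      by (simp only: frechet_derivative_diff[OF differentiable_bilinear[OF bounded_bilinear_matrix_mult diff(3,1)] diff(4)]
          frechet_derivative_matrix_mult[OF diff(2,3)] frechet_derivative_matrix_mult[OF diff(3,1)])
  qed
  have 2: "A' x u ** A' x v ** h x = h x ** A x u ** A x v - ?dh u ** A x v - A' x u ** ?dh v" for u v
  proof -
    have "A' x u ** A' x v ** h x = A' x u ** h x ** A x v - A' x u ** ?dh v"
      by (simp only: matrix_mul_assoc[symmetric] gauge[OF x, of v] matrix_distribs)
    then show ?thesis by (simp only: gauge[OF x, of u] matrix_distribs matrix_mul_assoc)
  qed
  have 3: "?d A' v u ** h x = h x ** ?d A v u + ?dh u ** A x v
      - frechet_derivative (\<lambda>y. frechet_derivative h (at y) v) (at x) u - A' x v ** ?dh u" for u v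
    using 1[of v u] by (simp add: algebra_simps)
  show ?thesis
    unfolding conn_curvature_def ext_d_def matrix_distribs 2 3 matrix_mul_assoc
    using frechet_derivative_commute[OF V x h, of u v] by (simp add: algebra_simps)
qed

text \<open>The inhomogeneous terms of the gauge law cancel against the derivative of
  \<open>h\<close> in the intertwining relation between \<open>B\<close> and \<open>B'\<close>. Only
  pointwise differentiability of the two forms is used, since the Hodge dual is known only through a
  formula valid on \<open>V\<close>.\<close>

lemma cov_d2_gauge:
  assumes x: "x \<in> V"
    and B: "\<And>u v. (\<lambda>y. B y u v) differentiable at x" and B': "\<And>u v. (\<lambda>y. B' y u v) differentiable at x"
    and BB': "\<And>x u v. x \<in> V \<Longrightarrow> B' x u v ** h x = h x ** B x u v"
  shows "cov_d2 A' B' x u v w ** h x = h x ** cov_d2 A B x u v w"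
proof -
  let ?dh = "\<lambda>v. frechet_derivative h (at x) v"
  let ?d = "\<lambda>B v w u. frechet_derivative (\<lambda>y. B y v w) (at x) u"
  note diff = B B' smooth_on_differentiable[OF h x]
  have 1: "B' x v w ** ?dh u + ?d B' v w u ** h x = h x ** ?d B v w u + ?dh u ** B x v w" for u v w
  proof -
    have "frechet_derivative (\<lambda>y. B' y v w ** h y) (at x) u = frechet_derivative (\<lambda>y. h y ** B y v w) (at x) u"
      by (rule fun_cong[OF frechet_derivative_cong_open[OF V x BB']])
    then show ?thesis
      by (simp only: frechet_derivative_matrix_mult[OF diff(2,3)] frechet_derivative_matrix_mult[OF diff(3,1)])
  qed
  have 2: "?d B' v w u ** h x = h x ** ?d B v w u + ?dh u ** B x v w - B' x v w ** ?dh u" for u v w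
    using 1[of v w u] by (simp add: algebra_simps)
  have 3: "A' x u ** B' x v w ** h x = h x ** A x u ** B x v w - ?dh u ** B x v w" for u v w
  proof -
    have "A' x u ** B' x v w ** h x = A' x u ** h x ** B x v w"
      by (simp only: matrix_mul_assoc[symmetric] BB'[OF x])
    then show ?thesis by (simp only: gauge[OF x, of u] matrix_distribs matrix_mul_assoc)
  qed
  have 4: "B' x v w ** A' x u ** h x = h x ** B x v w ** A x u - B' x v w ** ?dh u" for u v w
  proof -
    have "B' x v w ** A' x u ** h x = B' x v w ** h x ** A x u - B' x v w ** ?dh u"
      by (simp only: matrix_mul_assoc[symmetric] gauge[OF x, of u] matrix_distribs)
    then show ?thesis by (simp only: BB'[OF x])
  qed
  show ?thesis
    unfolding cov_d2_def ext_d2_def matrix_distribs 2 3 4 matrix_mul_assoc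
    by (simp add: algebra_simps)
qed

end

lemma smooth_on_det:
  fixes M :: "'a::real_normed_vector \<Rightarrow> complex^'n^'n"
  assumes S: "open S" and "\<And>i j. smooth_on S (\<lambda>x. M x $ i $ j)"
  shows "smooth_on S (\<lambda>x. det (M x))"
  unfolding det_def
  by (rule smooth_on_sum[OF S], rule smooth_on_mult[OF S smooth_on_const], rule smooth_on_prod[OF S]) (rule assms(2))

lemma matrix_inv_mult:
  fixes M :: "'b::semiring_1^'n^'n"
  assumes "invertible M"
  shows "M ** matrix_inv M = mat 1" "matrix_inv M ** M = mat 1"
  using someI_ex[OF assms[unfolded invertible_def]] unfolding matrix_inv_def by auto

text \<open>By Cramer's rule each entry of the inverse is a quotient of determinants, hence a
  rational function of the entries with nonvanishing denominator.\<close>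

lemma smooth_on_matrix_inv:
  fixes M :: "'a::real_normed_vector \<Rightarrow> complex^'n^'n"
  assumes S: "open S" and M: "\<And>i j. smooth_on S (\<lambda>x. M x $ i $ j)" and inv: "\<And>x. x \<in> S \<Longrightarrow> invertible (M x)"
  shows "smooth_on S (\<lambda>x. matrix_inv (M x) $ i $ j)"
proof (rule smooth_on_cong[OF S])
  let ?N = "\<lambda>x. (\<chi> p q. if q = i then axis j 1 $ p else M x $ p $ q) :: complex^'n^'n"
  have N: "smooth_on S (\<lambda>x. ?N x $ p $ q)" for p q
    using M[of p q] by (cases "q = i") (simp_all add: smooth_on_const)
  show "smooth_on S (\<lambda>x. det (?N x) / det (M x))"
    by (rule smooth_on_divide[OF S smooth_on_det[OF S N] smooth_on_det[OF S M]])
      (use inv invertible_det_nz in blast)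
  show "det (?N x) / det (M x) = matrix_inv (M x) $ i $ j" if x: "x \<in> S" for x
  proof -
    have nz: "det (M x) \<noteq> 0" using inv[OF x] invertible_det_nz by blast
    have "M x *v (matrix_inv (M x) *v axis j 1) = axis j 1"
      using matrix_inv_mult(1)[OF inv[OF x]] by (simp add: matrix_vector_mul_assoc)
    then have "matrix_inv (M x) *v axis j 1 = (\<chi> i. det (\<chi> p q. if q = i then axis j 1 $ p else M x $ p $ q) / det (M x))"
      using cramer[OF nz] by blast
    then have "(matrix_inv (M x) *v axis j 1) $ i = det (?N x) / det (M x)" by simp
    moreover have "(matrix_inv (M x) *v axis j 1) $ i = matrix_inv (M x) $ i $ j"
      unfolding matrix_vector_mult_def axis_def by (simp add: if_distrib cong: if_cong)
    ultimately show ?thesis by simp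
  qed
qed

section \<open>Matrices indexed in block form\<close>

lemma sum_idx6: "(\<Sum>r\<in>(UNIV::idx6 set). f r) = f (Inl ()) + (\<Sum>i\<in>UNIV. f (Inr (Inl i))) + f (Inr (Inr ()))"
proof -
  have "(UNIV::idx6 set) = insert (Inl ()) (insert (Inr (Inr ())) ((\<lambda>i. Inr (Inl i)) ` UNIV))"
  proof -
    have "r = Inl () \<or> r = Inr (Inr ()) \<or> r \<in> range (\<lambda>i. Inr (Inl i))" for r :: idx6
      by (cases r; cases "projr r") auto
    then show ?thesis by auto
  qed
  then have "(\<Sum>r\<in>UNIV. f r) = (\<Sum>r\<in>insert (Inl ()) (insert (Inr (Inr ())) ((\<lambda>i. Inr (Inl i)) ` UNIV)). f r)"
    by (rule arg_cong)
  also have "\<dots> = f (Inl ()) + (f (Inr (Inr ())) + (\<Sum>r\<in>(\<lambda>i. Inr (Inl i)) ` UNIV. f r))"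
    by (subst sum.insert; (subst sum.insert)?; auto)
  also have "(\<Sum>r\<in>(\<lambda>i. Inr (Inl i)) ` UNIV. f r) = (\<Sum>i\<in>UNIV. f (Inr (Inl i)))"
    by (subst sum.reindex) (auto simp: inj_on_def)
  finally show ?thesis by (simp only: add_ac)
qed

lemma all_idx6: "(\<forall>r::idx6. P r) \<longleftrightarrow> P (Inl ()) \<and> (\<forall>i. P (Inr (Inl i))) \<and> P (Inr (Inr ()))"
  by (metis (full_types) old.unit.exhaust sum.exhaust)

text \<open>In the index type \<open>4\<close> the numerals 0 and 4 denote the same element, which
  the final \<open>else\<close> sends to position 4.\<close>

definition pos6 :: "idx6 \<Rightarrow> nat" where
  "pos6 r = (case r of Inl _ \<Rightarrow> 0
     | Inr (Inl i) \<Rightarrow> (if i = 1 then 1 else if i = 2 then 2 else if i = 3 then 3 else 4)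
     | Inr (Inr _) \<Rightarrow> 5)"

lemma pos6_simps [simp]:
  "pos6 (Inl u) = 0" "pos6 (Inr (Inl 1)) = 1" "pos6 (Inr (Inl 2)) = 2" "pos6 (Inr (Inl 3)) = 3"
  "pos6 (Inr (Inl 4)) = 4" "pos6 (Inr (Inl 0)) = 4" "pos6 (Inr (Inr u)) = 5"
  by (simp_all add: pos6_def)

definition tab6 :: "complex list list \<Rightarrow> mat6" where
  "tab6 L = (\<chi> r s. L ! pos6 r ! pos6 s)"

lemma tab6_nth [simp]: "tab6 L $ r $ s = L ! pos6 r ! pos6 s"
  by (simp add: tab6_def)

lemma mat6_eq_iff: "A = (B :: mat6) \<longleftrightarrow> (\<forall>r s. A $ r $ s = B $ r $ s)"
  by (auto simp: vec_eq_iff)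

lemma mat6_mult_nth:
  "((A :: mat6) ** B) $ r $ s = A $ r $ Inl () * B $ Inl () $ s
     + (A $ r $ Inr (Inl 1) * B $ Inr (Inl 1) $ s + A $ r $ Inr (Inl 2) * B $ Inr (Inl 2) $ s
     + A $ r $ Inr (Inl 3) * B $ Inr (Inl 3) $ s + A $ r $ Inr (Inl 4) * B $ Inr (Inl 4) $ s)
     + A $ r $ Inr (Inr ()) * B $ Inr (Inr ()) $ s"
  by (simp add: matrix_matrix_mult_def sum_idx6 sum_4 del: numeral_eq_one_iff)

section \<open>Exterior derivatives of tuples of forms\<close>

lemma ext_d_Pair:
  assumes "\<And>v. (\<lambda>y. \<alpha> y v) differentiable at x" "\<And>v. (\<lambda>y. \<beta> y v) differentiable at x"
  shows "ext_d (\<lambda>y v. (\<alpha> y v, \<beta> y v)) x u v = (ext_d \<alpha> x u v, ext_d \<beta> x u v)"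
proof -
  have "frechet_derivative (\<lambda>y. (\<alpha> y v, \<beta> y v)) (at x) u
      = (frechet_derivative (\<lambda>y. \<alpha> y v) (at x) u, frechet_derivative (\<lambda>y. \<beta> y v) (at x) u)" for u v
    by (rule fun_cong[OF frechet_derivative_at[symmetric]], rule has_derivative_Pair)
      (use assms frechet_derivative_works in blast)+
  then show ?thesis by (simp add: ext_d_def)
qed

lemma differentiable_Pair:
  "f differentiable at x \<Longrightarrow> g differentiable at x \<Longrightarrow> (\<lambda>y. (f y, g y)) differentiable at x"
  unfolding differentiable_def using has_derivative_Pair by fast

lemma ext_d2_Pair:
  assumes "\<And>u v. (\<lambda>y. \<alpha> y u v) differentiable at x" "\<And>u v. (\<lambda>y. \<beta> y u v) differentiable at x"
  shows "ext_d2 (\<lambda>y u v. (\<alpha> y u v, \<beta> y u v)) x u v w = (ext_d2 \<alpha> x u v w, ext_d2 \<beta> x u v w)"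
proof -
  have "frechet_derivative (\<lambda>y. (\<alpha> y u v, \<beta> y u v)) (at x) w
      = (frechet_derivative (\<lambda>y. \<alpha> y u v) (at x) w, frechet_derivative (\<lambda>y. \<beta> y u v) (at x) w)" for u v w
    by (rule fun_cong[OF frechet_derivative_at[symmetric]], rule has_derivative_Pair)
      (use assms frechet_derivative_works in blast)+
  then show ?thesis by (simp add: ext_d2_def)
qed

lemma ext_d2_ext_d:
  fixes \<alpha> :: "('a::real_normed_vector, 'b::banach) form1"
  assumes "open S" "x \<in> S" "smooth_form S \<alpha>"
  shows "ext_d2 (ext_d \<alpha>) x u v w = 0"
proof -
  note sm = smooth_on_frechet_derivative[OF smooth_formD(2)[OF assms(3)]]
  note d = smooth_on_differentiable[OF sm assms(2)]
  show ?thesis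
    using frechet_derivative_commute[OF assms(1,2) smooth_formD(2)[OF assms(3)]]
    by (simp add: ext_d2_def ext_d_def frechet_derivative_diff[OF d d])
qed

section \<open>Coframes with the structure equations of a shear-free congruence\<close>

text \<open>The tuple collects all forms that occur in the connection, including the products
  \<open>kl\<close>, \<open>kl'\<close> with K and their companion \<open>q\<close>; this makes the
  matrix linear in the tuple, so the exterior derivative passes inside. The coefficients are
  parameters so that linearity and splitting are proved without unfolding rational functions of
  t.\<close>

definition conn_entries where
  "conn_entries e1 e2 e3 e4 e5 e6 e7 e8 e9 e10 e11 e12 e13 e14 e15 e16 = (\<lambda>(a, m, m', l, p, kl, kl', q). tab6
    [[a, e1 * kl, e1 * kl', e2 * q, e3 * p, 0],
     [m, e4 * p, 0, e5 * kl', e6 * m, e1 * kl'],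
     [m', 0, e7 * p, e8 * kl, e9 * m', e1 * kl],
     [l, e10 * m', e11 * m, - a, 0, e12 * p],
     [p, e13 * kl, e14 * kl', 0, a, e15 * q],
     [0, m', m, e16 * p, e16 * l, - a]])"

text \<open>Given the first column, the middle block is determined by torsion-freeness and by
  skewness with respect to \<open>Jform (eta0 t)\<close>. The top row is then determined by the
  trace condition established in \<open>weyl_trace\<close>, and the last row and column by
  skewness.\<close>

definition conn_tab :: "complex \<Rightarrow> complex \<times> complex \<times> complex \<times> complex \<times> complex \<times> complex \<times> complex \<times> complex \<Rightarrow> mat6" where
  "conn_tab t = conn_entries ((1 - t) / 4) (- (1 + t) / 4) (- t\<^sup>2) (\<i> * (t - 1)) (- \<i> * t) (\<i> * t)
     (- \<i> * (t - 1)) (\<i> * t) (- \<i> * t) (\<i> / 2) (- \<i> / 2) (- t / 2) (- \<i> / 2) (\<i> / 2) (- (1 + t) / (8 * t)) (2 * t)"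

text \<open>The parts of the curvature with values proportional to \<open>K\<^sub>2\<close> and to its conjugate; they turn
  out to be the two eigenforms of the Hodge star. The arguments stand for the 2-forms in
  \<open>curv_forms\<close> below.\<close>

definition curv_entries where
  "curv_entries c1 c2 c3 c4 c5 c6 c7 c8 c9 c10 c11 c12 c13 = (\<lambda>(\<Theta>, B, C, \<Phi>). tab6
    [[0, c1 * \<Theta> + c2 * B, 0, c3 * C, c4 * \<Phi>, 0],
     [0, c5 * \<Phi>, 0, 0, 0, 0],
     [0, 0, c6 * \<Phi>, c7 * \<Theta> + c8 * B, 0, c1 * \<Theta> + c2 * B],
     [0, 0, 0, c9 * \<Phi>, 0, c10 * \<Phi>],
     [0, c11 * \<Theta> + c12 * B, 0, 0, c6 * \<Phi>, c13 * C],
     [0, 0, 0, 0, 0, 0]])"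

definition curv_entries' where
  "curv_entries' c1 c2 c3 c4 c5 c6 c7 c8 c9 c10 c11 c12 c13 = (\<lambda>(\<Theta>, B, C, \<Phi>). tab6
    [[0, 0, c1 * \<Theta> + c2 * B, c3 * C, c4 * \<Phi>, 0],
     [0, c6 * \<Phi>, 0, c7 * \<Theta> + c8 * B, 0, c1 * \<Theta> + c2 * B],
     [0, 0, c5 * \<Phi>, 0, 0, 0],
     [0, 0, 0, c9 * \<Phi>, 0, c10 * \<Phi>],
     [0, 0, c11 * \<Theta> + c12 * B, 0, c6 * \<Phi>, c13 * C],
     [0, 0, 0, 0, 0, 0]])"

text \<open>The constant \<open>c\<close> is the coefficient of k in the Weyl tensor. With indices
  lowered by the null metric the middle block is the symmetric tensor - c k (sd1 sd2 + sd2 sd1) + i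
  t k1 sd1 sd1, where \<open>sd1\<close>, \<open>sd2\<close> are the 2-forms introduced below and
  \<open>k1\<close> is the \<open>w1\<close>-coefficient of the covariant derivative of k: Petrov
  type III wherever c k is nonzero.\<close>

definition curv_tab :: "complex \<Rightarrow> complex \<times> complex \<times> complex \<times> complex \<Rightarrow> mat6" where
  "curv_tab t = (let c = (3 * t - 1) / 4 in curv_entries (- \<i> / 2 * c) ((1 - t) / 4) ((1 + t) / 4)
     (\<i> * t * c) c (- c) (- c) (\<i> * t) c (\<i> / 2 * c) (c / (2 * t)) (- \<i> / 2) ((1 + t) / (8 * t)))"

definition curv_tab' :: "complex \<Rightarrow> complex \<times> complex \<times> complex \<times> complex \<Rightarrow> mat6" where
  "curv_tab' t = (let c = (3 * t - 1) / 4 in curv_entries' (\<i> / 2 * c) ((1 - t) / 4) ((1 + t) / 4)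
     (- \<i> * t * c) c (- c) (- c) (- \<i> * t) c (- \<i> / 2 * c) (c / (2 * t)) (\<i> / 2) ((1 + t) / (8 * t)))"

lemma bounded_linear_conn_tab: "bounded_linear (conn_tab t)"
proof -
  have "bounded_linear (conn_entries e1 e2 e3 e4 e5 e6 e7 e8 e9 e10 e11 e12 e13 e14 e15 e16)"
    for e1 e2 e3 e4 e5 e6 e7 e8 e9 e10 e11 e12 e13 e14 e15 e16
    unfolding linear_conv_bounded_linear[symmetric] linear_iff
    by (auto simp: conn_entries_def mat6_eq_iff all_idx6 forall_4 distrib_left scaleR_add_right add_ac)
  then show ?thesis unfolding conn_tab_def .
qed

lemma bounded_linear_curv_entries:
  "bounded_linear (curv_entries c1 c2 c3 c4 c5 c6 c7 c8 c9 c10 c11 c12 c13)"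
  "bounded_linear (curv_entries' c1 c2 c3 c4 c5 c6 c7 c8 c9 c10 c11 c12 c13)"
  unfolding linear_conv_bounded_linear[symmetric] linear_iff
  by (auto simp: curv_entries_def curv_entries'_def mat6_eq_iff all_idx6 forall_4
      distrib_left scaleR_add_right add_ac)

lemma bounded_linear_curv_tab: "bounded_linear (curv_tab t)"
  unfolding curv_tab_def Let_def by (rule bounded_linear_curv_entries)

lemma bounded_linear_curv_tab': "bounded_linear (curv_tab' t)"
  unfolding curv_tab'_def Let_def by (rule bounded_linear_curv_entries)

text \<open>The structure equations of the invariant coframe on a section of P over N, for vanishing
  \<open>K1\<close>. The real coframe of the four-manifold consists of \<open>w\<close>,
  \<open>w1\<close> and the imaginary part of \<open>W\<close>; the real part of \<open>W\<close>
  plays the role of a Weyl connection form, hence the shape of \<open>inj\<close>.\<close>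

locale conf_frame =
  fixes V :: "n_space set" and w :: "(n_space, real) form1" and w1 W :: "(n_space, complex) form1"
    and k :: "n_space \<Rightarrow> complex"
  assumes V: "open V" and smooth_w: "smooth_form V w" and smooth_w1: "smooth_form V w1"
    and smooth_W: "smooth_form V W" and smooth_k: "smooth_on V k"
    and ext_d_w: "\<And>x u v. x \<in> V \<Longrightarrow> ext_d (cplx w) x u v
      = \<i> * wedge (w1 x) (conj_form w1 x) u v + wedge (\<lambda>z. W x z + conj_form W x z) (cplx w x) u v"
    and ext_d_w1: "\<And>x u v. x \<in> V \<Longrightarrow> ext_d w1 x u v = wedge (W x) (w1 x) u v"
    and ext_d_W: "\<And>x u v. x \<in> V \<Longrightarrow> ext_d W x u v = k x * wedge (w1 x) (cplx w x) u v"
    and inj: "\<And>x v. x \<in> V \<Longrightarrow> w x v = 0 \<Longrightarrow> w1 x v = 0 \<Longrightarrow> Im (W x v) = 0 \<Longrightarrow> v = 0"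
begin

definition wc where "wc = cplx w"
definition wb where "wb = conj_form w1"
definition kb where "kb x = cnj (k x)"
definition al :: "(n_space, complex) form1" where "al x v = of_real (Re (W x v))"
definition ps :: "(n_space, complex) form1" where "ps x v = of_real (Im (W x v))"
definition kap where "kap x v = frechet_derivative k (at x) v"
text \<open>The covariant derivative of k. The weights 3 and 1 are those of a function scaling like
  \<rho>^(-3) e^(-i \<phi>), since \<open>al\<close> and \<open>ps\<close> contain the differentials
  of log \<rho> and of \<phi>.\<close>

definition bet where "bet x v = kap x v + k x * (3 * al x v + \<i> * ps x v)"
definition betb where "betb = conj_form bet"

lemma W_eq: "W x v = al x v + \<i> * ps x v" "cnj (W x v) = al x v - \<i> * ps x v"
  by (simp_all add: al_def ps_def complex_eq_iff)

lemma cnj_forms: "cnj (al x v) = al x v" "cnj (ps x v) = ps x v" "cnj (wc x v) = wc x v"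
  "cnj (w1 x v) = wb x v" "cnj (wb x v) = w1 x v" "cnj (k x) = kb x" "cnj (kb x) = k x"
  "cnj (bet x v) = betb x v" "cnj (betb x v) = bet x v"
  by (simp_all add: al_def ps_def wc_def cplx_def wb_def conj_form_def kb_def betb_def)

lemma smooth_forms:
  "smooth_form V wc" "smooth_form V wb" "smooth_form V al" "smooth_form V ps" "smooth_form V kap"
  "smooth_form V bet" "smooth_form V betb" "smooth_on V kb"
proof -
  show 1: "smooth_form V wc" unfolding wc_def cplx_def[abs_def]
    by (rule smooth_form_linear[OF V bounded_linear_of_real smooth_w])
  show 2: "smooth_form V wb" unfolding wb_def conj_form_def[abs_def]
    by (rule smooth_form_linear[OF V bounded_linear_cnj smooth_w1])
  show 3: "smooth_form V al" unfolding al_def[abs_def]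
    by (rule smooth_form_linear[OF V bounded_linear_compose[OF bounded_linear_of_real bounded_linear_Re] smooth_W])
  show 4: "smooth_form V ps" unfolding ps_def[abs_def]
    by (rule smooth_form_linear[OF V bounded_linear_compose[OF bounded_linear_of_real bounded_linear_Im] smooth_W])
  show 5: "smooth_form V kap" unfolding kap_def[abs_def]
    by (rule smooth_form_exact[OF smooth_k])
  show 6: "smooth_form V bet" unfolding bet_def[abs_def]
    by (intro smooth_form_add[OF V] 5 smooth_form_mult[OF V] smooth_form_const_mult[OF V] smooth_k 3 4)
  show "smooth_form V betb" unfolding betb_def conj_form_def[abs_def]
    by (rule smooth_form_linear[OF V bounded_linear_cnj 6])
  show "smooth_on V kb" unfolding kb_def[abs_def]
    by (rule smooth_on_cnj[OF V smooth_k])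
qed

text \<open>Later proofs cite this list by position: 1 \<open>w1\<close>, 2 \<open>W\<close>, 3
  \<open>wc\<close>, 4 \<open>wb\<close>, 5 \<open>al\<close>, 6 \<open>ps\<close>, 7
  \<open>kap\<close>, 8 \<open>bet\<close>, 9 \<open>betb\<close>, 10 \<open>k\<close>, 11
  \<open>kb\<close>.\<close>

lemmas forms_differentiable = smooth_formD(3)[OF smooth_w1] smooth_formD(3)[OF smooth_W]
  smooth_formD(3)[OF smooth_forms(1)] smooth_formD(3)[OF smooth_forms(2)] smooth_formD(3)[OF smooth_forms(3)]
  smooth_formD(3)[OF smooth_forms(4)] smooth_formD(3)[OF smooth_forms(5)] smooth_formD(3)[OF smooth_forms(6)]
  smooth_formD(3)[OF smooth_forms(7)] smooth_on_differentiable[OF smooth_k] smooth_on_differentiable[OF smooth_forms(8)]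

lemma kap_kb: "x \<in> V \<Longrightarrow> frechet_derivative kb (at x) v = cnj (kap x v)"
  unfolding kb_def[abs_def] kap_def
  by (rule frechet_derivative_linear[OF bounded_linear_cnj smooth_on_differentiable[OF smooth_k]])

lemma kap_eq: "kap x v = bet x v - k x * (3 * al x v + \<i> * ps x v)"
  "cnj (kap x v) = betb x v - kb x * (3 * al x v - \<i> * ps x v)"
  by (simp_all add: bet_def betb_def conj_form_def kb_def al_def ps_def)

lemma ext_d_forms:
  assumes x: "x \<in> V"
  shows "ext_d wc x u v = \<i> * wedge (w1 x) (wb x) u v + 2 * wedge (al x) (wc x) u v"
    and "ext_d w1 x u v = wedge (al x) (w1 x) u v + \<i> * wedge (ps x) (w1 x) u v"
    and "ext_d wb x u v = wedge (al x) (wb x) u v - \<i> * wedge (ps x) (wb x) u v"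
    and "ext_d al x u v = (k x * wedge (w1 x) (wc x) u v + kb x * wedge (wb x) (wc x) u v) / 2"
    and "ext_d ps x u v = - \<i> / 2 * (k x * wedge (w1 x) (wc x) u v - kb x * wedge (wb x) (wc x) u v)"
    and "ext_d bet x u v = wedge (kap x) (\<lambda>v. 3 * al x v + \<i> * ps x v) u v
      + k x * (3 * ext_d al x u v + \<i> * ext_d ps x u v)"
    and "ext_d betb x u v = wedge (\<lambda>v. cnj (kap x v)) (\<lambda>v. 3 * al x v - \<i> * ps x v) u v
      + kb x * (3 * ext_d al x u v - \<i> * ext_d ps x u v)"
proof -
  note d = forms_differentiable[OF x]
  show "ext_d wc x u v = \<i> * wedge (w1 x) (wb x) u v + 2 * wedge (al x) (wc x) u v"
    using ext_d_w[OF x, of u v]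
    by (simp add: wc_def[symmetric] wedge_def conj_form_def W_eq cnj_forms algebra_simps)
  show w1: "ext_d w1 x u v = wedge (al x) (w1 x) u v + \<i> * wedge (ps x) (w1 x) u v" for u v
    using ext_d_w1[OF x, of u v] by (simp add: wedge_def W_eq algebra_simps)
  have "ext_d wb x u v = cnj (ext_d w1 x u v)"
    unfolding wb_def conj_form_def[abs_def] by (rule ext_d_linear[OF bounded_linear_cnj d(1)])
  then show "ext_d wb x u v = wedge (al x) (wb x) u v - \<i> * wedge (ps x) (wb x) u v"
    by (simp add: w1 wedge_def wb_def conj_form_def al_def ps_def)
  have "ext_d al x u v = of_real (Re (ext_d W x u v))"
    unfolding al_def[abs_def]
    by (rule ext_d_linear[OF bounded_linear_compose[OF bounded_linear_of_real bounded_linear_Re] d(2)])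
  then show al: "ext_d al x u v = (k x * wedge (w1 x) (wc x) u v + kb x * wedge (wb x) (wc x) u v) / 2"
    by (simp add: ext_d_W[OF x] wc_def complex_eq_iff wedge_def wb_def kb_def conj_form_def cplx_def algebra_simps)
  have "ext_d ps x u v = of_real (Im (ext_d W x u v))"
    unfolding ps_def[abs_def]
    by (rule ext_d_linear[OF bounded_linear_compose[OF bounded_linear_of_real bounded_linear_Im] d(2)])
  then show ps: "ext_d ps x u v = - \<i> / 2 * (k x * wedge (w1 x) (wc x) u v - kb x * wedge (wb x) (wc x) u v)"
    by (simp add: ext_d_W[OF x] wc_def complex_eq_iff wedge_def wb_def kb_def conj_form_def cplx_def field_simps)
  have d3: "(\<lambda>y. 3 * al y v) differentiable at x" "(\<lambda>y. \<i> * ps y v) differentiable at x" for v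
    using d by (intro differentiable_mult differentiable_const; simp)+
  have "ext_d kap x u v = 0"
    unfolding kap_def[abs_def] by (rule ext_d_exact[OF V x smooth_k])
  moreover have "ext_d (\<lambda>y v. k y * (3 * al y v + \<i> * ps y v)) x u v
      = wedge (kap x) (\<lambda>v. 3 * al x v + \<i> * ps x v) u v + k x * (3 * ext_d al x u v + \<i> * ext_d ps x u v)"
    unfolding ext_d_mult[OF d(10) differentiable_add[OF d3]] ext_d_add[OF d3]
      ext_d_linear[OF bounded_linear_mult_right d(5)] ext_d_linear[OF bounded_linear_mult_right d(6)]
    by (simp add: kap_def wedge_def)
  ultimately show *: "ext_d bet x u v = wedge (kap x) (\<lambda>v. 3 * al x v + \<i> * ps x v) u v
      + k x * (3 * ext_d al x u v + \<i> * ext_d ps x u v)"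
    unfolding bet_def[abs_def]
    by (simp add: ext_d_add[OF d(7) differentiable_mult[OF d(10) differentiable_add[OF d3]]])
  have "ext_d betb x u v = cnj (ext_d bet x u v)"
    unfolding betb_def conj_form_def[abs_def] by (rule ext_d_linear[OF bounded_linear_cnj d(8)])
  then show "ext_d betb x u v = wedge (\<lambda>v. cnj (kap x v)) (\<lambda>v. 3 * al x v - \<i> * ps x v) u v
      + kb x * (3 * ext_d al x u v - \<i> * ext_d ps x u v)"
    unfolding * al ps
    by (simp add: wedge_def kb_def al_def ps_def wb_def wc_def conj_form_def cplx_def algebra_simps)
qed

text \<open>The combined map \<open>L\<close> is injective between real vector spaces of dimension
  four, hence surjective.\<close>

lemma dual_vectors:
  assumes x: "x \<in> V"
  obtains v where "w x v = p" "w1 x v = z" "Im (W x v) = q"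
proof -
  define L where "L v = (w x v, w1 x v, Im (W x v))" for v
  note lin = smooth_formD(1)[OF smooth_w x] smooth_formD(1)[OF smooth_w1 x] smooth_formD(1)[OF smooth_W x]
  have L: "linear L"
    by (rule linearI) (simp_all add: L_def linear_add[OF lin(1)] linear_add[OF lin(2)] linear_add[OF lin(3)]
        linear_scale[OF lin(1)] linear_scale[OF lin(2)] linear_scale[OF lin(3)])
  have "inj L"
    unfolding linear_injective_0[OF L]
  proof (intro allI impI)
    show "v = 0" if "L v = 0" for v
      using inj[OF x, of v] that by (simp add: L_def zero_prod_def)
  qed
  then have "dim (range L) = dim (UNIV :: n_space set)"
    by (intro dim_image_eq[OF L]) simp
  then have "dim (range L) = DIM(real \<times> complex \<times> real)" by simp
  then have "span (range L) = UNIV" by (simp only: dim_eq_full)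
  moreover have "span (range L) = range L"
    by (rule span_subspace[OF subset_refl span_superset]) (rule linear_subspace_image[OF L subspace_UNIV])
  ultimately have "range L = UNIV" by simp
  then obtain v where "L v = (p, z, q)" by (metis rangeE UNIV_I)
  then show ?thesis using that[of v] by (simp add: L_def)
qed

text \<open>This is d^2 W = 0. Since d(w1 \<and> wc) = (3 al + i ps) \<and> w1 \<and> wc,
  differentiating the equation for dW gives bet \<and> w1 \<and> wc = 0, so \<open>bet\<close> has
  no other components.\<close>

lemma bet_span:
  assumes x: "x \<in> V"
  obtains k1 k2 where "\<And>v. bet x v = k1 * w1 x v + k2 * wc x v"
    "\<And>v. betb x v = cnj k1 * wb x v + cnj k2 * wc x v"
proof -
  note d = forms_differentiable[OF x]
  have dw: "(\<lambda>y. wedge (w1 y) (wc y) u v) differentiable at x" for u v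
    by (rule differentiable_wedge[OF d(1,3)])
  have 0: "wedge12 (bet x) (wedge (w1 x) (wc x)) u v z = 0" for u v z
  proof -
    have "0 = ext_d2 (ext_d W) x u v z" by (rule ext_d2_ext_d[OF V x smooth_W, symmetric])
    also have "\<dots> = ext_d2 (\<lambda>y u v. k y * wedge (w1 y) (wc y) u v) x u v z"
      unfolding ext_d2_def wc_def
      by (simp only: frechet_derivative_cong_open[OF V x ext_d_W])
    also have "\<dots> = wedge12 (kap x) (wedge (w1 x) (wc x)) u v z
        + k x * (wedge12 (wc x) (ext_d w1 x) u v z - wedge12 (w1 x) (ext_d wc x) u v z)"
      unfolding ext_d2_mult[OF d(10) dw] ext_d2_wedge[OF d(1,3)] by (simp add: kap_def[abs_def])
    also have "\<dots> = wedge12 (bet x) (wedge (w1 x) (wc x)) u v z"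
      unfolding wedge12_def ext_d_forms[OF x] bet_def wedge_def by (simp add: algebra_simps)
    finally show ?thesis by simp
  qed
  obtain fx where fx: "w x fx = 0" "w1 x fx = 1" "Im (W x fx) = 0" by (rule dual_vectors[OF x])
  obtain fw where fw: "w x fw = 1" "w1 x fw = 0" "Im (W x fw) = 0" by (rule dual_vectors[OF x])
  \<comment> \<open>Inserting the dual vectors \<open>fx\<close> and \<open>fw\<close> into the
    vanishing 3-form isolates \<open>bet x v\<close>.\<close>
  have *: "bet x v = bet x fx * w1 x v + bet x fw * wc x v" for v
    using 0[of v fx fw] fx fw by (simp add: wedge12_def wedge_def wc_def cplx_def algebra_simps)
  moreover have "betb x v = cnj (bet x fx) * wb x v + cnj (bet x fw) * wc x v" for v
    unfolding betb_def conj_form_def *[of v] by (simp add: wb_def wc_def cplx_def conj_form_def)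
  ultimately show ?thesis by (rule that)
qed

definition conn :: "complex \<Rightarrow> (n_space, mat6) form1" where
  "conn t x v = conn_tab t (al x v, w1 x v, wb x v, wc x v, ps x v, k x * wc x v, kb x * wc x v,
     k x * w1 x v + kb x * wb x v)"

definition curv_plus :: "complex \<Rightarrow> (n_space, mat6) form2" where
  "curv_plus t x u v = curv_tab t (k x * (wedge (w1 x) (wb x) u v + 2 * t * wedge (wc x) (ps x) u v),
     wedge (bet x) (wc x) u v, wedge (w1 x) (bet x) u v, k x * wedge (w1 x) (wc x) u v)"

definition curv_minus :: "complex \<Rightarrow> (n_space, mat6) form2" where
  "curv_minus t x u v = curv_tab' t (kb x * (- wedge (w1 x) (wb x) u v + 2 * t * wedge (wc x) (ps x) u v),
     wedge (betb x) (wc x) u v, wedge (wb x) (betb x) u v, kb x * wedge (wb x) (wc x) u v)"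

lemma smooth_form_tuple:
  "smooth_form V \<alpha> \<Longrightarrow> smooth_form V \<beta> \<Longrightarrow> smooth_form V (\<lambda>x v. (\<alpha> x v, \<beta> x v))"
  if "open V" for \<alpha> :: "(n_space, 'b::real_normed_vector) form1" and \<beta> :: "(n_space, 'c::real_normed_vector) form1"
proof -
  assume a: "smooth_form V \<alpha>" "smooth_form V \<beta>"
  have "bounded_linear (\<lambda>y. (y, 0::'c))" "bounded_linear (\<lambda>y. (0::'b, y))"
    by (intro bounded_linear_Pair bounded_linear_ident bounded_linear_zero)+
  from smooth_form_add[OF V smooth_form_linear[OF V this(1) a(1)] smooth_form_linear[OF V this(2) a(2)]]
  show ?thesis by simp
qed

lemma smooth_conn: "smooth_form V (conn t)"
  unfolding conn_def[abs_def]
  by (rule smooth_form_linear[OF V bounded_linear_conn_tab])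
    (intro smooth_form_tuple V smooth_forms smooth_w1 smooth_form_mult[OF V] smooth_form_add[OF V] smooth_k)

lemma ext_d_conn:
  assumes x: "x \<in> V"
  shows "ext_d (conn t) x u v = conn_tab t (ext_d al x u v, ext_d w1 x u v, ext_d wb x u v, ext_d wc x u v, ext_d ps x u v,
     wedge (kap x) (wc x) u v + k x * ext_d wc x u v,
     wedge (\<lambda>v. cnj (kap x v)) (wc x) u v + kb x * ext_d wc x u v,
     wedge (kap x) (w1 x) u v + k x * ext_d w1 x u v + (wedge (\<lambda>v. cnj (kap x v)) (wb x) u v + kb x * ext_d wb x u v))"
proof -
  note d = forms_differentiable[OF x]
  note m = differentiable_mult[OF d(10) d(3)] differentiable_mult[OF d(11) d(3)]
    differentiable_mult[OF d(10) d(1)] differentiable_mult[OF d(11) d(4)]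
  note p7 = differentiable_Pair[OF m(2) differentiable_add[OF m(3,4)]]
  note p6 = differentiable_Pair[OF m(1) p7]
  note p5 = differentiable_Pair[OF d(6) p6]
  note p4 = differentiable_Pair[OF d(3) p5]
  note p3 = differentiable_Pair[OF d(4) p4]
  note p2 = differentiable_Pair[OF d(1) p3]
  show ?thesis
    unfolding conn_def[abs_def] ext_d_linear[OF bounded_linear_conn_tab differentiable_Pair[OF d(5) p2]]
      ext_d_Pair[OF d(5) p2] ext_d_Pair[OF d(1) p3] ext_d_Pair[OF d(4) p4] ext_d_Pair[OF d(3) p5]
      ext_d_Pair[OF d(6) p6] ext_d_Pair[OF m(1) p7] ext_d_Pair[OF m(2) differentiable_add[OF m(3,4)]]
      ext_d_add[OF m(3,4)] ext_d_mult[OF d(10) d(3)] ext_d_mult[OF d(11) d(3)]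
      ext_d_mult[OF d(10) d(1)] ext_d_mult[OF d(11) d(4)]
    by (simp add: kap_kb[OF x] wedge_def flip: kap_def)
qed

text \<open>The terms quadratic in the connection combine with the structure equations entry by
  entry. Derivatives of k are first rewritten through \<open>bet\<close>, so that they occur only in
  covariant combinations.\<close>

lemma curvature_conn:
  assumes x: "x \<in> V" and t: "t \<noteq> 0"
  shows "conn_curvature (conn t) x u v = curv_plus t x u v + curv_minus t x u v"
  unfolding conn_curvature_def ext_d_conn[OF x] ext_d_forms[OF x] conn_def conn_tab_def conn_entries_def
    curv_plus_def curv_minus_def curv_tab_def curv_tab'_def curv_entries_def curv_entries'_def Let_def wedge_def kap_eq
  using t
  by (auto simp: mat6_eq_iff all_idx6 forall_4 mat6_mult_nth cnj_forms field_simps power2_eq_square)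

lemma ext_d2_curv:
  assumes x: "x \<in> V"
  shows "ext_d2 (\<lambda>x u v. (k x * (wedge (w1 x) (wb x) u v + 2 * t * wedge (wc x) (ps x) u v),
       wedge (bet x) (wc x) u v, wedge (w1 x) (bet x) u v, k x * wedge (w1 x) (wc x) u v)) x u v z
   = (wedge12 (kap x) (\<lambda>u v. wedge (w1 x) (wb x) u v + 2 * t * wedge (wc x) (ps x) u v) u v z
       + k x * (wedge12 (wb x) (ext_d w1 x) u v z - wedge12 (w1 x) (ext_d wb x) u v z
         + 2 * t * (wedge12 (ps x) (ext_d wc x) u v z - wedge12 (wc x) (ext_d ps x) u v z)),
      wedge12 (wc x) (ext_d bet x) u v z - wedge12 (bet x) (ext_d wc x) u v z,
      wedge12 (bet x) (ext_d w1 x) u v z - wedge12 (w1 x) (ext_d bet x) u v z,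
      wedge12 (kap x) (wedge (w1 x) (wc x)) u v z
        + k x * (wedge12 (wc x) (ext_d w1 x) u v z - wedge12 (w1 x) (ext_d wc x) u v z))" (is ?P)
   and "ext_d2 (\<lambda>x u v. (kb x * (- wedge (w1 x) (wb x) u v + 2 * t * wedge (wc x) (ps x) u v),
       wedge (betb x) (wc x) u v, wedge (wb x) (betb x) u v, kb x * wedge (wb x) (wc x) u v)) x u v z
   = (wedge12 (\<lambda>v. cnj (kap x v)) (\<lambda>u v. - wedge (w1 x) (wb x) u v + 2 * t * wedge (wc x) (ps x) u v) u v z
       + kb x * (- (wedge12 (wb x) (ext_d w1 x) u v z - wedge12 (w1 x) (ext_d wb x) u v z)
         + 2 * t * (wedge12 (ps x) (ext_d wc x) u v z - wedge12 (wc x) (ext_d ps x) u v z)),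
      wedge12 (wc x) (ext_d betb x) u v z - wedge12 (betb x) (ext_d wc x) u v z,
      wedge12 (betb x) (ext_d wb x) u v z - wedge12 (wb x) (ext_d betb x) u v z,
      wedge12 (\<lambda>v. cnj (kap x v)) (wedge (wb x) (wc x)) u v z
        + kb x * (wedge12 (wc x) (ext_d wb x) u v z - wedge12 (wb x) (ext_d wc x) u v z))" (is ?M)
proof -
  note d = forms_differentiable[OF x]
  have m: "(\<lambda>y. 2 * t * wedge (wc y) (ps y) u v) differentiable at x" for u v
    by (intro differentiable_mult differentiable_const differentiable_wedge d)
  have n: "(\<lambda>y. - wedge (w1 y) (wb y) u v) differentiable at x" for u v
    by (intro differentiable_minus differentiable_wedge d)
  have tt: "ext_d2 (\<lambda>y u v. 2 * t * wedge (wc y) (ps y) u v) x u v z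
      = 2 * t * (wedge12 (ps x) (ext_d wc x) u v z - wedge12 (wc x) (ext_d ps x) u v z)"
    unfolding ext_d2_linear[OF bounded_linear_mult_right differentiable_wedge[OF d(3,6)]] ext_d2_wedge[OF d(3,6)] ..
  have nn: "ext_d2 (\<lambda>y u v. - wedge (w1 y) (wb y) u v) x u v z
      = - (wedge12 (wb x) (ext_d w1 x) u v z - wedge12 (w1 x) (ext_d wb x) u v z)"
    unfolding ext_d2_linear[OF bounded_linear_minus[OF bounded_linear_ident] differentiable_wedge[OF d(1,4)]]
      ext_d2_wedge[OF d(1,4)] ..
  note s1 = differentiable_add[OF differentiable_wedge[OF d(1,4)] m]
  note s2 = differentiable_add[OF n m]
  note c1 = differentiable_mult[OF d(10) s1] and c2 = differentiable_mult[OF d(11) s2]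
  note q1 = differentiable_mult[OF d(10) differentiable_wedge[OF d(1,3)]]
  note q2 = differentiable_mult[OF d(11) differentiable_wedge[OF d(4,3)]]
  note r1 = differentiable_Pair[OF differentiable_wedge[OF d(1,8)] q1]
  note r2 = differentiable_Pair[OF differentiable_wedge[OF d(4,9)] q2]
  show ?P
    unfolding ext_d2_Pair[OF c1 differentiable_Pair[OF differentiable_wedge[OF d(8,3)] r1]]
      ext_d2_Pair[OF differentiable_wedge[OF d(8,3)] r1] ext_d2_Pair[OF differentiable_wedge[OF d(1,8)] q1]
      ext_d2_mult[OF d(10) s1] ext_d2_add[OF differentiable_wedge[OF d(1,4)] m] tt
      ext_d2_mult[OF d(10) differentiable_wedge[OF d(1,3)]]
      ext_d2_wedge[OF d(1,4)] ext_d2_wedge[OF d(8,3)] ext_d2_wedge[OF d(1,8)] ext_d2_wedge[OF d(1,3)]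
    by (simp add: kap_def[abs_def])
  show ?M
    unfolding ext_d2_Pair[OF c2 differentiable_Pair[OF differentiable_wedge[OF d(9,3)] r2]]
      ext_d2_Pair[OF differentiable_wedge[OF d(9,3)] r2] ext_d2_Pair[OF differentiable_wedge[OF d(4,9)] q2]
      ext_d2_mult[OF d(11) s2] ext_d2_add[OF n m] tt nn
      ext_d2_mult[OF d(11) differentiable_wedge[OF d(4,3)]]
      ext_d2_wedge[OF d(9,3)] ext_d2_wedge[OF d(4,9)] ext_d2_wedge[OF d(4,3)]
    by (simp add: wedge12_def kap_kb[OF x])
qed

lemma differentiable_curv:
  assumes x: "x \<in> V"
  shows "(\<lambda>x. (k x * (wedge (w1 x) (wb x) u v + 2 * t * wedge (wc x) (ps x) u v),
       wedge (bet x) (wc x) u v, wedge (w1 x) (bet x) u v, k x * wedge (w1 x) (wc x) u v)) differentiable at x"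
    "(\<lambda>x. (kb x * (- wedge (w1 x) (wb x) u v + 2 * t * wedge (wc x) (ps x) u v),
       wedge (betb x) (wc x) u v, wedge (wb x) (betb x) u v, kb x * wedge (wb x) (wc x) u v)) differentiable at x"
  by (intro differentiable_Pair differentiable_mult differentiable_add differentiable_minus differentiable_const
      differentiable_wedge forms_differentiable[OF x])+

end

section \<open>Splitting matrix-valued forms into scalar forms and constant matrices\<close>

definition smat :: "complex \<Rightarrow> complex^'n^'m \<Rightarrow> complex^'n^'m" where
  "smat c M = (\<chi> i j. c * M $ i $ j)"

lemma smat_nth [simp]: "smat c M $ i $ j = c * M $ i $ j"
  by (simp add: smat_def)

lemma smat_mult: "smat c M ** N = smat c (M ** N)" "M ** smat c N = smat c (M ** N)"
  by (simp_all add: vec_eq_iff matrix_matrix_mult_def sum_distrib_left algebra_simps)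

text \<open>Reduces the bracket of a connection with a 2-form to ten commutators of fixed matrices,
  each multiplied by a scalar 3-form. Without it the entrywise verification of the Bach condition
  would expand every wedge product on three vectors.\<close>

lemma commutator_split:
  fixes A :: "'e \<Rightarrow> complex^'n^'n" and F :: "'e \<Rightarrow> 'e \<Rightarrow> complex^'n^'n"
  assumes A: "\<And>v. A v = smat (a1 v) M1 + smat (a2 v) M2 + smat (a3 v) M3 + smat (a4 v) M4 + smat (a5 v) M5"
    and F: "\<And>u v. F u v = smat (f u v) N1 + smat (g u v) N2"
  shows "(A u ** F v z + A v ** F z u + A z ** F u v) - (F u v ** A z + F v z ** A u + F z u ** A v)
    = smat (wedge12 a1 f u v z) (M1 ** N1 - N1 ** M1) + smat (wedge12 a2 f u v z) (M2 ** N1 - N1 ** M2)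
    + smat (wedge12 a3 f u v z) (M3 ** N1 - N1 ** M3) + smat (wedge12 a4 f u v z) (M4 ** N1 - N1 ** M4)
    + smat (wedge12 a5 f u v z) (M5 ** N1 - N1 ** M5)
    + smat (wedge12 a1 g u v z) (M1 ** N2 - N2 ** M1) + smat (wedge12 a2 g u v z) (M2 ** N2 - N2 ** M2)
    + smat (wedge12 a3 g u v z) (M3 ** N2 - N2 ** M3) + smat (wedge12 a4 g u v z) (M4 ** N2 - N2 ** M4)
    + smat (wedge12 a5 g u v z) (M5 ** N2 - N2 ** M5)"
  unfolding A F matrix_distribs smat_mult
  by (simp add: vec_eq_iff wedge12_def algebra_simps)

lemma conn_entries_split:
  "conn_entries e1 e2 e3 e4 e5 e6 e7 e8 e9 e10 e11 e12 e13 e14 e15 e16 (a, m, m', l, p, k * l, k' * l, k * m + k' * m')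
     = smat a (conn_entries e1 e2 e3 e4 e5 e6 e7 e8 e9 e10 e11 e12 e13 e14 e15 e16 (1, 0, 0, 0, 0, 0, 0, 0))
     + smat m (conn_entries e1 e2 e3 e4 e5 e6 e7 e8 e9 e10 e11 e12 e13 e14 e15 e16 (0, 1, 0, 0, 0, 0, 0, k))
     + smat m' (conn_entries e1 e2 e3 e4 e5 e6 e7 e8 e9 e10 e11 e12 e13 e14 e15 e16 (0, 0, 1, 0, 0, 0, 0, k'))
     + smat l (conn_entries e1 e2 e3 e4 e5 e6 e7 e8 e9 e10 e11 e12 e13 e14 e15 e16 (0, 0, 0, 1, 0, k, k', 0))
     + smat p (conn_entries e1 e2 e3 e4 e5 e6 e7 e8 e9 e10 e11 e12 e13 e14 e15 e16 (0, 0, 0, 0, 1, 0, 0, 0))"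
  by (simp add: conn_entries_def mat6_eq_iff all_idx6 forall_4 distrib_left mult_ac)

lemma curv_entries_split:
  "curv_entries c1 c2 c3 c4 c5 c6 c7 c8 c9 c10 c11 c12 c13 (a * g, b * f, c * f, d * f) = smat f (curv_entries c1 c2 c3 c4 c5 c6 c7 c8 c9 c10 c11 c12 c13 (0, b, c, d))
     + smat g (curv_entries c1 c2 c3 c4 c5 c6 c7 c8 c9 c10 c11 c12 c13 (a, 0, 0, 0))"
  "curv_entries' c1 c2 c3 c4 c5 c6 c7 c8 c9 c10 c11 c12 c13 (a * g, b * f, c * f, d * f) = smat f (curv_entries' c1 c2 c3 c4 c5 c6 c7 c8 c9 c10 c11 c12 c13 (0, b, c, d))
     + smat g (curv_entries' c1 c2 c3 c4 c5 c6 c7 c8 c9 c10 c11 c12 c13 (a, 0, 0, 0))"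
  by (simp_all add: curv_entries_def curv_entries'_def mat6_eq_iff all_idx6 forall_4 mult_ac add_ac)

lemma cov_d2_eq:
  "cov_d2 A B x u v w = ext_d2 B x u v w
     + ((A x u ** B x v w + A x v ** B x w u + A x w ** B x u v)
       - (B x u v ** A x w + B x v w ** A x u + B x w u ** A x v))"
  by (simp only: cov_d2_def add_diff_eq)

context conf_frame
begin

lemma conn_split:
  "conn t x v = smat (al x v) (conn_tab t (1, 0, 0, 0, 0, 0, 0, 0))
     + smat (w1 x v) (conn_tab t (0, 1, 0, 0, 0, 0, 0, k x))
     + smat (wb x v) (conn_tab t (0, 0, 1, 0, 0, 0, 0, kb x))
     + smat (wc x v) (conn_tab t (0, 0, 0, 1, 0, k x, kb x, 0))
     + smat (ps x v) (conn_tab t (0, 0, 0, 0, 1, 0, 0, 0))"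
  unfolding conn_def conn_tab_def by (rule conn_entries_split)

abbreviation sd1 where "sd1 x \<equiv> wedge (w1 x) (wc x)"
text \<open>Together with \<open>wb\<close> \<and> \<open>ps\<close>, the forms \<open>sd1\<close>
  and \<open>sd2\<close> span one eigenspace of the Hodge star of the null metric. That third form
  never occurs, because \<open>bet\<close> lies in the span of \<open>w1\<close> and
  \<open>wc\<close>.\<close>

definition sd2 where "sd2 t x u v = wedge (w1 x) (wb x) u v + 2 * t * wedge (wc x) (ps x) u v"
abbreviation asd1 where "asd1 x \<equiv> wedge (wb x) (wc x)"
definition asd2 where "asd2 t x u v = - wedge (w1 x) (wb x) u v + 2 * t * wedge (wc x) (ps x) u v"

lemma curv_plus_split:
  assumes bet: "\<And>v. bet x v = k1 * w1 x v + k2 * wc x v"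
  shows "curv_plus t x u v = smat (sd1 x u v) (curv_tab t (0, k1, k2, k x)) + smat (sd2 t x u v) (curv_tab t (k x, 0, 0, 0))"
proof -
  have "wedge (bet x) (wc x) u v = k1 * sd1 x u v" "wedge (w1 x) (bet x) u v = k2 * sd1 x u v"
    by (simp_all add: wedge_def bet algebra_simps)
  then show ?thesis
    unfolding curv_plus_def curv_tab_def Let_def sd2_def[symmetric] by (simp only: curv_entries_split)
qed

lemma curv_minus_split:
  assumes bet: "\<And>v. betb x v = k1 * wb x v + k2 * wc x v"
  shows "curv_minus t x u v = smat (asd1 x u v) (curv_tab' t (0, k1, k2, kb x)) + smat (asd2 t x u v) (curv_tab' t (kb x, 0, 0, 0))"
proof -
  have "wedge (betb x) (wc x) u v = k1 * asd1 x u v" "wedge (wb x) (betb x) u v = k2 * asd1 x u v"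
    by (simp_all add: wedge_def bet algebra_simps)
  then show ?thesis
    unfolding curv_minus_def curv_tab'_def Let_def asd2_def[symmetric] by (simp only: curv_entries_split)
qed

text \<open>Relations between 3-forms that bring the terms of the covariant derivative to a normal
  form in which coefficients can be compared.\<close>

lemma wedge12_sd:
  "wedge12 (w1 x) (sd1 x) u v z = 0" "wedge12 (wc x) (sd1 x) u v z = 0"
  "wedge12 (w1 x) (sd2 t x) u v z = 2 * t * wedge12 (ps x) (sd1 x) u v z"
  "wedge12 (wc x) (sd2 t x) u v z = - wedge12 (wb x) (sd1 x) u v z"
  "wedge12 (wb x) (asd1 x) u v z = 0" "wedge12 (wc x) (asd1 x) u v z = 0"
  "wedge12 (wb x) (asd2 t x) u v z = 2 * t * wedge12 (ps x) (asd1 x) u v z"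
  "wedge12 (wc x) (asd2 t x) u v z = - wedge12 (w1 x) (asd1 x) u v z"
  by (simp_all add: wedge12_def wedge_def sd2_def asd2_def algebra_simps)

text \<open>The exterior derivative is applied to \<open>bet\<close> itself and not to its
  coefficients \<open>k1\<close> and \<open>k2\<close>, whose derivatives therefore never appear;
  the expansion of \<open>bet\<close> is inserted only afterwards.\<close>

lemma ext_d2_curv_plus:
  assumes x: "x \<in> V" and bet: "\<And>v. bet x v = k1 * w1 x v + k2 * wc x v"
  shows "ext_d2 (curv_plus t) x u v z = curv_tab t
     (2 * t * k1 * wedge12 (ps x) (sd1 x) u v z - k2 * wedge12 (wb x) (sd1 x) u v z
        - k x * wedge12 (al x) (sd2 t x) u v z + \<i> * (2 * t - 1) * k x * wedge12 (ps x) (sd2 t x) u v z,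
      - k1 * wedge12 (al x) (sd1 x) u v z - \<i> * k1 * wedge12 (ps x) (sd1 x) u v z + \<i> * k2 * wedge12 (wb x) (sd1 x) u v z,
      - 2 * k2 * wedge12 (al x) (sd1 x) u v z + k x * kb x * wedge12 (wb x) (sd1 x) u v z, 0)"
proof -
  have "ext_d2 (curv_plus t) x u v z = curv_tab t (ext_d2 (\<lambda>x u v. (k x * (wedge (w1 x) (wb x) u v + 2 * t * wedge (wc x) (ps x) u v),
       wedge (bet x) (wc x) u v, wedge (w1 x) (bet x) u v, k x * wedge (w1 x) (wc x) u v)) x u v z)"
    unfolding curv_plus_def[abs_def] by (rule ext_d2_linear[OF bounded_linear_curv_tab differentiable_curv(1)[OF x]])
  also have "\<dots> = curv_tab t
     (2 * t * k1 * wedge12 (ps x) (sd1 x) u v z - k2 * wedge12 (wb x) (sd1 x) u v z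
        - k x * wedge12 (al x) (sd2 t x) u v z + \<i> * (2 * t - 1) * k x * wedge12 (ps x) (sd2 t x) u v z,
      - k1 * wedge12 (al x) (sd1 x) u v z - \<i> * k1 * wedge12 (ps x) (sd1 x) u v z + \<i> * k2 * wedge12 (wb x) (sd1 x) u v z,
      - 2 * k2 * wedge12 (al x) (sd1 x) u v z + k x * kb x * wedge12 (wb x) (sd1 x) u v z, 0)"
    unfolding ext_d2_curv[OF x] ext_d_forms[OF x]
    unfolding kap_eq bet wedge12_def wedge_def sd2_def
    by (rule arg_cong[where f = "curv_tab t"]; simp; intro conjI; simp add: algebra_simps; simp add: field_simps)
  finally show ?thesis .
qed

lemma ext_d2_curv_minus:
  assumes x: "x \<in> V" and bet: "\<And>v. betb x v = k1 * wb x v + k2 * wc x v"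
  shows "ext_d2 (curv_minus t) x u v z = curv_tab' t
     (2 * t * k1 * wedge12 (ps x) (asd1 x) u v z - k2 * wedge12 (w1 x) (asd1 x) u v z
        - kb x * wedge12 (al x) (asd2 t x) u v z - \<i> * (2 * t - 1) * kb x * wedge12 (ps x) (asd2 t x) u v z,
      - k1 * wedge12 (al x) (asd1 x) u v z + \<i> * k1 * wedge12 (ps x) (asd1 x) u v z - \<i> * k2 * wedge12 (w1 x) (asd1 x) u v z,
      - 2 * k2 * wedge12 (al x) (asd1 x) u v z + k x * kb x * wedge12 (w1 x) (asd1 x) u v z, 0)"
proof -
  have "ext_d2 (curv_minus t) x u v z = curv_tab' t (ext_d2 (\<lambda>x u v. (kb x * (- wedge (w1 x) (wb x) u v + 2 * t * wedge (wc x) (ps x) u v),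
       wedge (betb x) (wc x) u v, wedge (wb x) (betb x) u v, kb x * wedge (wb x) (wc x) u v)) x u v z)"
    unfolding curv_minus_def[abs_def] by (rule ext_d2_linear[OF bounded_linear_curv_tab' differentiable_curv(2)[OF x]])
  also have "\<dots> = curv_tab' t
     (2 * t * k1 * wedge12 (ps x) (asd1 x) u v z - k2 * wedge12 (w1 x) (asd1 x) u v z
        - kb x * wedge12 (al x) (asd2 t x) u v z - \<i> * (2 * t - 1) * kb x * wedge12 (ps x) (asd2 t x) u v z,
      - k1 * wedge12 (al x) (asd1 x) u v z + \<i> * k1 * wedge12 (ps x) (asd1 x) u v z - \<i> * k2 * wedge12 (w1 x) (asd1 x) u v z,
      - 2 * k2 * wedge12 (al x) (asd1 x) u v z + k x * kb x * wedge12 (w1 x) (asd1 x) u v z, 0)"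
    unfolding ext_d2_curv[OF x] ext_d_forms[OF x]
    unfolding kap_eq(2) bet wedge12_def wedge_def asd2_def
    by (rule arg_cong[where f = "curv_tab' t"]; simp; intro conjI; simp add: algebra_simps; simp add: field_simps)
  finally show ?thesis .
qed

text \<open>In the top row of the first statement the coefficients of all 3-forms cancel identically
  in t, except for \<open>wb\<close> \<and> \<open>sd1\<close> in the column of \<open>wc\<close>:
  there |k|^2 is multiplied by (1 + t)/4 - t (3t - 1)/4 = (1 - t)(1 + 3t)/4, which vanishes at the
  two given values.\<close>

lemma cov_d2_curv:
  assumes x: "x \<in> V" and t: "t = 1 \<or> t = -1/3"
  shows "cov_d2 (conn t) (curv_plus t) x u v z = 0" "cov_d2 (conn t) (curv_minus t) x u v z = 0"
proof -
  obtain k1 k2 where bet: "\<And>v. bet x v = k1 * w1 x v + k2 * wc x v"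
    "\<And>v. betb x v = cnj k1 * wb x v + cnj k2 * wc x v" using bet_span[OF x] by blast
  show "cov_d2 (conn t) (curv_plus t) x u v z = 0"
    unfolding cov_d2_eq ext_d2_curv_plus[OF x bet(1)]
      commutator_split[of "conn t x" "al x" _ "w1 x" _ "wb x" _ "wc x" _ "ps x" _ "curv_plus t x" "sd1 x" _ "sd2 t x",
        OF conn_split curv_plus_split[OF bet(1)]] wedge12_sd
    using t
    by (elim disjE; simp add: mat6_eq_iff all_idx6 forall_4 mat6_mult_nth conn_tab_def conn_entries_def
        curv_tab_def curv_entries_def Let_def; intro conjI; simp add: field_simps power2_eq_square)
  show "cov_d2 (conn t) (curv_minus t) x u v z = 0"
    unfolding cov_d2_eq ext_d2_curv_minus[OF x bet(2)]
      commutator_split[of "conn t x" "al x" _ "w1 x" _ "wb x" _ "wc x" _ "ps x" _ "curv_minus t x" "asd1 x" _ "asd2 t x",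
        OF conn_split curv_minus_split[OF bet(2)]] wedge12_sd
    using t
    by (elim disjE; simp add: mat6_eq_iff all_idx6 forall_4 mat6_mult_nth conn_tab_def conn_entries_def
        curv_tab'_def curv_entries'_def Let_def; intro conjI; simp add: field_simps power2_eq_square)
qed

end

section \<open>The gauge transformation to an adapted coframe\<close>

definition dot :: "complex^4 \<Rightarrow> complex^4 \<Rightarrow> complex" where
  "dot p x = (\<Sum>i\<in>UNIV. p $ i * x $ i)"

definition outer :: "complex^4 \<Rightarrow> complex^4 \<Rightarrow> complex^4^4" where
  "outer x p = (\<chi> i j. x $ i * p $ j)"

lemma dot_simps: "dot 0 x = 0" "dot x 0 = 0" "dot (- x) y = - dot x y" "dot x y = dot y x"
  by (simp_all add: dot_def sum_negf mult.commute)

lemma dot_0 [simp]: "dot 0 x = 0" "dot x 0 = 0"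
  by (rule dot_simps)+

lemma outer_0 [simp]: "outer 0 x = 0" "outer x 0 = 0"
  by (simp_all add: outer_def vec_eq_iff)

lemma dot_matrix: "dot (M *v x) y = dot x (transpose M *v y)"
  unfolding dot_def matrix_vector_mult_def transpose_def
  by (simp add: sum_distrib_left sum_distrib_right, subst sum.swap)
    (simp add: mult_ac)

text \<open>Block notation of shape 1 + 4 + 1, for which products are again blocks. Computations
  with the gauge matrix then never descend to single entries.\<close>

definition blk :: "complex \<Rightarrow> complex^4 \<Rightarrow> complex \<Rightarrow> complex^4 \<Rightarrow> complex^4^4 \<Rightarrow> complex^4 \<Rightarrow> complex \<Rightarrow> complex^4 \<Rightarrow> complex \<Rightarrow> mat6" where
  "blk a p s x M r z y f = (\<chi> i j. case i of
       Inl _ \<Rightarrow> (case j of Inl _ \<Rightarrow> a | Inr (Inl j) \<Rightarrow> p $ j | Inr (Inr _) \<Rightarrow> s)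
     | Inr (Inl i) \<Rightarrow> (case j of Inl _ \<Rightarrow> x $ i | Inr (Inl j) \<Rightarrow> M $ i $ j | Inr (Inr _) \<Rightarrow> r $ i)
     | Inr (Inr _) \<Rightarrow> (case j of Inl _ \<Rightarrow> z | Inr (Inl j) \<Rightarrow> y $ j | Inr (Inr _) \<Rightarrow> f))"

lemma blk_nth [simp]:
  "blk a p s x M r z y f $ Inl u $ Inl u' = a" "blk a p s x M r z y f $ Inl u $ Inr (Inl j) = p $ j"
  "blk a p s x M r z y f $ Inl u $ Inr (Inr u') = s"
  "blk a p s x M r z y f $ Inr (Inl i) $ Inl u' = x $ i" "blk a p s x M r z y f $ Inr (Inl i) $ Inr (Inl j) = M $ i $ j"
  "blk a p s x M r z y f $ Inr (Inl i) $ Inr (Inr u') = r $ i"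
  "blk a p s x M r z y f $ Inr (Inr u) $ Inl u' = z" "blk a p s x M r z y f $ Inr (Inr u) $ Inr (Inl j) = y $ j"
  "blk a p s x M r z y f $ Inr (Inr u) $ Inr (Inr u') = f"
  by (simp_all add: blk_def)

lemma mat6_nth_mult:
  "((A :: mat6) ** B) $ r $ s = A $ r $ Inl () * B $ Inl () $ s
     + (\<Sum>i\<in>UNIV. A $ r $ Inr (Inl i) * B $ Inr (Inl i) $ s) + A $ r $ Inr (Inr ()) * B $ Inr (Inr ()) $ s"
  by (simp add: matrix_matrix_mult_def sum_idx6)

lemma blk_mult:
  "blk a p s x M r z y f ** blk a' p' s' x' M' r' z' y' f' = blk
     (a * a' + dot p x' + s * z') (a *s p' + transpose M' *v p + s *s y') (a * s' + dot p r' + s * f')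
     (a' *s x + M *v x' + z' *s r) (outer x p' + M ** M' + outer r y') (s' *s x + M *v r' + f' *s r)
     (z * a' + dot y x' + f * z') (z *s p' + transpose M' *v y + f *s y') (z * s' + dot y r' + f * f')"
  unfolding mat6_eq_iff all_idx6 mat6_nth_mult
  by (simp add: dot_def outer_def matrix_vector_mult_def matrix_matrix_mult_def transpose_def mult.commute)

lemma blk_transpose:
  "transpose (blk a p s x M r z y f) = blk a x z p (transpose M) y s r f"
  by (simp add: mat6_eq_iff all_idx6 transpose_def)

lemma blk_mat_1: "mat 1 = blk 1 0 0 0 (mat 1) 0 0 0 1"
  by (simp add: mat6_eq_iff all_idx6 mat_def)

definition nb :: "4 \<Rightarrow> n_space" where
  "nb c = (if c = 1 then (axis 1 1, 0) else if c = 2 then (axis 2 1, 0) else if c = 3 then (axis 3 1, 0) else (0, 1))"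

definition nc :: "n_space \<Rightarrow> 4 \<Rightarrow> real" where
  "nc v c = (if c = 1 then fst v $ 1 else if c = 2 then fst v $ 2 else if c = 3 then fst v $ 3 else snd v)"

lemma n_space_expand: "v = (\<Sum>c\<in>UNIV. nc v c *\<^sub>R nb c)"
  by (simp add: sum_4 nb_def nc_def prod_eq_iff vec_eq_iff forall_3 axis_def)

lemma linear_n_space: 
  assumes "linear (f :: n_space \<Rightarrow> complex)"
  shows "f v = (\<Sum>c\<in>UNIV. f (nb c) * of_real (nc v c))"
proof -
  have "f (\<Sum>c\<in>UNIV. nc v c *\<^sub>R nb c) = (\<Sum>c\<in>UNIV. f (nb c) * of_real (nc v c))"
    by (simp only: linear_sum[OF assms] linear_scale[OF assms] scaleR_conv_of_real mult.commute)
  then show ?thesis by (simp only: n_space_expand[symmetric])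
qed

text \<open>The Gram matrix of the metric in the complex null coframe ordered as \<open>w1\<close>,
  \<open>wb\<close>, \<open>wc\<close>, \<open>ps\<close>.\<close>

definition eta0 :: "real \<Rightarrow> complex^4^4" where
  "eta0 t = (\<chi> i j. if i = 1 \<and> j = 2 \<or> i = 2 \<and> j = 1 then 1
     else if i = 3 \<and> j = 4 \<or> i = 4 \<and> j = 3 then 2 * of_real t else 0)"

definition eta0_inv :: "real \<Rightarrow> complex^4^4" where
  "eta0_inv t = (\<chi> i j. if i = 1 \<and> j = 2 \<or> i = 2 \<and> j = 1 then 1
     else if i = 3 \<and> j = 4 \<or> i = 4 \<and> j = 3 then 1 / (2 * of_real t) else 0)"

lemma eta0_inv: "t \<noteq> 0 \<Longrightarrow> eta0 t ** eta0_inv t = mat 1" "t \<noteq> 0 \<Longrightarrow> eta0_inv t ** eta0 t = mat 1"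
  by (simp_all add: eta0_def eta0_inv_def vec_eq_iff forall_4 matrix_matrix_mult_def sum_4 mat_def)

text \<open>The bilinear form of signature (4,2) on the tractor space, written in a basis with two
  null vectors in the corners, whose orthogonal group contains the conformal connection.\<close>

definition Jform :: "complex^4^4 \<Rightarrow> mat6" where
  "Jform \<eta> = blk 0 0 (- 1) 0 \<eta> 0 (- 1) 0 0"

lemma Jform_mult: "Jform \<eta> ** Jform \<eta>' = blk 1 0 0 0 (\<eta> ** \<eta>') 0 0 0 1"
  by (simp add: Jform_def blk_mult)

lemma transpose_diff: "transpose (A - B) = transpose A - transpose (B :: 'a::ab_group_add^'n^'m)"
  by (simp add: transpose_def vec_eq_iff)

lemma bounded_linear_transpose: "bounded_linear (transpose :: complex^'n^'m \<Rightarrow> complex^'m^'n)"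
  unfolding linear_conv_bounded_linear[symmetric] linear_iff
  by (simp add: transpose_def vec_eq_iff)

section \<open>The complex null coframe and its matrix in coordinates\<close>

context conf_frame
begin

definition xi :: "4 \<Rightarrow> (n_space, complex) form1" where
  "xi a = (if a = 1 then w1 else if a = 2 then wb else if a = 3 then wc else ps)"

definition X :: "n_space \<Rightarrow> complex^4^4" where
  "X x = (\<chi> a c. xi a x (nb c))"

definition Y :: "n_space \<Rightarrow> complex^4^4" where
  "Y x = matrix_inv (X x)"

lemma smooth_xi: "smooth_form V (xi a)"
  unfolding xi_def using smooth_w1 smooth_forms by simp

lemma xi_zero: 
  assumes x: "x \<in> V" and "\<And>a. xi a x v = 0" shows "v = 0"
  using inj[OF x, of v] assms(2)[of 1] assms(2)[of 3] assms(2)[of 4]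
  by (simp add: xi_def wc_def cplx_def ps_def)

lemma xi_eq: 
  assumes x: "x \<in> V" and "\<And>a. xi a x u = xi a x v" shows "u = v"
  using xi_zero[OF x, of "u - v"] assms(2) linear_diff[OF smooth_formD(1)[OF smooth_xi x]] by simp

text \<open>A complex kernel vector splits into two real tangent vectors. The reality of
  \<open>wc\<close> and \<open>ps\<close> and the conjugacy of \<open>w1\<close> and
  \<open>wb\<close> show that each of them is annihilated by the whole coframe.\<close>

lemma invertible_X:
  assumes x: "x \<in> V" shows "invertible (X x)"
proof -
  have lin: "linear (xi a x)" for a by (rule smooth_formD(1)[OF smooth_xi x])
  have "z = 0" if z: "X x *v z = 0" for z
  proof -
    define v where "v = (\<Sum>c\<in>UNIV. Re (z $ c) *\<^sub>R nb c)"
    define v' where "v' = (\<Sum>c\<in>UNIV. Im (z $ c) *\<^sub>R nb c)"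
    have "xi a x v + \<i> * xi a x v' = (\<Sum>c\<in>UNIV. xi a x (nb c) * z $ c)" for a
      unfolding v_def v'_def linear_sum[OF lin] linear_scale[OF lin] scaleR_conv_of_real sum_distrib_left sum.distrib[symmetric]
      by (rule sum.cong) (simp_all add: complex_eq_iff)
    also have "\<dots> a = (X x *v z) $ a" for a
      by (simp add: X_def matrix_vector_mult_def)
    finally have 0: "xi a x v + \<i> * xi a x v' = 0" for a using z by simp
    have "w x v = 0 \<and> w x v' = 0" using 0[of 3] by (simp add: xi_def wc_def cplx_def complex_eq_iff)
    moreover have "Im (W x v) = 0 \<and> Im (W x v') = 0" using 0[of 4] by (simp add: xi_def ps_def complex_eq_iff)
    moreover have "w1 x v = 0 \<and> w1 x v' = 0"
      using 0[of 1] 0[of 2] by (auto simp: xi_def wb_def conj_form_def complex_eq_iff)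
    ultimately have "v = 0" "v' = 0" using inj[OF x] by auto
    moreover have "nc v c = Re (z $ c)" "nc v' c = Im (z $ c)" for c
      using exhaust_4[of c] unfolding v_def v'_def
      by (auto simp: nc_def nb_def sum_4 axis_def)
    moreover have "nc 0 c = 0" for c by (simp add: nc_def)
    ultimately show "z = 0" by (simp add: vec_eq_iff complex_eq_iff)
  qed
  then have "\<exists>N. N ** X x = mat 1" using matrix_left_invertible_ker by blast
  then show ?thesis using invertible_left_inverse by blast
qed

lemma smooth_Y: "smooth_on V (\<lambda>x. Y x $ c $ a)"
  unfolding Y_def
  by (rule smooth_on_matrix_inv[OF V _ invertible_X]) (simp add: X_def smooth_formD(2)[OF smooth_xi])

lemma coframe_expand:
  assumes x: "x \<in> V" and f: "linear (f :: n_space \<Rightarrow> complex)"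
  shows "f v = (\<Sum>a\<in>UNIV. (\<Sum>c\<in>UNIV. f (nb c) * Y x $ c $ a) * xi a x v)"
proof -
  let ?n = "(\<chi> c. of_real (nc v c)) :: complex^4" and ?xi = "(\<chi> a. xi a x v) :: complex^4"
  have "?xi = X x *v ?n"
    by (simp add: vec_eq_iff matrix_vector_mult_def X_def linear_n_space[OF smooth_formD(1)[OF smooth_xi x], of _ v])
  then have "Y x *v ?xi = ?n"
    by (simp add: matrix_vector_mul_assoc Y_def matrix_inv_mult[OF invertible_X[OF x]])
  then have n: "of_real (nc v c) = (\<Sum>a\<in>UNIV. Y x $ c $ a * xi a x v)" for c
    by (simp add: vec_eq_iff matrix_vector_mult_def)
  show ?thesis
    unfolding linear_n_space[OF f, of v] n sum_distrib_left sum_distrib_right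
    by (subst sum.swap) (simp add: mult_ac)
qed

end

text \<open>Relates an arbitrary real adapted coframe to the null coframe: both express the same
  metric. The free metric in the conformal class has already been absorbed into the choice of
  \<open>w\<close>, \<open>w1\<close>, \<open>W\<close>.\<close>

locale adapted_frame = conf_frame V w w1 W k for V w w1 W k +
  fixes t :: real and \<eta> :: "real^4^4" and \<theta> :: "4 \<Rightarrow> (n_space, real) form1" and e :: "4 \<Rightarrow> n_space \<Rightarrow> n_space"
  assumes t: "t \<noteq> 0" and eta_sym: "transpose \<eta> = \<eta>" and smooth_theta: "\<And>i. smooth_form V (\<theta> i)"
    and dual: "\<And>x i j. x \<in> V \<Longrightarrow> \<theta> i x (e j x) = (if i = j then 1 else 0)"
    and metric: "\<And>x u v. x \<in> V \<Longrightarrow> (\<Sum>i\<in>UNIV. \<Sum>j\<in>UNIV. \<eta> $ i $ j * \<theta> i x u * \<theta> j x v)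
      = 2 * Re (w1 x u * cnj (w1 x v)) + 2 * t * (w x u * Im (W x v) + w x v * Im (W x u))"
begin

definition T where "T = complex_of_real t"
definition etac :: "complex^4^4" where "etac = (\<chi> i j. of_real (\<eta> $ i $ j))"
definition Bm :: "n_space \<Rightarrow> complex^4^4" where
  "Bm x = (\<chi> i a. \<Sum>c\<in>UNIV. of_real (\<theta> i x (nb c)) * Y x $ c $ a)"
definition Em :: "n_space \<Rightarrow> complex^4^4" where
  "Em x = (\<chi> a j. xi a x (e j x))"
text \<open>The components of - \<open>al\<close> in the null coframe: the covector of the conformal
  translation that cancels the corner entry of \<open>conn\<close>.\<close>

definition cv :: "n_space \<Rightarrow> complex^4" where
  "cv x = (\<chi> a. - (\<Sum>c\<in>UNIV. al x (nb c) * Y x $ c $ a))"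
text \<open>The change of coframe \<open>Bm\<close> composed with the conformal translation by
  \<open>cv\<close>. The entry with half the square of \<open>cv\<close> and the last column are
  forced by compatibility with \<open>Jform\<close>, see \<open>hm_J\<close>.\<close>

definition hm :: "n_space \<Rightarrow> mat6" where
  "hm x = (let n = eta0_inv t *v cv x in blk 1 (cv x) (dot (cv x) n / 2) 0 (Bm x) (Bm x *v n) 0 0 1)"

lemma T: "T \<noteq> 0" using t by (simp add: T_def)

lemma theta_eq: 
  assumes x: "x \<in> V" shows "of_real (\<theta> i x v) = (\<Sum>a\<in>UNIV. Bm x $ i $ a * xi a x v)"
proof -
  have "linear (\<lambda>v. complex_of_real (\<theta> i x v))"
    using linear_compose[OF smooth_formD(1)[OF smooth_theta x] bounded_linear.linear[OF bounded_linear_of_real]]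
    by (simp only: o_def)
  from coframe_expand[OF x this, of v] show ?thesis by (simp add: Bm_def)
qed

lemma al_eq:
  assumes x: "x \<in> V" shows "al x v = - (\<Sum>a\<in>UNIV. cv x $ a * xi a x v)"
  using coframe_expand[OF x smooth_formD(1)[OF smooth_forms(3) x], of v] by (simp add: cv_def sum_negf)

lemma Bm_Em: assumes x: "x \<in> V" shows "Bm x ** Em x = mat 1" "Em x ** Bm x = mat 1"
proof -
  show *: "Bm x ** Em x = mat 1"
    using dual[OF x] by (simp add: vec_eq_iff matrix_matrix_mult_def Em_def theta_eq[OF x, symmetric] mat_def)
  then show "Em x ** Bm x = mat 1" by (simp only: matrix_left_right_inverse)
qed

lemma xi_theta: 
  assumes x: "x \<in> V" shows "xi a x v = (\<Sum>i\<in>UNIV. Em x $ a $ i * of_real (\<theta> i x v))"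
proof -
  have "(\<chi> i. of_real (\<theta> i x v)) = Bm x *v (\<chi> a. xi a x v)"
    by (simp add: vec_eq_iff matrix_vector_mult_def theta_eq[OF x])
  then have "Em x *v (\<chi> i. of_real (\<theta> i x v)) = (\<chi> a. xi a x v)"
    by (simp add: matrix_vector_mul_assoc Bm_Em[OF x])
  then show ?thesis by (simp add: vec_eq_iff matrix_vector_mult_def)
qed

lemma frame_expand: assumes x: "x \<in> V" shows "v = (\<Sum>i\<in>UNIV. \<theta> i x v *\<^sub>R e i x)"
proof (rule xi_eq[OF x])
  fix a
  note l = smooth_formD(1)[OF smooth_xi x, of a]
  show "xi a x v = xi a x (\<Sum>i\<in>UNIV. \<theta> i x v *\<^sub>R e i x)"
    unfolding xi_theta[OF x, of a v] linear_sum[OF l] linear_scale[OF l]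
    by (simp add: Em_def scaleR_conv_of_real mult.commute)
qed

lemma sum_eta0: "(\<Sum>a\<in>UNIV. \<Sum>b\<in>UNIV. eta0 t $ a $ b * xi a x u * xi b x v)
   = of_real (2 * Re (w1 x u * cnj (w1 x v)) + 2 * t * (w x u * Im (W x v) + w x v * Im (W x u)))"
  by (simp add: sum_4 eta0_def xi_def wb_def wc_def ps_def conj_form_def cplx_def complex_eq_iff algebra_simps)

lemma eta_Em: assumes x: "x \<in> V" shows "transpose (Em x) ** eta0 t ** Em x = etac"
proof -
  have "(transpose (Em x) ** eta0 t ** Em x) $ i $ j = (\<Sum>a\<in>UNIV. \<Sum>b\<in>UNIV. eta0 t $ a $ b * xi a x (e i x) * xi b x (e j x))" for i j
    unfolding matrix_matrix_mult_def transpose_def Em_def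
    by (simp add: sum_distrib_left sum_distrib_right, subst sum.swap) (simp add: mult_ac)
  also have "\<dots> i j = of_real (\<eta> $ i $ j)" for i j
    unfolding sum_eta0 metric[OF x, symmetric]
    by (simp add: dual[OF x] if_distrib[of "\<lambda>y. _ * y"] cong: if_cong)
  finally show ?thesis by (simp add: vec_eq_iff etac_def)
qed

lemma eta_Bm: assumes x: "x \<in> V" shows "transpose (Bm x) ** etac ** Bm x = eta0 t"
proof -
  have "transpose (Bm x) ** etac ** Bm x = transpose (Em x ** Bm x) ** eta0 t ** (Em x ** Bm x)"
    by (simp add: eta_Em[OF x, symmetric] matrix_transpose_mul matrix_mul_assoc)
  then show ?thesis by (simp add: Bm_Em[OF x] transpose_mat)
qed

lemma transpose_etac: "transpose etac = etac"
  using eta_sym by (simp add: etac_def vec_eq_iff transpose_def)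

lemma eta0_cv: "eta0 t *v (eta0_inv t *v v) = v"
  by (simp add: matrix_vector_mul_assoc eta0_inv[OF t])

lemma hm_J: assumes x: "x \<in> V" shows "transpose (hm x) ** Jform etac ** hm x = Jform (eta0 t)"
proof -
  define n where "n = eta0_inv t *v cv x"
  have 1: "transpose (Bm x) *v (etac *v (Bm x *v n)) = cv x"
  proof -
    have "transpose (Bm x) *v (etac *v (Bm x *v n)) = (transpose (Bm x) ** etac ** Bm x) *v n"
      by (simp only: matrix_vector_mul_assoc matrix_mul_assoc)
    then show ?thesis by (simp only: eta_Bm[OF x] n_def eta0_cv)
  qed
  have "dot (etac *v (Bm x *v n)) (Bm x *v n) = dot (Bm x *v n) (etac *v (Bm x *v n))"
    by (rule dot_simps(4))
  also have "\<dots> = dot n (transpose (Bm x) *v (etac *v (Bm x *v n)))" by (rule dot_matrix)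
  also have "\<dots> = dot n (cv x)" by (simp only: 1)
  also have "\<dots> = dot (cv x) n" by (rule dot_simps(4))
  finally have 2: "dot (etac *v (Bm x *v n)) (Bm x *v n) = dot (cv x) n" .
  have 3: "(transpose (Bm x) ** etac) *v (Bm x *v n) = cv x"
    using 1 by (simp only: matrix_vector_mul_assoc matrix_mul_assoc)
  have 4: "(etac *v (Bm x *v n)) v* Bm x = cv x"
    using 1 by (simp only: transpose_matrix_vector)
  have "hm x = blk 1 (cv x) (dot (cv x) n / 2) 0 (Bm x) (Bm x *v n) 0 0 1"
    by (simp add: hm_def n_def Let_def)
  then show ?thesis
    by (simp add: Jform_def blk_transpose blk_mult eta_Bm[OF x] transpose_etac 2 3 4)
qed

end

context adapted_frame
begin

text \<open>The inverse is read off from the orthogonality relation \<open>hm_J\<close>, which also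
  makes its smoothness immediate.\<close>

definition hi :: "n_space \<Rightarrow> mat6" where
  "hi x = Jform (eta0_inv t) ** transpose (hm x) ** Jform etac"

lemma hi: assumes x: "x \<in> V" shows "hi x ** hm x = mat 1" "hm x ** hi x = mat 1"
proof -
  show "hi x ** hm x = mat 1"
    unfolding hi_def using hm_J[OF x]
    by (simp add: matrix_mul_assoc[symmetric] Jform_mult eta0_inv[OF t] blk_mat_1)
  then show "hm x ** hi x = mat 1" by (simp only: matrix_left_right_inverse)
qed

lemma smooth_Bm: "smooth_on V (\<lambda>x. Bm x $ i $ a)"
  unfolding Bm_def
  by (simp, rule smooth_on_sum[OF V], rule smooth_on_mult[OF V smooth_on_of_real[OF V] smooth_Y],
      rule smooth_formD(2)[OF smooth_theta])

lemma smooth_cv: "smooth_on V (\<lambda>x. cv x $ a)"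
  unfolding cv_def
  by (simp, rule smooth_on_minus[OF V], rule smooth_on_sum[OF V], rule smooth_on_mult[OF V _ smooth_Y],
      rule smooth_formD(2)[OF smooth_forms(3)])

lemma smooth_hm: "smooth_on V hm"
proof (intro smooth_on_vec[OF V])
  fix r s
  have n: "smooth_on V (\<lambda>x. (eta0_inv t *v cv x) $ i)" for i
    unfolding matrix_vector_mult_def
    by (simp, rule smooth_on_sum[OF V], rule smooth_on_mult[OF V smooth_on_const smooth_cv])
  have m: "smooth_on V (\<lambda>x. (Bm x *v (eta0_inv t *v cv x)) $ i)" for i
  proof -
    have "smooth_on V (\<lambda>x. \<Sum>a\<in>UNIV. Bm x $ i $ a * (eta0_inv t *v cv x) $ a)"
      by (rule smooth_on_sum[OF V], rule smooth_on_mult[OF V smooth_Bm n])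
    then show ?thesis by (subst matrix_vector_mult_def) simp
  qed
  have d: "smooth_on V (\<lambda>x. dot (cv x) (eta0_inv t *v cv x) / 2)"
    unfolding dot_def divide_inverse
    by (rule smooth_on_mult[OF V _ smooth_on_const], rule smooth_on_sum[OF V], rule smooth_on_mult[OF V smooth_cv n])
  have "\<forall>r s. smooth_on V (\<lambda>x. hm x $ r $ s)"
    by (simp add: hm_def Let_def all_idx6 smooth_Bm smooth_cv m d)
  then show "smooth_on V (\<lambda>x. hm x $ r $ s)" by blast
qed

lemma smooth_hi: "smooth_on V hi"
  unfolding hi_def[abs_def]
  by (rule smooth_on_bilinear[OF V bounded_bilinear_matrix_mult
        smooth_on_bilinear[OF V bounded_bilinear_matrix_mult smooth_on_const
          smooth_on_linear[OF V bounded_linear_transpose smooth_hm]] smooth_on_const])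

definition Acon :: "(n_space, mat6) form1" where
  "Acon x v = (hm x ** conn T x v - frechet_derivative hm (at x) v) ** hi x"

lemma Acon_gauge: 
  assumes x: "x \<in> V" shows "Acon x v ** hm x = hm x ** conn T x v - frechet_derivative hm (at x) v"
  unfolding Acon_def by (simp add: matrix_mul_assoc[symmetric] hi[OF x])

lemma smooth_Acon: "smooth_form V Acon"
  unfolding smooth_form_def
proof (intro conjI ballI allI)
  show "smooth_on V (\<lambda>x. Acon x v)" for v
    unfolding Acon_def
    by (rule smooth_on_bilinear[OF V bounded_bilinear_matrix_mult smooth_on_diff[OF V
        smooth_on_bilinear[OF V bounded_bilinear_matrix_mult smooth_hm smooth_formD(2)[OF smooth_conn]]
        smooth_on_frechet_derivative[OF smooth_hm]] smooth_hi])
  show "linear (Acon x)" if x: "x \<in> V" for x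
  proof (rule linearI)
    note l = smooth_formD(1)[OF smooth_conn x, of T] has_derivative_linear[OF smooth_on_has_derivative[OF smooth_hm x]]
    show "Acon x (u + v) = Acon x u + Acon x v" for u v
      by (simp add: Acon_def linear_add[OF l(1)] linear_add[OF l(2)] matrix_distribs)
    show "Acon x (r *\<^sub>R v) = r *\<^sub>R Acon x v" for r v
      by (simp add: Acon_def linear_scale[OF l(1)] linear_scale[OF l(2)] matrix_distribs
          matrix_mult.scaleR_left matrix_mult.scaleR_right algebra_simps)
  qed
qed

lemma curvature_Acon:
  assumes x: "x \<in> V"
  shows "conn_curvature Acon x u v ** hm x = hm x ** (curv_plus T x u v + curv_minus T x u v)"
  unfolding curvature_conn[OF x T, symmetric]
  by (rule conn_curvature_gauge[OF V smooth_conn smooth_Acon smooth_hm Acon_gauge x])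

text \<open>The explicit connection takes values in the orthogonal Lie algebra of the tractor form.
  After transport to \<open>Acon\<close> this determines the last row and column and ties the top
  row to the last column.\<close>

lemma conn_skew: "Jform (eta0 t) ** conn T x v + transpose (conn T x v) ** Jform (eta0 t) = 0"
  using T
  by (simp add: mat6_eq_iff all_idx6 forall_4 mat6_mult_nth Jform_def eta0_def conn_def conn_tab_def
      conn_entries_def transpose_def power2_eq_square T_def[symmetric]; simp add: field_simps)

lemma Acon_skew:
  assumes x: "x \<in> V" shows "Jform etac ** Acon x v + transpose (Acon x v) ** Jform etac = 0"
proof -
  let ?J = "Jform etac" and ?h = "hm x" and ?A = "Acon x v" and ?d = "frechet_derivative hm (at x) v" and ?K = "conn T x v"
  note d = smooth_on_differentiable[OF smooth_hm x]
  note c = differentiable_bilinear[OF bounded_bilinear_matrix_mult]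
  have dt: "(\<lambda>y. transpose (hm y)) differentiable at x"
    using smooth_on_differentiable[OF smooth_on_linear[OF V bounded_linear_transpose smooth_hm] x] .
  \<comment> \<open>Differentiating the orthogonality relation, whose right-hand side is constant,
    shows that the inhomogeneous term of the gauge law is itself skew.\<close>
  have "frechet_derivative (\<lambda>y. transpose (hm y) ** ?J ** hm y) (at x) v = frechet_derivative (\<lambda>y. Jform (eta0 t)) (at x) v"
    by (rule fun_cong[OF frechet_derivative_cong_open[OF V x hm_J]])
  then have "transpose ?h ** ?J ** ?d + (transpose ?h ** 0 + transpose ?d ** ?J) ** ?h = 0"
    by (simp only: frechet_derivative_matrix_mult[OF c[OF dt differentiable_const] d]
        frechet_derivative_matrix_mult[OF dt differentiable_const]
        frechet_derivative_linear[OF bounded_linear_transpose d] frechet_derivative_const)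
  then have 1: "transpose ?h ** ?J ** ?d + transpose ?d ** ?J ** ?h = 0" by simp
  have "transpose ?h ** (?J ** ?A + transpose ?A ** ?J) ** ?h
      = transpose ?h ** ?J ** (?A ** ?h) + transpose (?A ** ?h) ** ?J ** ?h"
    by (simp add: matrix_distribs matrix_transpose_mul matrix_mul_assoc)
  also have "\<dots> = (transpose ?h ** ?J ** ?h) ** ?K + transpose ?K ** (transpose ?h ** ?J ** ?h)
      - (transpose ?h ** ?J ** ?d + transpose ?d ** ?J ** ?h)"
    unfolding Acon_gauge[OF x]
    by (simp add: matrix_distribs matrix_transpose_mul matrix_mul_assoc transpose_diff)
  also have "\<dots> = 0" unfolding 1 hm_J[OF x] using conn_skew by simp
  finally have "transpose ?h ** (?J ** ?A + transpose ?A ** ?J) ** ?h = 0" .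
  then have "transpose (hi x) ** (transpose ?h ** (?J ** ?A + transpose ?A ** ?J) ** ?h) ** hi x = 0" by simp
  then have "transpose (?h ** hi x) ** (?J ** ?A + transpose ?A ** ?J) ** (?h ** hi x) = 0"
    by (simp only: matrix_transpose_mul matrix_mul_assoc)
  then show ?thesis by (simp add: hi[OF x] transpose_mat)
qed

end

section \<open>The normal conformal connection\<close>

lemma bounded_linear_nth2: "bounded_linear (\<lambda>M :: complex^'n^'m. M $ r $ s)"
  by (rule bounded_linear_compose[OF bounded_linear_vec_nth bounded_linear_vec_nth])

lemma conn_curvature_nth:
  assumes "smooth_form V A" "x \<in> V"
  shows "conn_curvature A x u v $ r $ s = ext_d (\<lambda>y v. A y v $ r $ s) x u v
    + (A x u ** A x v) $ r $ s - (A x v ** A x u) $ r $ s"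
  unfolding conn_curvature_def ext_d_linear[OF bounded_linear_nth2 smooth_formD(3)[OF assms]]
  by simp

definition cmat :: "real^'n^'m \<Rightarrow> complex^'n^'m" where
  "cmat M = (\<chi> i j. of_real (M $ i $ j))"

lemma cmat_mult: "cmat (M ** N) = cmat M ** cmat N"
  by (simp add: cmat_def vec_eq_iff matrix_matrix_mult_def)

lemma cmat_mat_1: "cmat (mat 1) = mat 1"
  by (simp add: cmat_def vec_eq_iff mat_def)

context adapted_frame
begin

lemma etac_cmat: "etac = cmat \<eta>"
  by (simp add: etac_def cmat_def)

text \<open>Nondegeneracy of the constant matrix is inherited from the null Gram matrix through
  \<open>eta_Bm\<close>; a complex left inverse has no nonzero real kernel vectors.\<close>

lemma invertible_eta:
  assumes x: "x \<in> V" shows "invertible \<eta>"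
proof -
  have "(eta0_inv t ** transpose (Bm x) ** etac) ** Bm x = mat 1"
    using eta_Bm[OF x] eta0_inv[OF t] by (simp add: matrix_mul_assoc[symmetric])
  then have "Bm x ** (eta0_inv t ** transpose (Bm x) ** etac) = mat 1"
    by (simp only: matrix_left_right_inverse)
  then have inv: "(Bm x ** eta0_inv t ** transpose (Bm x)) ** etac = mat 1"
    by (simp add: matrix_mul_assoc)
  have "z = 0" if z: "\<eta> *v z = 0" for z
  proof -
    define cz where "cz = ((\<chi> i. of_real (z $ i)) :: complex^4)"
    have "(etac *v cz) $ i = of_real ((\<eta> *v z) $ i)" for i
      by (simp add: cz_def etac_def matrix_vector_mult_def)
    then have "etac *v cz = 0" by (simp add: z vec_eq_iff)
    then have "(Bm x ** eta0_inv t ** transpose (Bm x)) *v (etac *v cz) = 0" by simp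
    then have "cz = 0" by (simp only: matrix_vector_mul_assoc inv matrix_vector_mul_lid)
    then show "z = 0" by (simp add: cz_def vec_eq_iff)
  qed
  then have "\<exists>N. N ** \<eta> = mat 1" using matrix_left_invertible_ker by blast
  then show ?thesis using invertible_left_inverse by blast
qed

lemma matrix_inv_eta:
  assumes x: "x \<in> V"
  shows "(\<Sum>m\<in>UNIV. matrix_inv \<eta> $ i $ m * \<eta> $ m $ j) = (if i = j then 1 else 0)"
    "(\<Sum>m\<in>UNIV. \<eta> $ i $ m * matrix_inv \<eta> $ m $ j) = (if i = j then 1 else 0)"
    "matrix_inv \<eta> $ i $ j = matrix_inv \<eta> $ j $ i" "\<eta> $ i $ j = \<eta> $ j $ i"
proof -
  note inv = matrix_inv_mult[OF invertible_eta[OF x]]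
  show "(\<Sum>m\<in>UNIV. matrix_inv \<eta> $ i $ m * \<eta> $ m $ j) = (if i = j then 1 else 0)"
    using inv(2) by (simp add: vec_eq_iff matrix_matrix_mult_def mat_def)
  show "(\<Sum>m\<in>UNIV. \<eta> $ i $ m * matrix_inv \<eta> $ m $ j) = (if i = j then 1 else 0)"
    using inv(1) by (simp add: vec_eq_iff matrix_matrix_mult_def mat_def)
  have "transpose (matrix_inv \<eta> ** \<eta>) = mat 1" using inv by (simp add: transpose_mat)
  then have 1: "\<eta> ** transpose (matrix_inv \<eta>) = mat 1" by (simp add: matrix_transpose_mul eta_sym)
  have "matrix_inv \<eta> ** (\<eta> ** transpose (matrix_inv \<eta>)) = matrix_inv \<eta>" unfolding 1 by simp
  then have "transpose (matrix_inv \<eta>) = matrix_inv \<eta>" by (simp add: matrix_mul_assoc inv)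
  then have "transpose (matrix_inv \<eta>) $ j $ i = matrix_inv \<eta> $ j $ i" by simp
  then show "matrix_inv \<eta> $ i $ j = matrix_inv \<eta> $ j $ i" by (simp add: transpose_def)
  have "transpose \<eta> $ j $ i = \<eta> $ j $ i" using eta_sym by simp
  then show "\<eta> $ i $ j = \<eta> $ j $ i" by (simp add: transpose_def)
qed

lemma hm_nth:
  "hm x $ Inl () $ Inl () = 1" "hm x $ Inr r $ Inl () = 0"
  "hm x $ Inl () $ Inr (Inl b) = cv x $ b" "hm x $ Inr (Inl i) $ Inr (Inl b) = Bm x $ i $ b"
  "hm x $ Inr (Inr ()) $ Inr (Inl b) = 0"
  by ((cases r; simp add: hm_def Let_def)+)

lemma mult_hm_col0: "((M :: mat6) ** hm x) $ r $ Inl () = M $ r $ Inl ()"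
  by (simp add: mat6_nth_mult hm_nth)

lemma conn_col0:
  "conn T x v $ Inl () $ Inl () = al x v" "conn T x v $ Inr (Inl a) $ Inl () = xi a x v"
  "conn T x v $ Inr (Inr ()) $ Inl () = 0"
  using exhaust_4[of a] by (auto simp: conn_def conn_tab_def conn_entries_def xi_def)

text \<open>This is the purpose of the translation part of \<open>hm\<close>: in the corner,
  \<open>al\<close> meets the pairing of \<open>cv\<close> with the coframe and cancels, and the
  remaining entries become the adapted coframe itself.\<close>

lemma Acon_col0:
  assumes x: "x \<in> V"
  shows "Acon x v $ Inl () $ Inl () = 0" "Acon x v $ Inr (Inl i) $ Inl () = of_real (\<theta> i x v)"
    "Acon x v $ Inr (Inr ()) $ Inl () = 0"
proof -
  \<comment> \<open>The first column of \<open>hm\<close> is constant, so the derivative term of the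
    gauge law does not contribute to the first column.\<close>
  have d0: "frechet_derivative hm (at x) v $ r $ Inl () = 0" for r
  proof -
    have "frechet_derivative hm (at x) v $ r $ Inl () = frechet_derivative (\<lambda>y. hm y $ r $ Inl ()) (at x) v"
      by (rule frechet_derivative_nth2[OF smooth_on_differentiable[OF smooth_hm x]])
    also have "(\<lambda>y. hm y $ r $ Inl ()) = (\<lambda>y. if r = Inl () then 1 else 0)"
      by (cases r) (simp_all add: hm_nth)
    finally show ?thesis by (simp add: frechet_derivative_const)
  qed
  have *: "Acon x v $ r $ Inl () = (hm x ** conn T x v) $ r $ Inl ()" for r
    using Acon_gauge[OF x, of v] mult_hm_col0[of "Acon x v" x r] d0[of r] by simp
  show "Acon x v $ Inl () $ Inl () = 0"
    unfolding * mat6_nth_mult conn_col0 hm_nth by (simp add: al_eq[OF x])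
  show "Acon x v $ Inr (Inl i) $ Inl () = of_real (\<theta> i x v)"
    unfolding * mat6_nth_mult conn_col0 hm_nth by (simp add: theta_eq[OF x])
  show "Acon x v $ Inr (Inr ()) $ Inl () = 0"
    unfolding * mat6_nth_mult conn_col0 hm_nth by simp
qed

lemma Acon_skew_nth:
  assumes x: "x \<in> V"
  shows "Acon x v $ Inr (Inr ()) $ Inr (Inl j) = (\<Sum>i\<in>UNIV. of_real (\<eta> $ i $ j * \<theta> i x v))"
    "Acon x v $ Inr (Inr ()) $ Inr (Inr ()) = 0" "Acon x v $ Inl () $ Inr (Inr ()) = 0"
    "Acon x v $ Inl () $ Inr (Inl j) = (\<Sum>i\<in>UNIV. of_real (\<eta> $ j $ i) * Acon x v $ Inr (Inl i) $ Inr (Inr ()))"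
    "(\<Sum>k\<in>UNIV. of_real (\<eta> $ i $ k) * Acon x v $ Inr (Inl k) $ Inr (Inl j)
      + of_real (\<eta> $ j $ k) * Acon x v $ Inr (Inl k) $ Inr (Inl i)) = 0"
proof -
  have *: "(Jform etac ** Acon x v + transpose (Acon x v) ** Jform etac) $ r $ s = 0" for r s
    using Acon_skew[OF x, of v] by simp
  note S = *[unfolded vector_add_component mat6_nth_mult transpose_def Jform_def]
  show "Acon x v $ Inr (Inr ()) $ Inr (Inl j) = (\<Sum>i\<in>UNIV. of_real (\<eta> $ i $ j * \<theta> i x v))"
    using S[of "Inl ()" "Inr (Inl j)"] by (simp add: Acon_col0[OF x] etac_def mult.commute)
  show "Acon x v $ Inr (Inr ()) $ Inr (Inr ()) = 0"
    using S[of "Inl ()" "Inr (Inr ())"] by (simp add: Acon_col0[OF x])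
  show "Acon x v $ Inl () $ Inr (Inr ()) = 0"
    using S[of "Inr (Inr ())" "Inr (Inr ())"] by simp
  show "Acon x v $ Inl () $ Inr (Inl j) = (\<Sum>i\<in>UNIV. of_real (\<eta> $ j $ i) * Acon x v $ Inr (Inl i) $ Inr (Inr ()))"
    using S[of "Inr (Inl j)" "Inr (Inr ())"] by (simp add: etac_def)
  show "(\<Sum>k\<in>UNIV. of_real (\<eta> $ i $ k) * Acon x v $ Inr (Inl k) $ Inr (Inl j)
      + of_real (\<eta> $ j $ k) * Acon x v $ Inr (Inl k) $ Inr (Inl i)) = 0"
    using S[of "Inr (Inl i)" "Inr (Inl j)"]
    by (simp add: etac_def sum.distrib matrix_inv_eta(4)[OF x, of _ j] mult.commute)
qed

definition Gam :: "4 \<Rightarrow> 4 \<Rightarrow> (n_space, complex) form1" where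
  "Gam i j x v = Acon x v $ Inr (Inl i) $ Inr (Inl j)"

lemma smooth_Gam: "smooth_form V (Gam i j)"
  unfolding Gam_def[abs_def] by (rule smooth_form_linear[OF V bounded_linear_nth2 smooth_Acon])

lemma curv_col0:
  "(curv_plus T x u v + curv_minus T x u v) $ r $ Inl () = 0"
  "(curv_plus T x u v + curv_minus T x u v) $ Inr (Inr ()) $ r = 0"
proof -
  have "\<forall>r. (curv_plus T x u v + curv_minus T x u v) $ r $ Inl () = 0 \<and>
      (curv_plus T x u v + curv_minus T x u v) $ Inr (Inr ()) $ r = 0"
    by (simp add: all_idx6 forall_4 curv_plus_def curv_minus_def curv_tab_def curv_tab'_def
        curv_entries_def curv_entries'_def Let_def)
  then show "(curv_plus T x u v + curv_minus T x u v) $ r $ Inl () = 0"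
    "(curv_plus T x u v + curv_minus T x u v) $ Inr (Inr ()) $ r = 0" by blast+
qed

lemma curvature_Acon_col0: 
  assumes x: "x \<in> V" shows "conn_curvature Acon x u v $ r $ Inl () = 0"
  using curvature_Acon[OF x, of u v] mult_hm_col0[of "conn_curvature Acon x u v" x r]
  by (simp add: mat6_nth_mult curv_col0[simplified])

text \<open>The first column of the curvature vanishes; with \<open>Acon_col0\<close> its middle
  entries are the torsion of the middle block.\<close>

lemma Gam_torsion:
  assumes x: "x \<in> V"
  shows "of_real (ext_d (\<theta> i) x u v) + (\<Sum>j\<in>UNIV. Gam i j x u * of_real (\<theta> j x v) - Gam i j x v * of_real (\<theta> j x u)) = 0"
proof -
  have "ext_d (\<lambda>y v. Acon y v $ Inr (Inl i) $ Inl ()) x u v = ext_d (\<lambda>y v. of_real (\<theta> i y v)) x u v"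
    by (rule ext_d_cong[OF V x Acon_col0(2)])
  also have "\<dots> = of_real (ext_d (\<theta> i) x u v)"
    by (rule ext_d_linear[OF bounded_linear_of_real smooth_formD(3)[OF smooth_theta x]])
  finally show ?thesis
    using curvature_Acon_col0[OF x, of u v "Inr (Inl i)"]
    unfolding conn_curvature_nth[OF smooth_Acon x] mat6_nth_mult Acon_col0[OF x]
    by (simp add: Gam_def sum_subtractf algebra_simps)
qed

lemma Gam_skew:
  assumes x: "x \<in> V"
  shows "(\<Sum>k\<in>UNIV. of_real (\<eta> $ i $ k) * Gam k j x v + of_real (\<eta> $ j $ k) * Gam k i x v) = 0"
  using Acon_skew_nth(5)[OF x] by (simp add: Gam_def)

text \<open>Existence of the Levi-Civita connection of an adapted coframe, needed to exhibit an
  actual Cartan gauge when the Cotton condition is refuted.\<close>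

lemma levi_civita_Re_Gam: "levi_civita V \<eta> \<theta> (\<lambda>i j x v. Re (Gam i j x v))"
  unfolding levi_civita_def
proof (intro conjI allI ballI)
  show "smooth_form V (\<lambda>x v. Re (Gam i j x v))" for i j
    by (rule smooth_form_linear[OF V bounded_linear_Re smooth_Gam])
  fix x assume x: "x \<in> V"
  show "ext_d (\<theta> i) x u v + (\<Sum>j\<in>UNIV. wedge (\<lambda>v. Re (Gam i j x v)) (\<theta> j x) u v) = 0" for i u v
    using arg_cong[OF Gam_torsion[OF x, of i u v], of Re] by (simp add: wedge_def)
  show "(\<Sum>k\<in>UNIV. \<eta> $ i $ k * Re (Gam k j x v) + \<eta> $ j $ k * Re (Gam k i x v)) = 0" for i j v
    using arg_cong[OF Gam_skew[OF x, of i j v], of Re] by simp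
qed

text \<open>Uniqueness of the Levi-Civita connection, for a difference that is a priori complex
  because the null coframe is. It identifies the middle block of \<open>Acon\<close> with any given
  \<Gamma> and shows that it is real.\<close>

lemma Gam_unique:
  assumes \<Gamma>: "levi_civita V \<eta> \<theta> \<Gamma>" and x: "x \<in> V"
  shows "Gam i j x v = of_real (\<Gamma> i j x v)"
proof -
  define \<Delta> where "\<Delta> i j v = Gam i j x v - of_real (\<Gamma> i j x v)" for i j v
  define D where "D i j l = (\<Sum>m\<in>UNIV. of_real (\<eta> $ i $ m) * \<Delta> m j (e l x))" for i j l
  have "of_real (ext_d (\<theta> i) x u v) + (\<Sum>j\<in>UNIV. of_real (\<Gamma> i j x u) * of_real (\<theta> j x v) - of_real (\<Gamma> i j x v) * of_real (\<theta> j x u)) = (0::complex)" for i u v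
    using \<Gamma> x unfolding levi_civita_def wedge_def
    by (simp only: of_real_add[symmetric] of_real_sum[symmetric] of_real_mult[symmetric] of_real_diff[symmetric] of_real_eq_0_iff)
  note A = this
  have eq: "(\<Sum>j\<in>UNIV. Gam i j x u * of_real (\<theta> j x v) - Gam i j x v * of_real (\<theta> j x u))
      = (\<Sum>j\<in>UNIV. of_real (\<Gamma> i j x u) * of_real (\<theta> j x v) - of_real (\<Gamma> i j x v) * of_real (\<theta> j x u))" for i u v
    by (rule add_left_imp_eq[OF trans[OF Gam_torsion[OF x, of i u v] A[symmetric]]])
  have "(\<Sum>j\<in>UNIV. \<Delta> i j u * of_real (\<theta> j x v) - \<Delta> i j v * of_real (\<theta> j x u))
      = (\<Sum>j\<in>UNIV. Gam i j x u * of_real (\<theta> j x v) - Gam i j x v * of_real (\<theta> j x u))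
      - (\<Sum>j\<in>UNIV. of_real (\<Gamma> i j x u) * of_real (\<theta> j x v) - of_real (\<Gamma> i j x v) * of_real (\<theta> j x u))" for i u v
    unfolding sum_subtractf[symmetric] by (rule sum.cong) (simp_all add: \<Delta>_def algebra_simps)
  then have "(\<Sum>j\<in>UNIV. \<Delta> i j u * of_real (\<theta> j x v) - \<Delta> i j v * of_real (\<theta> j x u)) = 0" for i u v
    by (simp only: eq diff_self)
  from this[of _ "e _ x" "e _ x"] have sym: "\<Delta> i j (e l x) = \<Delta> i l (e j x)" for i j l
    by (simp add: dual[OF x] sum_subtractf if_distrib[of complex_of_real] if_distrib[of "\<lambda>y. _ * y"] cong: if_cong)
  have "(\<Sum>k\<in>UNIV. of_real (\<eta> $ i $ k) * of_real (\<Gamma> k j x v) + of_real (\<eta> $ j $ k) * of_real (\<Gamma> k i x v)) = (0::complex)" for i j v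
    using \<Gamma> x unfolding levi_civita_def
    by (simp only: of_real_add[symmetric] of_real_sum[symmetric] of_real_mult[symmetric] of_real_eq_0_iff)
  note skew\<Gamma> = this
  have "D i j l + D j i l = (\<Sum>k\<in>UNIV. of_real (\<eta> $ i $ k) * Gam k j x (e l x) + of_real (\<eta> $ j $ k) * Gam k i x (e l x))
      - (\<Sum>k\<in>UNIV. of_real (\<eta> $ i $ k) * of_real (\<Gamma> k j x (e l x)) + of_real (\<eta> $ j $ k) * of_real (\<Gamma> k i x (e l x)))" for i j l
    unfolding D_def sum_subtractf[symmetric] sum.distrib[symmetric]
    by (rule sum.cong) (simp_all add: \<Delta>_def algebra_simps)
  then have skew: "D i j l + D j i l = 0" for i j l
    by (simp only: skew\<Gamma> Gam_skew[OF x] diff_self)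
  have D_sym: "D i j l = D i l j" for i j l
    unfolding D_def by (simp only: sym[of _ j l])
  \<comment> \<open>A tensor skew in its first two indices and symmetric in its last two
    vanishes.\<close>
  have "D i j l = 0" for i j l
  proof -
    have "D i j l = D i l j" "D l i j = D l j i" "D j l i = D j i l" by (rule D_sym)+
    with skew[of i l j] skew[of l j i] skew[of i j l] show ?thesis
      by algebra
  qed
  have "\<Delta> i j (e l x) = 0" for i j l
  proof -
    have "(\<Sum>m\<in>UNIV. of_real (matrix_inv \<eta> $ i $ m) * D m j l) =
        (\<Sum>m'\<in>UNIV. (\<Sum>m\<in>UNIV. of_real (matrix_inv \<eta> $ i $ m * \<eta> $ m $ m')) * \<Delta> m' j (e l x))"
      unfolding D_def sum_distrib_left sum_distrib_right by (subst sum.swap) (simp add: mult_ac)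
    then show ?thesis
      using \<open>\<And>i j l. D i j l = 0\<close>
      by (simp add: of_real_sum[symmetric] matrix_inv_eta(1)[OF x] if_distrib[of complex_of_real]
          if_distrib[of "\<lambda>y. y * _"] del: of_real_sum of_real_mult cong: if_cong)
  qed
  moreover have "\<Delta> i j v = (\<Sum>l\<in>UNIV. \<theta> l x v *\<^sub>R \<Delta> i j (e l x))"
  proof -
    have "smooth_form V (\<Gamma> i j)" using \<Gamma> by (simp add: levi_civita_def)
    from smooth_formD(1)[OF this x] smooth_formD(1)[OF smooth_Gam x, of i j]
    have l: "linear (\<Delta> i j)"
      unfolding \<Delta>_def by (auto simp: linear_iff algebra_simps scaleR_conv_of_real)
    show ?thesis
      by (subst frame_expand[OF x, of v]) (simp only: linear_sum[OF l] linear_scale[OF l])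
  qed
  ultimately show ?thesis by (simp add: \<Delta>_def)
qed

end

section \<open>The trace normalisation and the Schouten forms\<close>

context adapted_frame
begin

lemma xi_dual:
  assumes x: "x \<in> V" shows "(\<Sum>i\<in>UNIV. Bm x $ i $ a * xi c x (e i x)) = (if c = a then 1 else 0)"
proof -
  have "(Em x ** Bm x) $ c $ a = (if c = a then 1 else 0)" by (simp add: Bm_Em[OF x] mat_def)
  then show ?thesis by (simp add: matrix_matrix_mult_def Em_def mult.commute)
qed

lemma contract_wedge:
  assumes x: "x \<in> V"
  shows "(\<Sum>i\<in>UNIV. Bm x $ i $ a * wedge (xi c x) (xi d x) (e i x) v)
    = (if c = a then xi d x v else 0) - (if d = a then xi c x v else 0)"
proof -
  have "(\<Sum>i\<in>UNIV. Bm x $ i $ a * wedge (xi c x) (xi d x) (e i x) v)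
      = (\<Sum>i\<in>UNIV. Bm x $ i $ a * xi c x (e i x)) * xi d x v - (\<Sum>i\<in>UNIV. Bm x $ i $ a * xi d x (e i x)) * xi c x v"
    unfolding sum_distrib_right sum_subtractf[symmetric]
    by (rule sum.cong) (simp_all add: wedge_def algebra_simps)
  then show ?thesis by (simp add: xi_dual[OF x])
qed

text \<open>The normality condition. The sum over i turns \<open>Bm\<close> and the frame
  \<open>e\<close> into the complex frame dual to the null coframe, so this is the Ricci-type
  contraction of the middle block, evaluated by contracting the four 2-forms \<open>sd1\<close>,
  \<open>sd2\<close>, \<open>asd1\<close>, \<open>asd2\<close>.\<close>

lemma weyl_trace:
  assumes x: "x \<in> V"
  shows "(\<Sum>i\<in>UNIV. \<Sum>a\<in>UNIV. Bm x $ i $ a *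
    (curv_plus T x (e i x) v + curv_minus T x (e i x) v) $ Inr (Inl a) $ Inr (Inl b)) = 0"
proof -
  obtain k1 k2 where bet: "\<And>v. bet x v = k1 * w1 x v + k2 * wc x v"
    "\<And>v. betb x v = cnj k1 * wb x v + cnj k2 * wc x v" using bet_span[OF x] by blast
  define n1 where "n1 = curv_tab T (0, k1, k2, k x)"
  define n2 where "n2 = curv_tab T (k x, 0, 0, 0)"
  define n3 where "n3 = curv_tab' T (0, cnj k1, cnj k2, kb x)"
  define n4 where "n4 = curv_tab' T (kb x, 0, 0, 0)"
  let ?X = "\<lambda>c d a. (\<Sum>i\<in>UNIV. Bm x $ i $ a * wedge (xi c x) (xi d x) (e i x) v)"
  have "(\<Sum>i\<in>UNIV. \<Sum>a\<in>UNIV. Bm x $ i $ a *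
      (curv_plus T x (e i x) v + curv_minus T x (e i x) v) $ Inr (Inl a) $ Inr (Inl b))
    = (\<Sum>a\<in>UNIV. ?X 1 3 a * n1 $ Inr (Inl a) $ Inr (Inl b) + (?X 1 2 a + 2 * T * ?X 3 4 a) * n2 $ Inr (Inl a) $ Inr (Inl b)
        + ?X 2 3 a * n3 $ Inr (Inl a) $ Inr (Inl b) + (- ?X 1 2 a + 2 * T * ?X 3 4 a) * n4 $ Inr (Inl a) $ Inr (Inl b))"
    unfolding curv_plus_split[OF bet(1)] curv_minus_split[OF bet(2)] n1_def[symmetric] n2_def[symmetric]
      n3_def[symmetric] n4_def[symmetric]
    by (subst sum.swap, rule sum.cong)
      (simp_all add: sd2_def asd2_def xi_def sum_distrib_left sum_distrib_right sum_negf[symmetric] sum.distrib[symmetric] algebra_simps)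
  also have "\<dots> = 0"
    unfolding contract_wedge[OF x]
    using exhaust_4[of b] T
    by (auto simp: sum_4 n1_def n2_def n3_def n4_def curv_tab_def curv_tab'_def curv_entries_def curv_entries'_def
        Let_def xi_def field_simps)
  finally show ?thesis .
qed

text \<open>Since the first column and the last row of the curvature vanish, the triangular matrix
  \<open>hm\<close> acts on the middle block only through \<open>Bm\<close>; the trace is therefore
  carried over to the adapted frame.\<close>

lemma curvature_Acon_trace:
  assumes x: "x \<in> V"
  shows "(\<Sum>i\<in>UNIV. conn_curvature Acon x (e i x) v $ Inr (Inl i) $ Inr (Inl j)) = 0"
proof -
  let ?F = "\<lambda>u. conn_curvature Acon x u v" and ?G = "\<lambda>u. curv_plus T x u v + curv_minus T x u v"
  have "(?F u ** hm x) $ Inr (Inl i) $ Inr (Inl b) = (hm x ** ?G u) $ Inr (Inl i) $ Inr (Inl b)" for u i b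
    by (simp only: curvature_Acon[OF x])
  then have 1: "(\<Sum>j\<in>UNIV. ?F u $ Inr (Inl i) $ Inr (Inl j) * Bm x $ j $ b)
      = (\<Sum>a\<in>UNIV. Bm x $ i $ a * ?G u $ Inr (Inl a) $ Inr (Inl b))" for u i b
    unfolding mat6_nth_mult hm_nth curvature_Acon_col0[OF x] curv_col0 by simp
  define y where "y j = (\<Sum>i\<in>UNIV. ?F (e i x) $ Inr (Inl i) $ Inr (Inl j))" for j
  have yB: "(\<Sum>j\<in>UNIV. y j * Bm x $ j $ b) = 0" for b
    unfolding y_def sum_distrib_right
    by (subst sum.swap) (simp only: 1 weyl_trace[OF x])
  have "y j = (\<Sum>j'\<in>UNIV. y j' * (Bm x ** Em x) $ j' $ j)"
    by (simp add: Bm_Em[OF x] mat_def if_distrib[of "\<lambda>z. _ * z"] cong: if_cong)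
  also have "\<dots> = (\<Sum>b\<in>UNIV. (\<Sum>j'\<in>UNIV. y j' * Bm x $ j' $ b) * Em x $ b $ j)"
    unfolding matrix_matrix_mult_def
    by (simp add: sum_distrib_left sum_distrib_right, subst sum.swap) (simp add: mult_ac)
  finally have "y j = 0" by (simp only: yB mult_zero_left sum.neutral_const)
  then show ?thesis by (simp add: y_def)
qed

context
  fixes \<Gamma> :: "4 \<Rightarrow> 4 \<Rightarrow> (n_space, real) form1"
  assumes \<Gamma>: "levi_civita V \<eta> \<theta> \<Gamma>"
begin

text \<open>The vanishing trace is a linear equation for the top row \<open>S\<close>. Its unique
  solution in terms of the Ricci tensor is the Schouten tensor with the given normalisation.\<close>

lemma Acon_schouten:
  assumes x: "x \<in> V"
  shows "Acon x v $ Inl () $ Inr (Inl j) = of_real (schouten \<eta> \<theta> e \<Gamma> j x v)"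
    and "Acon x v $ Inr (Inl i) $ Inr (Inr ()) = (\<Sum>j\<in>UNIV. of_real (matrix_inv \<eta> $ i $ j) * Acon x v $ Inl () $ Inr (Inl j))"
proof -
  define S where "S j v = Acon x v $ Inl () $ Inr (Inl j)" for j v
  define R where "R i v = Acon x v $ Inr (Inl i) $ Inr (Inr ())" for i v
  have SR: "S j v = (\<Sum>i\<in>UNIV. of_real (\<eta> $ j $ i) * R i v)" for j v
    unfolding S_def R_def by (rule Acon_skew_nth(4)[OF x])
  have SR': "(\<Sum>i\<in>UNIV. R i v * of_real (\<eta> $ i $ j)) = S j v" for j v
    unfolding SR by (rule sum.cong) (simp_all add: mult.commute matrix_inv_eta(4)[OF x, of j])
  have RS: "R i v = (\<Sum>j\<in>UNIV. of_real (matrix_inv \<eta> $ i $ j) * S j v)" for i v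
  proof -
    have "(\<Sum>j\<in>UNIV. of_real (matrix_inv \<eta> $ i $ j) * S j v)
        = (\<Sum>m\<in>UNIV. of_real (\<Sum>j\<in>UNIV. matrix_inv \<eta> $ i $ j * \<eta> $ j $ m) * R m v)"
      unfolding SR of_real_sum sum_distrib_left sum_distrib_right by (subst sum.swap) (simp add: mult_ac)
    then show ?thesis
      by (simp add: matrix_inv_eta(1)[OF x] if_distrib[of complex_of_real] if_distrib[of "\<lambda>z. z * _"]
          del: of_real_sum cong: if_cong)
  qed
  show "Acon x v $ Inr (Inl i) $ Inr (Inr ()) = (\<Sum>j\<in>UNIV. of_real (matrix_inv \<eta> $ i $ j) * Acon x v $ Inl () $ Inr (Inl j))"
    using RS by (simp add: R_def S_def)
  have th: "(\<Sum>m\<in>UNIV. of_real (\<eta> $ m $ j * \<theta> m x (e l x))) = (of_real (\<eta> $ l $ j) :: complex)" for j l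
    by (simp add: dual[OF x] if_distrib[of "\<lambda>z. _ * z"] if_distrib[of complex_of_real] cong: if_cong)
  have mid: "conn_curvature Acon x u v $ Inr (Inl i) $ Inr (Inl j) = of_real (curv_form \<Gamma> i j x u v)
      + (of_real (\<theta> i x u) * S j v - of_real (\<theta> i x v) * S j u)
      + (R i u * (\<Sum>m\<in>UNIV. of_real (\<eta> $ m $ j * \<theta> m x v)) - R i v * (\<Sum>m\<in>UNIV. of_real (\<eta> $ m $ j * \<theta> m x u)))" for i j u v
  proof -
    have "ext_d (\<lambda>y v. Acon y v $ Inr (Inl i) $ Inr (Inl j)) x u v = ext_d (\<lambda>y v. of_real (\<Gamma> i j y v)) x u v"
      by (rule ext_d_cong[OF V x]) (use Gam_unique[OF \<Gamma>] Gam_def in metis)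
    also have "\<dots> = of_real (ext_d (\<Gamma> i j) x u v)"
      by (rule ext_d_linear[OF bounded_linear_of_real smooth_formD(3)[OF _ x]]) (use \<Gamma> in \<open>simp add: levi_civita_def\<close>)
    finally show ?thesis
      unfolding conn_curvature_nth[OF smooth_Acon x] mat6_nth_mult Acon_col0[OF x] Acon_skew_nth(1)[OF x]
        Gam_def[symmetric] Gam_unique[OF \<Gamma> x] S_def[symmetric] R_def[symmetric]
      by (simp add: curv_form_def wedge_def sum_subtractf)
  qed
  define tr where "tr = (\<Sum>i\<in>UNIV. R i (e i x))"
  \<comment> \<open>In dimension four the term \<theta> \<and> S contributes 4 - 1 = 3 copies of
    \<open>S\<close>, and the other mixed term contributes the trace times \<eta> minus one more
    copy.\<close>
  have ric: "of_real (ricci e \<Gamma> j l x) = - (2 * S j (e l x) + tr * of_real (\<eta> $ l $ j))" for j l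
  proof -
    have "0 = (\<Sum>i\<in>UNIV. conn_curvature Acon x (e i x) (e l x) $ Inr (Inl i) $ Inr (Inl j))"
      by (simp only: curvature_Acon_trace[OF x])
    also have "\<dots> = of_real (ricci e \<Gamma> j l x) + (\<Sum>i\<in>UNIV. S j (e l x) - (if i = l then S j (e i x) else 0))
        + (\<Sum>i\<in>UNIV. R i (e i x) * of_real (\<eta> $ l $ j) - R i (e l x) * of_real (\<eta> $ i $ j))"
      unfolding mid th ricci_def of_real_sum sum.distrib[symmetric]
      by (rule sum.cong) (simp_all add: dual[OF x])
    also have "(\<Sum>i\<in>UNIV. S j (e l x) - (if i = l then S j (e i x) else 0)) = 3 * S j (e l x)"
      by (simp add: sum_subtractf)
    also have "(\<Sum>i\<in>UNIV. R i (e i x) * of_real (\<eta> $ l $ j) - R i (e l x) * of_real (\<eta> $ i $ j))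
        = tr * of_real (\<eta> $ l $ j) - S j (e l x)"
      unfolding sum_subtractf SR' tr_def sum_distrib_right ..
    finally show ?thesis by (simp add: algebra_simps eq_neg_iff_add_eq_0)
  qed
  have "of_real (scalar_curv \<eta> e \<Gamma> x) = (\<Sum>j\<in>UNIV. \<Sum>l\<in>UNIV. of_real (matrix_inv \<eta> $ j $ l) * - (2 * S j (e l x) + tr * of_real (\<eta> $ l $ j)))"
    by (simp add: scalar_curv_def ric)
  also have "\<dots> = - 2 * (\<Sum>j\<in>UNIV. \<Sum>l\<in>UNIV. of_real (matrix_inv \<eta> $ j $ l) * S j (e l x))
      - tr * (\<Sum>j\<in>UNIV. of_real (\<Sum>l\<in>UNIV. matrix_inv \<eta> $ j $ l * \<eta> $ l $ j))"
    unfolding of_real_sum sum_distrib_left sum_subtractf[symmetric]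
    by (intro sum.cong refl) (simp add: algebra_simps)
  also have "(\<Sum>j\<in>UNIV. \<Sum>l\<in>UNIV. of_real (matrix_inv \<eta> $ j $ l) * S j (e l x))
      = (\<Sum>l\<in>UNIV. \<Sum>j\<in>UNIV. of_real (matrix_inv \<eta> $ l $ j) * S j (e l x))"
    by (subst sum.swap, intro sum.cong refl) (metis matrix_inv_eta(3)[OF x])
  also have "(\<Sum>l\<in>UNIV. \<Sum>j\<in>UNIV. of_real (matrix_inv \<eta> $ l $ j) * S j (e l x)) = tr"
    by (simp only: RS[symmetric] tr_def)
  also have "(\<Sum>j\<in>UNIV. of_real (\<Sum>l\<in>UNIV. matrix_inv \<eta> $ j $ l * \<eta> $ l $ j)) = (4 :: complex)"
    by (simp add: matrix_inv_eta(1)[OF x] sum_4 del: of_real_sum)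
  also have "- 2 * tr - tr * 4 = - 6 * tr" by (simp add: algebra_simps)
  \<comment> \<open>Twice the trace from \<open>S\<close> and four times from the trace of the
    identity. Substitution into R/12 \<eta> - Ric/2 then cancels the trace and leaves
    \<open>S\<close>.\<close>
  finally have scal: "of_real (scalar_curv \<eta> e \<Gamma> x) = - 6 * tr" .
  have "of_real (schouten \<eta> \<theta> e \<Gamma> j x v) = (\<Sum>l\<in>UNIV. S j (e l x) * of_real (\<theta> l x v))"
    unfolding schouten_def of_real_sum
    by (rule sum.cong) (simp_all add: scal ric matrix_inv_eta(4)[OF x, of j] field_simps)
  also have "\<dots> = S j v"
  proof -
    have l: "linear (S j)"
      unfolding S_def using bounded_linear.linear[OF bounded_linear_nth2]
        linear_compose[OF smooth_formD(1)[OF smooth_Acon x]] by (fastforce simp: o_def)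
    show ?thesis
      by (subst (2) frame_expand[OF x, of v])
        (simp add: linear_sum[OF l] linear_scale[OF l] scaleR_conv_of_real mult.commute)
  qed
  finally show "Acon x v $ Inl () $ Inr (Inl j) = of_real (schouten \<eta> \<theta> e \<Gamma> j x v)"
    by (simp add: S_def)
qed

lemma normal_connection_eq:
  assumes x: "x \<in> V" shows "normal_connection \<eta> \<theta> e \<Gamma> x v = Acon x v"
  unfolding mat6_eq_iff all_idx6
  by (simp add: normal_connection_def Acon_col0[OF x] Acon_skew_nth(1,2,3)[OF x] Acon_schouten[OF x]
      Gam_def[symmetric] Gam_unique[OF \<Gamma> x])

end

end

section \<open>The Hodge star\<close>

lemma det_4:
  "det (A::'a::comm_ring_1^4^4) = A$1$1 * A$2$2 * A$3$3 * A$4$4 - A$1$1 * A$2$2 * A$3$4 * A$4$3 - A$1$1 * A$2$3 * A$3$2 * A$4$4 + A$1$1 * A$2$3 * A$3$4 * A$4$2 + A$1$1 * A$2$4 * A$3$2 * A$4$3 - A$1$1 * A$2$4 * A$3$3 * A$4$2 - A$1$2 * A$2$1 * A$3$3 * A$4$4 + A$1$2 * A$2$1 * A$3$4 * A$4$3 + A$1$2 * A$2$3 * A$3$1 * A$4$4 - A$1$2 * A$2$3 * A$3$4 * A$4$1 - A$1$2 * A$2$4 * A$3$1 * A$4$3 + A$1$2 * A$2$4 * A$3$3 * A$4$1 + A$1$3 * A$2$1 * A$3$2 * A$4$4 - A$1$3 * A$2$1 * A$3$4 * A$4$2 - A$1$3 * A$2$2 * A$3$1 * A$4$4 + A$1$3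 * A$2$2 * A$3$4 * A$4$1 + A$1$3 * A$2$4 * A$3$1 * A$4$2 - A$1$3 * A$2$4 * A$3$2 * A$4$1 - A$1$4 * A$2$1 * A$3$2 * A$4$3 + A$1$4 * A$2$1 * A$3$3 * A$4$2 + A$1$4 * A$2$2 * A$3$1 * A$4$3 - A$1$4 * A$2$2 * A$3$3 * A$4$1 - A$1$4 * A$2$3 * A$3$1 * A$4$2 + A$1$4 * A$2$3 * A$3$2 * A$4$1"
proof -
  have f1: "finite {2::4, 3, 4}" "1 \<notin> {2::4, 3, 4}" by auto
  have f2: "finite {3::4, 4}" "2 \<notin> {3::4, 4}" by auto
  have f3: "finite {4::4}" "3 \<notin> {4::4}" by auto
  show ?thesis
    unfolding det_def UNIV_4
    unfolding sum_over_permutations_insert[OF f1]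
    unfolding sum_over_permutations_insert[OF f2]
    unfolding sum_over_permutations_insert[OF f3]
    unfolding permutes_sing
    by (simp add: sign_swap_id permutation_swap_id permutation_compose sign_compose sign_id swap_id_eq algebra_simps)
qed

text \<open>The complex multilinear extension of \<open>eps4\<close>, with the same placement of
  rows, so that the Levi-Civita symbol can be evaluated on complex null vectors.\<close>

definition det_rows :: "complex^4 \<Rightarrow> complex^4 \<Rightarrow> complex^4 \<Rightarrow> complex^4 \<Rightarrow> complex" where
  "det_rows p q r s = det (\<chi> a. if a = 0 then p else if a = 1 then q else if a = 2 then r else s)"

lemma det_rows_add:
  "det_rows (p + p') q r s = det_rows p q r s + det_rows p' q r s"
  "det_rows p (q + q') r s = det_rows p q r s + det_rows p q' r s"
  "det_rows p q (r + r') s = det_rows p q r s + det_rows p q r' s"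
  "det_rows p q r (s + s') = det_rows p q r s + det_rows p q r s'"
  "det_rows (c *s p) q r s = c * det_rows p q r s"
  "det_rows p (c *s q) r s = c * det_rows p q r s"
  "det_rows p q (c *s r) s = c * det_rows p q r s"
  "det_rows p q r (c *s s) = c * det_rows p q r s"
  by (simp_all add: det_rows_def det_4 algebra_simps)

lemma eps4_det_rows: "complex_of_real (eps4 i j k l) = det_rows (axis i 1) (axis j 1) (axis k 1) (axis l 1)"
proof -
  have "complex_of_real (axis a (1::real) $ b) = axis a 1 $ b" for a b :: 4 by (simp add: axis_def)
  then show ?thesis by (simp add: eps4_def det_rows_def det_4)
qed

lemma vec4_expand: "(p :: complex^4) = (p $ 1) *s axis 1 1 + (p $ 2) *s axis 2 1 + (p $ 3) *s axis 3 1 + (p $ 4) *s (axis 4 (1::complex))"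
  by (simp add: vec_eq_iff forall_4 axis_def)

lemma sum_eps4:
  "(\<Sum>i\<in>UNIV. \<Sum>j\<in>UNIV. \<Sum>k\<in>UNIV. \<Sum>l\<in>UNIV. of_real (eps4 i j k l) * p $ i * q $ j * r $ k * s $ l) = det_rows p q r s"
proof -
  let ?a = "\<lambda>i. axis i (1::complex) :: complex^4"
  have 4: "det_rows p q r s = (\<Sum>l\<in>UNIV. s $ l * det_rows p q r (?a l))" for p q r s
    by (subst vec4_expand[of s]) (simp only: det_rows_add sum_4)
  have 3: "det_rows p q r s = (\<Sum>k\<in>UNIV. r $ k * det_rows p q (?a k) s)" for p q r s
    by (subst vec4_expand[of r]) (simp only: det_rows_add sum_4)
  have 2: "det_rows p q r s = (\<Sum>j\<in>UNIV. q $ j * det_rows p (?a j) r s)" for p q r s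
    by (subst vec4_expand[of q]) (simp only: det_rows_add sum_4)
  have 1: "det_rows p q r s = (\<Sum>i\<in>UNIV. p $ i * det_rows (?a i) q r s)" for p q r s
    by (subst vec4_expand[of p]) (simp only: det_rows_add sum_4)
  have "det_rows p q r s = (\<Sum>i\<in>UNIV. p $ i * (\<Sum>j\<in>UNIV. q $ j * (\<Sum>k\<in>UNIV. r $ k * (\<Sum>l\<in>UNIV. s $ l * det_rows (?a i) (?a j) (?a k) (?a l)))))"
    by (subst 1, subst 2, subst 3, subst 4) (rule refl)
  then show ?thesis
    unfolding eps4_det_rows sum_distrib_left by (simp add: mult_ac)
qed

lemma det_rows_matrix: "det_rows (B *v p) (B *v q) (B *v r) (B *v s) = det B * det_rows p q r s"
proof -
  let ?M = "(\<chi> a. if a = 0 then p else if a = 1 then q else if a = 2 then r else s) :: complex^4^4"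
  have "(\<chi> a. if a = 0 then B *v p else if a = 1 then B *v q else if a = 2 then B *v r else B *v s) = ?M ** transpose B"
    unfolding vec_eq_iff matrix_matrix_mult_def matrix_vector_mult_def transpose_def
    by (simp add: mult.commute)
  then have "det_rows (B *v p) (B *v q) (B *v r) (B *v s) = det (?M ** transpose B)"
    by (simp only: det_rows_def)
  also have "\<dots> = det ?M * det B" by (simp only: det_mul det_transpose)
  finally show ?thesis by (simp add: det_rows_def)
qed

lemma det_rows_axis:
  "det_rows (axis 2 1) (axis 4 1) r s = r $ 1 * s $ 3 - r $ 3 * s $ 1"
  "det_rows (axis 4 1) (axis 2 1) r s = - (r $ 1 * s $ 3 - r $ 3 * s $ 1)"
  "det_rows (axis 1 1) (axis 4 1) r s = - (r $ 2 * s $ 3 - r $ 3 * s $ 2)"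
  "det_rows (axis 4 1) (axis 1 1) r s = r $ 2 * s $ 3 - r $ 3 * s $ 2"
  "det_rows (axis 2 1) (axis 1 1) r s = r $ 3 * s $ 4 - r $ 4 * s $ 3"
  "det_rows (axis 1 1) (axis 2 1) r s = - (r $ 3 * s $ 4 - r $ 4 * s $ 3)"
  "det_rows (axis 4 1) (axis 3 1) r s = r $ 1 * s $ 2 - r $ 2 * s $ 1"
  "det_rows (axis 3 1) (axis 4 1) r s = - (r $ 1 * s $ 2 - r $ 2 * s $ 1)"
  by (simp_all add: det_rows_def det_4 axis_def)

lemma sum_swap4:
  fixes f :: "'i \<Rightarrow> 'j \<Rightarrow> 'k \<Rightarrow> 'l \<Rightarrow> complex"
  shows "(\<Sum>k\<in>A. \<Sum>l\<in>B. \<Sum>i\<in>C. \<Sum>j\<in>D. f i j k l) = (\<Sum>i\<in>C. \<Sum>j\<in>D. \<Sum>k\<in>A. \<Sum>l\<in>B. f i j k l)"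
proof -
  have "(\<Sum>l\<in>B. \<Sum>i\<in>C. \<Sum>j\<in>D. f i j k l) = (\<Sum>i\<in>C. \<Sum>j\<in>D. \<Sum>l\<in>B. f i j k l)" for k
    by (subst sum.swap, rule sum.cong[OF refl], rule sum.swap)
  then have "(\<Sum>k\<in>A. \<Sum>l\<in>B. \<Sum>i\<in>C. \<Sum>j\<in>D. f i j k l) = (\<Sum>k\<in>A. \<Sum>i\<in>C. \<Sum>j\<in>D. \<Sum>l\<in>B. f i j k l)"
    by (simp only:)
  also have "\<dots> = (\<Sum>i\<in>C. \<Sum>j\<in>D. \<Sum>k\<in>A. \<Sum>l\<in>B. f i j k l)"
    by (subst sum.swap, rule sum.cong[OF refl], rule sum.swap)
  finally show ?thesis .
qed

text \<open>The star of a scalar complex 2-form at one point. The star of a matrix-valued form is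
  this operation on each entry.\<close>

definition hodge_scalar ::
  "real^4^4 \<Rightarrow> (4 \<Rightarrow> (n_space, real) form1) \<Rightarrow> (4 \<Rightarrow> n_space \<Rightarrow> n_space) \<Rightarrow> n_space \<Rightarrow>
   (n_space \<Rightarrow> n_space \<Rightarrow> complex) \<Rightarrow> n_space \<Rightarrow> n_space \<Rightarrow> complex" where
  "hodge_scalar \<eta> \<theta> e x \<beta> u v = (\<Sum>k\<in>UNIV. \<Sum>l\<in>UNIV. of_real (\<theta> k x u * \<theta> l x v) *
     (\<Sum>i\<in>UNIV. \<Sum>j\<in>UNIV. \<Sum>m\<in>UNIV. \<Sum>n\<in>UNIV.
        of_real (sqrt \<bar>det \<eta>\<bar> / 2 * eps4 i j k l * matrix_inv \<eta> $ i $ m * matrix_inv \<eta> $ j $ n) * \<beta> (e m x) (e n x)))"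

lemma hodge_nth: "hodge \<eta> \<theta> e B x u v $ r $ s = hodge_scalar \<eta> \<theta> e x (\<lambda>u v. B x u v $ r $ s) u v"
  unfolding hodge_def hodge_scalar_def
  by (simp only: sum_component vector_scaleR_component) (simp only: scaleR_conv_of_real)

lemma hodge_scalar_linear:
  "hodge_scalar \<eta> \<theta> e x (\<lambda>u v. a * \<alpha> u v + b * \<beta> u v) u v
    = a * hodge_scalar \<eta> \<theta> e x \<alpha> u v + b * hodge_scalar \<eta> \<theta> e x \<beta> u v"
  unfolding hodge_scalar_def sum_distrib_left sum.distrib[symmetric]
  by (intro sum.cong refl) (simp add: algebra_simps)

context adapted_frame
begin

text \<open>Raising an index in the adapted coframe is raising it in the null coframe followed by
  \<open>Bm\<close>; this moves the Hodge star to the null coframe.\<close>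

lemma matrix_inv_etac:
  assumes x: "x \<in> V"
  shows "(\<Sum>m\<in>UNIV. of_real (matrix_inv \<eta> $ i $ m) * xi a x (e m x)) = (Bm x *v column a (eta0_inv t)) $ i"
proof -
  have inv: "(Bm x ** eta0_inv t ** transpose (Bm x)) ** etac = mat 1"
  proof -
    have "(eta0_inv t ** transpose (Bm x) ** etac) ** Bm x = mat 1"
      using eta_Bm[OF x] eta0_inv[OF t] by (simp add: matrix_mul_assoc[symmetric])
    then have "Bm x ** (eta0_inv t ** transpose (Bm x) ** etac) = mat 1"
      by (simp only: matrix_left_right_inverse)
    then show ?thesis by (simp add: matrix_mul_assoc)
  qed
  have "etac ** cmat (matrix_inv \<eta>) = mat 1"
    unfolding etac_cmat cmat_mult[symmetric] matrix_inv_mult[OF invertible_eta[OF x]] by (rule cmat_mat_1)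
  then have "(Bm x ** eta0_inv t ** transpose (Bm x)) ** (etac ** cmat (matrix_inv \<eta>)) = Bm x ** eta0_inv t ** transpose (Bm x)"
    by (simp only: matrix_mul_rid)
  then have 1: "cmat (matrix_inv \<eta>) = Bm x ** eta0_inv t ** transpose (Bm x)"
    by (simp only: matrix_mul_assoc inv matrix_mul_lid)
  have "cmat (matrix_inv \<eta>) ** transpose (Em x) = Bm x ** eta0_inv t ** transpose (Em x ** Bm x)"
    by (simp add: 1 matrix_transpose_mul matrix_mul_assoc)
  also have "\<dots> = Bm x ** eta0_inv t" by (simp add: Bm_Em[OF x] transpose_mat)
  finally have "(cmat (matrix_inv \<eta>) ** transpose (Em x)) $ i $ a = (Bm x ** eta0_inv t) $ i $ a" by simp
  then show ?thesis
    by (simp add: matrix_matrix_mult_def matrix_vector_mult_def cmat_def transpose_def Em_def column_def)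
qed

definition xiv :: "n_space \<Rightarrow> n_space \<Rightarrow> complex^4" where
  "xiv x v = (\<chi> a. xi a x v)"

text \<open>All four arguments of the Levi-Civita symbol are images under \<open>Bm\<close>, so its
  determinant factors out and a constant determinant in null components remains.\<close>

lemma hodge_wedge_xi:
  assumes x: "x \<in> V"
  shows "hodge_scalar \<eta> \<theta> e x (wedge (xi a x) (xi b x)) u v = of_real (sqrt \<bar>det \<eta>\<bar>) * det (Bm x) *
    (det_rows (column a (eta0_inv t)) (column b (eta0_inv t)) (xiv x u) (xiv x v)
     - det_rows (column b (eta0_inv t)) (column a (eta0_inv t)) (xiv x u) (xiv x v)) / 2"
proof -
  let ?P = "\<lambda>a. Bm x *v column a (eta0_inv t)" and ?U = "Bm x *v xiv x u" and ?V = "Bm x *v xiv x v"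
  define c where "c = complex_of_real (sqrt \<bar>det \<eta>\<bar>) / 2"
  have th: "of_real (\<theta> k x z) = (Bm x *v xiv x z) $ k" for k z
    by (simp add: theta_eq[OF x] matrix_vector_mult_def xiv_def)
  have inner: "(\<Sum>m\<in>UNIV. \<Sum>n\<in>UNIV. of_real (sqrt \<bar>det \<eta>\<bar> / 2 * eps4 i j k l * matrix_inv \<eta> $ i $ m * matrix_inv \<eta> $ j $ n)
        * wedge (xi a x) (xi b x) (e m x) (e n x))
      = c * of_real (eps4 i j k l) * (?P a $ i * ?P b $ j - ?P b $ i * ?P a $ j)" for i j k l
  proof -
    have "(\<Sum>m\<in>UNIV. \<Sum>n\<in>UNIV. of_real (sqrt \<bar>det \<eta>\<bar> / 2 * eps4 i j k l * matrix_inv \<eta> $ i $ m * matrix_inv \<eta> $ j $ n)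
        * wedge (xi a x) (xi b x) (e m x) (e n x))
      = c * of_real (eps4 i j k l) * ((\<Sum>m\<in>UNIV. \<Sum>n\<in>UNIV. (of_real (matrix_inv \<eta> $ i $ m) * xi a x (e m x)) * (of_real (matrix_inv \<eta> $ j $ n) * xi b x (e n x)))
          - (\<Sum>m\<in>UNIV. \<Sum>n\<in>UNIV. (of_real (matrix_inv \<eta> $ i $ m) * xi b x (e m x)) * (of_real (matrix_inv \<eta> $ j $ n) * xi a x (e n x))))"
      unfolding sum_distrib_left sum_subtractf[symmetric]
      by (intro sum.cong refl) (simp add: c_def wedge_def algebra_simps)
    then show ?thesis unfolding sum_product[symmetric] matrix_inv_etac[OF x] .
  qed
  have "hodge_scalar \<eta> \<theta> e x (wedge (xi a x) (xi b x)) u v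
      = (\<Sum>k\<in>UNIV. \<Sum>l\<in>UNIV. \<Sum>i\<in>UNIV. \<Sum>j\<in>UNIV. c * (of_real (eps4 i j k l) * ?P a $ i * ?P b $ j * ?U $ k * ?V $ l)
        - c * (of_real (eps4 i j k l) * ?P b $ i * ?P a $ j * ?U $ k * ?V $ l))"
    unfolding hodge_scalar_def inner sum_distrib_left
    by (intro sum.cong refl) (simp add: th algebra_simps)
  also have "\<dots> = (\<Sum>i\<in>UNIV. \<Sum>j\<in>UNIV. \<Sum>k\<in>UNIV. \<Sum>l\<in>UNIV. c * (of_real (eps4 i j k l) * ?P a $ i * ?P b $ j * ?U $ k * ?V $ l)
        - c * (of_real (eps4 i j k l) * ?P b $ i * ?P a $ j * ?U $ k * ?V $ l))"
    by (rule sum_swap4)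
  also have "\<dots> = c * (det_rows (?P a) (?P b) ?U ?V - det_rows (?P b) (?P a) ?U ?V)"
    unfolding sum_eps4[symmetric] right_diff_distrib sum_distrib_left sum_subtractf[symmetric] ..
  finally show ?thesis unfolding det_rows_matrix c_def by (simp add: algebra_simps)
qed

text \<open>The eigenvalue of the star on \<open>sd1\<close> and \<open>sd2\<close>. It is i or -i
  according to the orientation of the adapted coframe, but is kept in this form because it depends
  on the point a priori.\<close>

definition lam :: "n_space \<Rightarrow> complex" where
  "lam x = of_real (sqrt \<bar>det \<eta>\<bar>) * det (Bm x) / (2 * T)"

lemma hodge_sd:
  assumes x: "x \<in> V"
  shows "hodge_scalar \<eta> \<theta> e x (sd1 x) u v = lam x * sd1 x u v"
    "hodge_scalar \<eta> \<theta> e x (sd2 T x) u v = lam x * sd2 T x u v"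
    "hodge_scalar \<eta> \<theta> e x (asd1 x) u v = - lam x * asd1 x u v"
    "hodge_scalar \<eta> \<theta> e x (asd2 T x) u v = - lam x * asd2 T x u v"
proof -
  \<comment> \<open>Raising an index exchanges 1 with 2 and 3 with 4, as the coframe is
    null.\<close>
  have c: "column 1 (eta0_inv t) = axis 2 1" "column 2 (eta0_inv t) = axis 1 1"
    "column 3 (eta0_inv t) = (1 / (2 * T)) *s axis (4::4) 1" "column 4 (eta0_inv t) = (1 / (2 * T)) *s axis 3 1"
    by (simp_all add: column_def eta0_inv_def vec_eq_iff forall_4 axis_def T_def)
  have w: "wedge (xi a x) (xi b x) u v = xiv x u $ a * xiv x v $ b - xiv x v $ a * xiv x u $ b" for a b u v
    by (simp add: wedge_def xiv_def)
  have f: "sd1 x = wedge (xi 1 x) (xi 3 x)" "asd1 x = wedge (xi 2 x) (xi 3 x)"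
    by (simp_all add: xi_def)
  have g: "sd2 T x = (\<lambda>u v. 1 * wedge (xi 1 x) (xi 2 x) u v + 2 * T * wedge (xi 3 x) (xi 4 x) u v)"
    "asd2 T x = (\<lambda>u v. - 1 * wedge (xi 1 x) (xi 2 x) u v + 2 * T * wedge (xi 3 x) (xi 4 x) u v)"
    by (simp_all add: fun_eq_iff sd2_def asd2_def xi_def)
  show "hodge_scalar \<eta> \<theta> e x (sd1 x) u v = lam x * sd1 x u v"
    unfolding f hodge_wedge_xi[OF x] c det_rows_add w lam_def
    using T by (simp add: det_rows_axis field_simps)
  show "hodge_scalar \<eta> \<theta> e x (asd1 x) u v = - lam x * asd1 x u v"
    unfolding f hodge_wedge_xi[OF x] c det_rows_add w lam_def
    using T by (simp add: det_rows_axis field_simps)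
  show "hodge_scalar \<eta> \<theta> e x (sd2 T x) u v = lam x * sd2 T x u v"
    unfolding g hodge_scalar_linear hodge_wedge_xi[OF x]
    unfolding c det_rows_add w lam_def
    using T by (simp add: det_rows_axis field_simps)
  show "hodge_scalar \<eta> \<theta> e x (asd2 T x) u v = - lam x * asd2 T x u v"
    unfolding g hodge_scalar_linear hodge_wedge_xi[OF x]
    unfolding c det_rows_add w lam_def
    using T by (simp add: det_rows_axis field_simps)
qed

text \<open>Complex conjugation exchanges the first two rows of \<open>Em\<close>, so its
  determinant is purely imaginary. Hence det \<eta> = - 4 t^2 r^2 with r the imaginary part, and
  |det \<eta>| cancels everything but the sign.\<close>

lemma lam_square:
  assumes x: "x \<in> V" shows "lam x * lam x = - 1"
proof -
  have BE: "det (Bm x) * det (Em x) = 1"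
    using arg_cong[OF Bm_Em(1)[OF x], of det] by (simp add: det_mul)
  have "cnj (Em x $ 1 $ j) = Em x $ 2 $ j" "cnj (Em x $ 2 $ j) = Em x $ 1 $ j"
    "cnj (Em x $ 3 $ j) = Em x $ 3 $ j" "cnj (Em x $ 4 $ j) = Em x $ 4 $ j" for j
    by (simp_all add: Em_def xi_def cnj_forms)
  then have "cnj (det (Em x)) = - det (Em x)" by (simp add: det_4 algebra_simps)
  from arg_cong[OF this, of Re] have "Re (det (Em x)) = 0" by simp
  then obtain r where r: "det (Em x) = \<i> * of_real r"
    using that[of "Im (det (Em x))"] by (simp add: complex_eq_iff)
  have "r \<noteq> 0" using BE r by auto
  have "complex_of_real (det \<eta>) = det etac"
    by (simp add: det_4 etac_def)
  also have "\<dots> = det (Em x) * det (Em x) * det (eta0 t)"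
    unfolding eta_Em[OF x, symmetric] by (simp add: det_mul det_transpose mult_ac)
  also have "det (eta0 t) = 4 * T * T" by (simp add: det_4 eta0_def T_def)
  also have "det (Em x) * det (Em x) * (4 * T * T) = of_real (- 4 * (r * t) * (r * t))"
    by (simp add: r T_def)
  finally have d: "det \<eta> = - 4 * (r * t) * (r * t)" by (simp only: of_real_eq_iff)
  have "0 < (r * t) * (r * t)"
    using \<open>r \<noteq> 0\<close> t zero_less_power2[of "r * t"] by (simp add: power2_eq_square)
  then have s: "sqrt \<bar>det \<eta>\<bar> * sqrt \<bar>det \<eta>\<bar> = 4 * (r * t) * (r * t)" by (simp add: d)
  have "det (Bm x) = 1 / (\<i> * of_real r)" using BE r \<open>r \<noteq> 0\<close> by (simp add: field_simps)
  define q where "q = sqrt \<bar>det \<eta>\<bar>"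
  have "lam x * lam x = of_real (q * q) / (\<i> * of_real r * (\<i> * of_real r) * (4 * T * T))"
    unfolding lam_def q_def[symmetric] \<open>det (Bm x) = _\<close> by (simp add: mult_ac)
  also have "\<dots> = - 1" unfolding s[folded q_def] using \<open>r \<noteq> 0\<close> t by (simp add: T_def field_simps)
  finally show ?thesis .
qed

lemma smooth_lam: "smooth_on V lam"
  unfolding lam_def[abs_def] divide_inverse
  by (rule smooth_on_mult[OF V smooth_on_mult[OF V smooth_on_const smooth_on_det[OF V smooth_Bm]] smooth_on_const])

text \<open>Differentiating \<open>lam_square\<close> avoids an argument about connected components
  of \<open>V\<close>; the star then commutes with the covariant derivative of each part up to the
  factor \<open>lam\<close>.\<close>

lemma lam_derivative:
  assumes x: "x \<in> V" shows "frechet_derivative lam (at x) v = 0"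
proof -
  note d = smooth_on_differentiable[OF smooth_lam x]
  have "frechet_derivative (\<lambda>y. lam y * lam y) (at x) v = frechet_derivative (\<lambda>y. - 1) (at x) v"
    by (rule fun_cong[OF frechet_derivative_cong_open[OF V x lam_square]])
  then have "lam x * frechet_derivative lam (at x) v + frechet_derivative lam (at x) v * lam x = 0"
    by (simp only: frechet_derivative_mult[OF d d] frechet_derivative_const)
  then have "lam x * frechet_derivative lam (at x) v = 0" by (simp add: mult.commute)
  moreover have "lam x \<noteq> 0" using lam_square[OF x] by auto
  ultimately show ?thesis by simp
qed

end

section \<open>The Bach and Cotton conditions in an adapted coframe\<close>

lemma bounded_bilinear_smat: "bounded_bilinear (smat :: complex \<Rightarrow> complex^'n^'m \<Rightarrow> _)"
proof -
  have "bilinear (smat :: complex \<Rightarrow> complex^'n^'m \<Rightarrow> _)"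
    unfolding bilinear_def linear_iff by (simp add: vec_eq_iff algebra_simps)
  then show ?thesis by (simp add: bilinear_conv_bounded_bilinear)
qed

lemma smat_0 [simp]: "smat c 0 = 0" "smat 0 M = 0"
  by (simp_all add: vec_eq_iff)

lemma differentiable_linear:
  assumes "bounded_linear L" "f differentiable at x"
  shows "(\<lambda>y. L (f y)) differentiable at x"
proof -
  from assms(2) obtain D where "(f has_derivative D) (at x)" unfolding differentiable_def by (rule exE)
  from bounded_linear.has_derivative[OF assms(1) this] show ?thesis by (rule differentiableI)
qed

context conf_frame
begin

lemma linear_curv:
  assumes x: "x \<in> V"
  shows "linear (\<lambda>u. curv_plus t x u v)" "linear (\<lambda>v. curv_plus t x u v)"
    "linear (\<lambda>u. curv_minus t x u v)" "linear (\<lambda>v. curv_minus t x u v)"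
proof -
  obtain k1 k2 where bet: "\<And>v. bet x v = k1 * w1 x v + k2 * wc x v"
    "\<And>v. betb x v = cnj k1 * wb x v + cnj k2 * wc x v" using bet_span[OF x] by blast
  note l = smooth_formD(1)[OF smooth_w1 x] smooth_formD(1)[OF smooth_forms(1) x]
    smooth_formD(1)[OF smooth_forms(2) x] smooth_formD(1)[OF smooth_forms(4) x]
  note a = linear_add[OF l(1)] linear_add[OF l(2)] linear_add[OF l(3)] linear_add[OF l(4)]
    linear_scale[OF l(1)] linear_scale[OF l(2)] linear_scale[OF l(3)] linear_scale[OF l(4)]
  show "linear (\<lambda>u. curv_plus t x u v)" "linear (\<lambda>v. curv_plus t x u v)"
    unfolding curv_plus_split[OF bet(1)] linear_iff sd2_def wedge_def a
    by (simp_all add: vec_eq_iff algebra_simps)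
  show "linear (\<lambda>u. curv_minus t x u v)" "linear (\<lambda>v. curv_minus t x u v)"
    unfolding curv_minus_split[OF bet(2)] linear_iff asd2_def wedge_def a
    by (simp_all add: vec_eq_iff algebra_simps)
qed

lemma curv_differentiable:
  assumes x: "x \<in> V"
  shows "(\<lambda>y. curv_plus t y u v) differentiable at x" "(\<lambda>y. curv_minus t y u v) differentiable at x"
  unfolding curv_plus_def curv_minus_def
  by (rule differentiable_linear[OF bounded_linear_curv_tab differentiable_curv(1)[OF x]],
      rule differentiable_linear[OF bounded_linear_curv_tab' differentiable_curv(2)[OF x]])

end

context adapted_frame
begin

definition star_curv :: "(n_space, mat6) form2" where
  "star_curv x u v = smat (lam x) (curv_plus T x u v - curv_minus T x u v)"

lemma curvature_Acon_eq:
  assumes x: "x \<in> V"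
  shows "conn_curvature Acon x u v = hm x ** (curv_plus T x u v + curv_minus T x u v) ** hi x"
proof -
  have "conn_curvature Acon x u v ** (hm x ** hi x) = hm x ** (curv_plus T x u v + curv_minus T x u v) ** hi x"
    by (simp only: curvature_Acon[OF x] matrix_mul_assoc)
  then show ?thesis by (simp only: hi[OF x] matrix_mul_rid)
qed

text \<open>Conjugation by \<open>hm\<close> mixes matrix entries but not the 2-forms, so every
  entry of the curvature stays a combination of the two pairs of eigenforms.\<close>

lemma hodge_curvature:
  assumes x: "x \<in> V"
  shows "hodge \<eta> \<theta> e (conn_curvature Acon) x u v = hm x ** star_curv x u v ** hi x"
proof -
  obtain k1 k2 where bet: "\<And>v. bet x v = k1 * w1 x v + k2 * wc x v"
    "\<And>v. betb x v = cnj k1 * wb x v + cnj k2 * wc x v" using bet_span[OF x] by blast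
  define N1 where "N1 = hm x ** curv_tab T (0, k1, k2, k x) ** hi x"
  define N2 where "N2 = hm x ** curv_tab T (k x, 0, 0, 0) ** hi x"
  define N3 where "N3 = hm x ** curv_tab' T (0, cnj k1, cnj k2, kb x) ** hi x"
  define N4 where "N4 = hm x ** curv_tab' T (kb x, 0, 0, 0) ** hi x"
  have F: "conn_curvature Acon x u v $ r $ s = 1 * (N1 $ r $ s * sd1 x u v + N2 $ r $ s * sd2 T x u v)
      + 1 * (N3 $ r $ s * asd1 x u v + N4 $ r $ s * asd2 T x u v)" for u v r s
    unfolding curvature_Acon_eq[OF x] curv_plus_split[OF bet(1)] curv_minus_split[OF bet(2)]
      matrix_distribs smat_mult N1_def N2_def N3_def N4_def
    by (simp add: mult.commute)
  have S: "(hm x ** star_curv x u v ** hi x) $ r $ s = lam x * (N1 $ r $ s * sd1 x u v + N2 $ r $ s * sd2 T x u v)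
      - lam x * (N3 $ r $ s * asd1 x u v + N4 $ r $ s * asd2 T x u v)" for r s
    unfolding star_curv_def curv_plus_split[OF bet(1)] curv_minus_split[OF bet(2)]
      matrix_distribs smat_mult N1_def N2_def N3_def N4_def
    by (simp add: algebra_simps)
  have "hodge \<eta> \<theta> e (conn_curvature Acon) x u v $ r $ s = (hm x ** star_curv x u v ** hi x) $ r $ s" for r s
    unfolding hodge_nth F hodge_scalar_linear hodge_sd[OF x] S by (simp add: algebra_simps)
  then show ?thesis by (simp add: vec_eq_iff)
qed

lemma star_curv_differentiable: "x \<in> V \<Longrightarrow> (\<lambda>y. star_curv y u v) differentiable at x"
  unfolding star_curv_def
  by (rule differentiable_bilinear[OF bounded_bilinear_smat smooth_on_differentiable[OF smooth_lam]])
    (assumption, rule differentiable_diff[OF curv_differentiable])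

lemma cov_d2_star_curv:
  assumes x: "x \<in> V" and t1: "t = 1 \<or> t = -1/3"
  shows "cov_d2 (conn T) star_curv x u v z = 0"
proof -
  have T1: "T = 1 \<or> T = -1/3" using t1 by (auto simp: T_def)
  note d = curv_differentiable[OF x, of T]
  have fd: "frechet_derivative (\<lambda>y. star_curv y p q) (at x) r
      = smat (lam x) (frechet_derivative (\<lambda>y. curv_plus T y p q) (at x) r - frechet_derivative (\<lambda>y. curv_minus T y p q) (at x) r)" for p q r
    unfolding star_curv_def
      frechet_derivative_bilinear[OF bounded_bilinear_smat smooth_on_differentiable[OF smooth_lam x] differentiable_diff[OF d]]
      frechet_derivative_diff[OF d] lam_derivative[OF x] by simp
  have "cov_d2 (conn T) star_curv x u v z = smat (lam x) (cov_d2 (conn T) (curv_plus T) x u v z - cov_d2 (conn T) (curv_minus T) x u v z)"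
    unfolding cov_d2_def ext_d2_def fd
    unfolding star_curv_def smat_mult matrix_distribs
    by (simp add: vec_eq_iff algebra_simps)
  then show ?thesis by (simp add: cov_d2_curv[OF x T1])
qed

context
  fixes \<Gamma> :: "4 \<Rightarrow> 4 \<Rightarrow> (n_space, real) form1"
  assumes \<Gamma>: "levi_civita V \<eta> \<theta> \<Gamma>"
begin

abbreviation "NC \<equiv> normal_connection \<eta> \<theta> e \<Gamma>"

lemma curvature_NC: 
  assumes x: "x \<in> V" shows "conn_curvature NC x u v = conn_curvature Acon x u v"
proof -
  have "ext_d NC x u v = ext_d Acon x u v"
    by (rule ext_d_cong[OF V x normal_connection_eq[OF \<Gamma>]])
  then show ?thesis by (simp only: conn_curvature_def normal_connection_eq[OF \<Gamma> x])
qed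

lemma hodge_NC: 
  assumes x: "x \<in> V" shows "hodge \<eta> \<theta> e (conn_curvature NC) x u v = hm x ** star_curv x u v ** hi x"
  unfolding hodge_curvature[OF x, symmetric] hodge_def curvature_NC[OF x] ..

text \<open>The normal connection is replaced by \<open>Acon\<close>, the star by \<open>lam\<close>
  times the difference of the two parts, and the equation is pulled back through the gauge
  transformation to \<open>cov_d2_star_curv\<close>.\<close>

lemma bach_adapted:
  assumes x: "x \<in> V" and t1: "t = 1 \<or> t = -1/3"
  shows "cov_d2 NC (hodge \<eta> \<theta> e (conn_curvature NC)) x u v z = 0"
proof -
  let ?B = "hodge \<eta> \<theta> e (conn_curvature NC)"
  have d: "(\<lambda>y. ?B y u v) differentiable at x" for u v
  proof (rule differentiable_cong_open[OF V x])
    show "(\<lambda>y. hm y ** star_curv y u v ** hi y) differentiable at x"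
      by (rule differentiable_bilinear[OF bounded_bilinear_matrix_mult differentiable_bilinear[OF bounded_bilinear_matrix_mult
            smooth_on_differentiable[OF smooth_hm x] star_curv_differentiable[OF x]] smooth_on_differentiable[OF smooth_hi x]])
  qed (simp add: hodge_NC)
  have B: "?B y u v ** hm y = hm y ** star_curv y u v" if "y \<in> V" for y u v
    unfolding hodge_NC[OF that] matrix_mul_assoc[symmetric] hi[OF that] matrix_mul_rid ..
  have "cov_d2 Acon ?B x u v z ** hm x = hm x ** cov_d2 (conn T) star_curv x u v z"
    by (rule cov_d2_gauge[OF V smooth_conn smooth_Acon smooth_hm Acon_gauge x star_curv_differentiable[OF x] d B])
  then have "cov_d2 Acon ?B x u v z ** hm x = 0"
    by (simp add: cov_d2_star_curv[OF x t1])
  then have "cov_d2 Acon ?B x u v z ** hm x ** hi x = 0" by simp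
  then have "cov_d2 Acon ?B x u v z = 0" by (simp only: matrix_mul_assoc[symmetric] hi[OF x] matrix_mul_rid)
  then show ?thesis unfolding cov_d2_def normal_connection_eq[OF \<Gamma> x] .
qed

lemma curvature_zero_adapted:
  assumes x: "x \<in> V" and k: "\<And>y. y \<in> V \<Longrightarrow> k y = 0"
  shows "conn_curvature NC x u v = 0"
proof -
  have "frechet_derivative k (at x) v = frechet_derivative (\<lambda>y. 0) (at x) v" for v
    by (rule fun_cong[OF frechet_derivative_cong_open[OF V x k]])
  then have "bet x v = 0" for v by (simp add: bet_def kap_def k[OF x] frechet_derivative_const)
  then have "bet x v = 0 * w1 x v + 0 * wc x v" "betb x v = 0 * wb x v + 0 * wc x v" for v
    by (simp_all add: betb_def conj_form_def)
  note s = curv_plus_split[OF this(1)] curv_minus_split[OF this(2)]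
  have "curv_tab T (0, 0, 0, 0) = 0" "curv_tab' T (0, 0, 0, 0) = 0"
    using linear_0[OF bounded_linear.linear[OF bounded_linear_curv_tab], of T]
      linear_0[OF bounded_linear.linear[OF bounded_linear_curv_tab'], of T]
    by (simp_all add: zero_prod_def)
  then have "curv_plus T x u v = 0" "curv_minus T x u v = 0" unfolding s by (simp_all add: k[OF x] kb_def)
  then show ?thesis by (simp add: curvature_NC[OF x] curvature_Acon_eq[OF x])
qed

text \<open>On the null pair dual to \<open>wc\<close> and \<open>ps\<close> the forms
  \<open>sd1\<close> and \<open>asd1\<close> vanish and \<open>sd2\<close> and \<open>asd2\<close>
  both equal 2t, so all terms with derivatives of k disappear.\<close>

lemma curv_dual_vectors:
  assumes x: "x \<in> V"
  obtains u v where "curv_plus T x u v = smat (2 * T) (curv_tab T (k x, 0, 0, 0))"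
    "curv_minus T x u v = smat (2 * T) (curv_tab' T (kb x, 0, 0, 0))"
proof -
  obtain k1 k2 where bet: "\<And>v. bet x v = k1 * w1 x v + k2 * wc x v"
    "\<And>v. betb x v = cnj k1 * wb x v + cnj k2 * wc x v" using bet_span[OF x] by blast
  obtain u where u: "w x u = 1" "w1 x u = 0" "Im (W x u) = 0" by (rule dual_vectors[OF x])
  obtain v where v: "w x v = 0" "w1 x v = 0" "Im (W x v) = 1" by (rule dual_vectors[OF x])
  have f: "w1 x u = 0" "wb x u = 0" "wc x u = 1" "ps x u = 0" "w1 x v = 0" "wb x v = 0" "wc x v = 0" "ps x v = 1"
    using u v by (simp_all add: wb_def conj_form_def wc_def cplx_def ps_def)
  show ?thesis
    by (rule that[of u v]; unfold curv_plus_split[OF bet(1)] curv_minus_split[OF bet(2)] sd2_def asd2_def wedge_def f; simp)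
qed

lemma curvature_nonzero_adapted:
  assumes x: "x \<in> V" and t1: "t = 1 \<or> t = -1/3" and k: "k x \<noteq> 0"
  obtains u v where "conn_curvature NC x u v \<noteq> 0"
proof -
  obtain u v where uv: "curv_plus T x u v = smat (2 * T) (curv_tab T (k x, 0, 0, 0))"
    "curv_minus T x u v = smat (2 * T) (curv_tab' T (kb x, 0, 0, 0))" by (rule curv_dual_vectors[OF x])
  have "(curv_plus T x u v + curv_minus T x u v) $ Inl () $ Inr (Inl 1) = - \<i> * T * ((3 * T - 1) / 4) * k x"
    unfolding uv by (simp add: curv_tab_def curv_tab'_def curv_entries_def curv_entries'_def Let_def)
  \<comment> \<open>The factor 3t - 1 is 2 for t = 1 and -2 for t = -1/3.\<close>
  also have "\<dots> \<noteq> 0" using t1 k by (auto simp: T_def)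
  finally have "(curv_plus T x u v + curv_minus T x u v) $ Inl () $ Inr (Inl 1) \<noteq> 0" .
  then have nz: "curv_plus T x u v + curv_minus T x u v \<noteq> 0" by (metis zero_index)
  have "conn_curvature NC x u v \<noteq> 0"
  proof
    assume "conn_curvature NC x u v = 0"
    then have "hi x ** (hm x ** (curv_plus T x u v + curv_minus T x u v) ** hi x) ** hm x = 0"
      by (simp add: curvature_NC[OF x] curvature_Acon_eq[OF x])
    then have "(hi x ** hm x) ** (curv_plus T x u v + curv_minus T x u v) ** (hi x ** hm x) = 0"
      by (simp only: matrix_mul_assoc)
    then show False using nz by (simp add: hi[OF x])
  qed
  then show ?thesis by (rule that)
qed

lemma linear_zero_on_frame:
  assumes x: "x \<in> V" and "linear f" "\<And>i. f (e i x) = 0" shows "f u = 0"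
  by (subst frame_expand[OF x, of u]) (simp add: linear_sum[OF assms(2)] linear_scale[OF assms(2)] assms(3))

text \<open>Vanishing commutators on frame vectors extend by linearity to all arguments, in
  particular to the null pair of \<open>curv_dual_vectors\<close>. There a single entry of the
  commutator is a nonzero multiple of |k|^2.\<close>

lemma cotton_adapted:
  assumes x: "x \<in> V" and t1: "t = 1 \<or> t = -1/3" and k: "k x \<noteq> 0"
    and comm: "\<And>i j k l. dual_part 1 \<eta> \<theta> e (conn_curvature NC) x (e i x) (e j x) ** dual_part (-1) \<eta> \<theta> e (conn_curvature NC) x (e k x) (e l x)
       = dual_part (-1) \<eta> \<theta> e (conn_curvature NC) x (e k x) (e l x) ** dual_part 1 \<eta> \<theta> e (conn_curvature NC) x (e i x) (e j x)"
  shows False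
proof -
  define P where "P u v = hm x ** curv_plus T x u v ** hi x" for u v
  define M where "M u v = hm x ** curv_minus T x u v ** hi x" for u v
  have F: "conn_curvature NC x u v = P u v + M u v" for u v
    unfolding curvature_NC[OF x] curvature_Acon_eq[OF x] P_def M_def by (simp only: matrix_distribs)
  have H: "hodge \<eta> \<theta> e (conn_curvature NC) x u v = smat (lam x) (P u v - M u v)" for u v
    unfolding hodge_NC[OF x] star_curv_def P_def M_def by (simp only: smat_mult matrix_distribs)
  have "(lam x - \<i>) * (lam x + \<i>) = 0" using lam_square[OF x] by (simp add: algebra_simps)
  \<comment> \<open>The sign decides which part is the self-dual one; the commutator condition is
    symmetric under exchanging the two, so both cases lead to \<open>c0\<close>.\<close>
  then have "lam x = \<i> \<or> lam x = - \<i>" by (simp add: eq_neg_iff_add_eq_0)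
  then have "(\<forall>u v. dual_part 1 \<eta> \<theta> e (conn_curvature NC) x u v = P u v \<and> dual_part (-1) \<eta> \<theta> e (conn_curvature NC) x u v = M u v)
     \<or> (\<forall>u v. dual_part 1 \<eta> \<theta> e (conn_curvature NC) x u v = M u v \<and> dual_part (-1) \<eta> \<theta> e (conn_curvature NC) x u v = P u v)"
    by (elim disjE) (simp_all add: dual_part_def F H vec_eq_iff algebra_simps)
  then have c0: "P (e i x) (e j x) ** M (e k x) (e l x) - M (e k x) (e l x) ** P (e i x) (e j x) = 0" for i j k l
  proof (elim disjE)
    assume "\<forall>u v. dual_part 1 \<eta> \<theta> e (conn_curvature NC) x u v = P u v \<and> dual_part (-1) \<eta> \<theta> e (conn_curvature NC) x u v = M u v"
    then have d: "dual_part 1 \<eta> \<theta> e (conn_curvature NC) x u v = P u v" "dual_part (-1) \<eta> \<theta> e (conn_curvature NC) x u v = M u v" for u v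
      by blast+
    show ?thesis using comm[of i j k l] unfolding d by (rule right_minus_eq[THEN iffD2])
  next
    assume "\<forall>u v. dual_part 1 \<eta> \<theta> e (conn_curvature NC) x u v = M u v \<and> dual_part (-1) \<eta> \<theta> e (conn_curvature NC) x u v = P u v"
    then have d: "dual_part 1 \<eta> \<theta> e (conn_curvature NC) x u v = M u v" "dual_part (-1) \<eta> \<theta> e (conn_curvature NC) x u v = P u v" for u v
      by blast+
    show ?thesis using comm[of k l i j, symmetric] unfolding d by (rule right_minus_eq[THEN iffD2])
  qed
  have lP: "linear (\<lambda>u. P u v)" "linear (\<lambda>v. P u v)" and lM: "linear (\<lambda>u. M u v)" "linear (\<lambda>v. M u v)" for u v
    using linear_curv[OF x, of T]
    by (simp_all add: linear_iff P_def M_def matrix_distribs matrix_mult.scaleR_left matrix_mult.scaleR_right)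
  have lc: "linear (\<lambda>u. f u ** N - N ** f u)" "linear (\<lambda>u. N ** f u - f u ** N)"
    if "linear f" for f :: "n_space \<Rightarrow> mat6" and N :: mat6
    using that by (simp_all add: linear_iff matrix_distribs matrix_mult.scaleR_left matrix_mult.scaleR_right algebra_simps)
  have "P u v ** M u' v' - M u' v' ** P u v = 0" for u v u' v'
    by (rule linear_zero_on_frame[OF x lc(1)[OF lP(1)]], rule linear_zero_on_frame[OF x lc(1)[OF lP(2)]],
        rule linear_zero_on_frame[OF x lc(2)[OF lM(1)]], rule linear_zero_on_frame[OF x lc(2)[OF lM(2)]], rule c0)
  then have PM: "P u v ** M u v - M u v ** P u v = 0" for u v by blast
  obtain u v where uv: "curv_plus T x u v = smat (2 * T) (curv_tab T (k x, 0, 0, 0))"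
    "curv_minus T x u v = smat (2 * T) (curv_tab' T (kb x, 0, 0, 0))" by (rule curv_dual_vectors[OF x])
  define p where "p = curv_plus T x u v"
  define m where "m = curv_minus T x u v"
  have "hm x ** p ** hi x ** (hm x ** m ** hi x) - hm x ** m ** hi x ** (hm x ** p ** hi x) = 0"
    using PM[of u v] unfolding P_def M_def p_def m_def .
  moreover have "hm x ** a ** hi x ** (hm x ** b ** hi x) = hm x ** (a ** b) ** hi x" for a b
  proof -
    have "hm x ** a ** hi x ** (hm x ** b ** hi x) = hm x ** a ** (hi x ** hm x) ** b ** hi x"
      by (simp only: matrix_mul_assoc)
    also have "\<dots> = hm x ** (a ** b) ** hi x"
      unfolding hi[OF x] matrix_mul_rid by (simp only: matrix_mul_assoc)
    finally show ?thesis .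
  qed
  ultimately have 0: "hm x ** (p ** m - m ** p) ** hi x = 0"
    by (simp only: matrix_distribs)
  have "(hi x ** hm x) ** (p ** m - m ** p) ** (hi x ** hm x) = hi x ** (hm x ** (p ** m - m ** p) ** hi x) ** hm x"
    by (simp only: matrix_mul_assoc)
  then have "(hi x ** hm x) ** (p ** m - m ** p) ** (hi x ** hm x) = 0" by (simp add: 0)
  then have "p ** m - m ** p = 0" by (simp add: hi[OF x])
  then have "(p ** m - m ** p) $ Inl () $ Inr (Inl 3) = 0" by simp
  \<comment> \<open>Two products contribute to this entry: through the column of \<open>w1\<close>
    in \<open>p ** m\<close> and through that of \<open>wb\<close> in \<open>m ** p\<close>. They
    have opposite signs and add up in the commutator.\<close>
  moreover have "(p ** m - m ** p) $ Inl () $ Inr (Inl 3) = 4 * T * T * \<i> * ((3 * T - 1) / 4)\<^sup>2 * k x * kb x"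
    unfolding p_def m_def uv vector_minus_component mat6_mult_nth
    by (simp add: curv_tab_def curv_tab'_def curv_entries_def curv_entries'_def Let_def power2_eq_square)
  ultimately show False
    using t1 k by (auto simp: T_def kb_def)
qed

end

end

section \<open>The coframe on the slice \<open>\<rho> = 1\<close>\<close>

lemma frechet_derivative_line:
  assumes "f differentiable at y"
  shows "((\<lambda>s. f (y + s *\<^sub>R u)) has_vector_derivative frechet_derivative f (at y) u) (at 0)"
proof -
  have "((\<lambda>s. y + s *\<^sub>R u) has_vector_derivative u) (at 0)"
    by (auto intro!: derivative_eq_intros)
  moreover have "(f has_derivative frechet_derivative f (at y)) (at (y + 0 *\<^sub>R u))"
    using assms frechet_derivative_works by auto
  ultimately show ?thesis
    using vector_derivative_diff_chain_within[of "\<lambda>s. y + s *\<^sub>R u" u 0 UNIV f "frechet_derivative f (at y)"]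
    by (auto simp: o_def intro: has_derivative_at_withinI)
qed

text \<open>\<open>smooth_on\<close> is a pointwise condition on iterated derivatives, so smoothness
  on neighbourhoods suffices.\<close>

lemma smooth_on_local:
  assumes "\<And>x. x \<in> S \<Longrightarrow> \<exists>U. x \<in> U \<and> smooth_on U f" shows "smooth_on S f"
  using assms unfolding smooth_on_def by blast

lemma (in conf_frame) conf_frame_subset:
  assumes "open V'" "V' \<subseteq> V" shows "conf_frame V' w w1 W k"
proof
  show "open V'" by fact
  show "smooth_form V' w" "smooth_form V' w1" "smooth_form V' W" "smooth_on V' k"
    using smooth_form_subset[OF smooth_w assms(2)] smooth_form_subset[OF smooth_w1 assms(2)]
      smooth_form_subset[OF smooth_W assms(2)] smooth_on_subset[OF smooth_k assms(2)] .
qed (use assms ext_d_w ext_d_w1 ext_d_W inj in blast)+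

text \<open>Corresponds to replacing the section \<rho> = 1 of P by \<rho> = e^f: the pulled back
  forms acquire the factors \<rho>^2 and \<rho>, the form \<open>W\<close> gains d log \<rho>, and k
  gains \<rho>^(-3). The metric is multiplied by e^(2f).\<close>

lemma (in conf_frame) conf_frame_rescale:
  assumes f: "smooth_on V (f :: n_space \<Rightarrow> real)"
  shows "conf_frame V (\<lambda>x v. exp (2 * f x) * w x v) (\<lambda>x v. of_real (exp (f x)) * w1 x v)
    (\<lambda>x v. W x v + of_real (frechet_derivative f (at x) v)) (\<lambda>x. of_real (exp (- 3 * f x)) * k x)"
proof -
  let ?df = "\<lambda>x v. frechet_derivative f (at x) v"
  have fd: "(f has_derivative ?df x) (at x)" if "x \<in> V" for x by (rule smooth_on_has_derivative[OF f that])
  have sm: "smooth_on V (\<lambda>x. exp (c * f x))" for c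
    by (rule smooth_on_exp[OF V smooth_on_mult[OF V smooth_on_const f]])
  have de: "frechet_derivative (\<lambda>x. exp (c * f x)) (at x) v = c * ?df x v * exp (c * f x)" if "x \<in> V" for c x v
    by (rule fun_cong[OF frechet_derivative_at[symmetric]]) (auto intro!: derivative_eq_intros fd[OF that])
  have sc: "smooth_on V (\<lambda>x. complex_of_real (exp (c * f x)))" for c by (rule smooth_on_of_real[OF V sm])
  have dc: "frechet_derivative (\<lambda>x. complex_of_real (exp (c * f x))) (at x) v = of_real (c * ?df x v * exp (c * f x))" if "x \<in> V" for c x v
    unfolding frechet_derivative_linear[OF bounded_linear_of_real smooth_on_differentiable[OF sm that]] de[OF that] ..
  note c1 = sc[of 1, simplified]
  have sdf: "smooth_form V (\<lambda>x v. complex_of_real (?df x v))"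
    by (rule smooth_form_linear[OF V bounded_linear_of_real smooth_form_exact[OF f]])
  show ?thesis
  proof
    show "open V" by (rule V)
    show "smooth_form V (\<lambda>x v. exp (2 * f x) * w x v)" by (rule smooth_form_mult[OF V sm smooth_w])
    show "smooth_form V (\<lambda>x v. of_real (exp (f x)) * w1 x v)" by (rule smooth_form_mult[OF V c1 smooth_w1])
    show "smooth_form V (\<lambda>x v. W x v + of_real (?df x v))" by (rule smooth_form_add[OF V smooth_W sdf])
    show "smooth_on V (\<lambda>x. of_real (exp (- 3 * f x)) * k x)" by (rule smooth_on_mult[OF V sc smooth_k])
    fix x u v assume x: "x \<in> V"
    have cw: "cplx (\<lambda>x v. exp (2 * f x) * w x v) = (\<lambda>x v. of_real (exp (2 * f x)) * cplx w x v)"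
      by (simp add: cplx_def fun_eq_iff)
    have e2: "exp (2 * f x) = exp (f x) * exp (f x)" by (simp add: exp_add[symmetric])
    have e3: "exp (- 3 * f x) * (exp (f x) * (exp (f x) * exp (f x))) = 1" by (simp add: exp_add[symmetric])
    have dwc: "(\<lambda>y. cplx w y v) differentiable at x" for v
      using forms_differentiable(3)[OF x] by (simp add: wc_def)
    show "ext_d (cplx (\<lambda>x v. exp (2 * f x) * w x v)) x u v
        = \<i> * wedge (\<lambda>v. of_real (exp (f x)) * w1 x v) (conj_form (\<lambda>x v. of_real (exp (f x)) * w1 x v) x) u v
        + wedge (\<lambda>z. W x z + of_real (?df x z) + conj_form (\<lambda>x v. W x v + of_real (?df x v)) x z)
          (cplx (\<lambda>x v. exp (2 * f x) * w x v) x) u v"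
      unfolding cw ext_d_mult[OF smooth_on_differentiable[OF sc x] dwc] ext_d_w[OF x] wedge_def dc[OF x] e2
      by (simp add: conj_form_def algebra_simps)
    show "ext_d (\<lambda>x v. of_real (exp (f x)) * w1 x v) x u v
        = wedge (\<lambda>v. W x v + of_real (?df x v)) (\<lambda>v. of_real (exp (f x)) * w1 x v) u v"
      unfolding ext_d_mult[OF smooth_on_differentiable[OF c1 x] forms_differentiable(1)[OF x]] ext_d_w1[OF x]
      using dc[OF x, of 1] by (simp add: wedge_def algebra_simps)
    have "ext_d (\<lambda>x v. complex_of_real (?df x v)) x u v = of_real (ext_d ?df x u v)"
      by (rule ext_d_linear[OF bounded_linear_of_real smooth_formD(3)[OF smooth_form_exact[OF f] x]])
    then have 0: "ext_d (\<lambda>x v. complex_of_real (?df x v)) x u v = 0"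
      by (simp add: ext_d_exact[OF V x f])
    have "of_real (exp (- 3 * f x)) * k x * wedge (\<lambda>v. of_real (exp (f x)) * w1 x v) (cplx (\<lambda>x v. exp (2 * f x) * w x v) x) u v
      = of_real (exp (- 3 * f x) * (exp (f x) * (exp (f x) * exp (f x)))) * (k x * wedge (w1 x) (cplx w x) u v)"
      unfolding cw e2 by (simp add: wedge_def algebra_simps)
    note E = this
    show "ext_d (\<lambda>x v. W x v + of_real (?df x v)) x u v
        = of_real (exp (- 3 * f x)) * k x * wedge (\<lambda>v. of_real (exp (f x)) * w1 x v) (cplx (\<lambda>x v. exp (2 * f x) * w x v) x) u v"
      unfolding ext_d_add[OF forms_differentiable(2)[OF x] smooth_formD(3)[OF sdf x]] 0 ext_d_W[OF x] E e3 by simp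
  next
    fix x v assume "x \<in> V" "exp (2 * f x) * w x v = 0" "of_real (exp (f x)) * w1 x v = 0" "Im (W x v + of_real (?df x v)) = 0"
    then show "v = 0" using inj[of x v] by simp
  qed
qed

definition jr :: "real \<Rightarrow> n_space \<Rightarrow> p_space" where "jr \<rho> z = (fst z, \<rho>, snd z)"
definition jl :: "n_space \<Rightarrow> p_space" where "jl v = (fst v, 0, snd v)"

lemma ext_d_slice:
  assumes "\<And>p. (\<lambda>y. \<alpha> y p) differentiable at (jr \<rho> z)"
  shows "ext_d (\<lambda>z v. \<alpha> (jr \<rho> z) (jl v)) z u v = ext_d \<alpha> (jr \<rho> z) (jl u) (jl v)"
proof -
  have j: "(jr \<rho> has_derivative jl) (at z)"
    unfolding jr_def[abs_def] jl_def[abs_def] by (auto intro!: derivative_eq_intros)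
  have "frechet_derivative (\<lambda>z. \<alpha> (jr \<rho> z) p) (at z) u = frechet_derivative (\<lambda>y. \<alpha> y p) (at (jr \<rho> z)) (jl u)" for p u
  proof -
    have "((\<lambda>y. \<alpha> y p) has_derivative frechet_derivative (\<lambda>y. \<alpha> y p) (at (jr \<rho> z))) (at (jr \<rho> z))"
      using assms frechet_derivative_works by blast
    from diff_chain_at[OF j this] have "((\<lambda>z. \<alpha> (jr \<rho> z) p) has_derivative (\<lambda>u. frechet_derivative (\<lambda>y. \<alpha> y p) (at (jr \<rho> z)) (jl u))) (at z)"
      by (simp only: o_def)
    from fun_cong[OF frechet_derivative_at[OF this]] show ?thesis by (rule sym)
  qed
  then show ?thesis by (simp add: ext_d_def)
qed

lemma smooth_on_slice:
  assumes D: "open D" and f: "smooth_on (D \<times> {0<..} \<times> UNIV) f" and r: "\<rho> > 0"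
  shows "smooth_on (D \<times> UNIV) (\<lambda>z. f (jr \<rho> z))"
proof (rule smooth_on_compose[OF _ _ f])
  show o: "open (D \<times> (UNIV::real set))" using D by (intro open_Times) auto
  have "smooth_on (D \<times> UNIV) (\<lambda>z. (0, \<rho>, 0) + jl z)"
    by (rule smooth_on_add[OF o smooth_on_const smooth_on_bounded_linear[OF o]])
      (auto simp: linear_conv_bounded_linear[symmetric] linear_iff jl_def)
  then show "smooth_on (D \<times> UNIV) (jr \<rho>)" by (simp add: jl_def jr_def[abs_def])
  show "jr \<rho> z \<in> D \<times> {0<..} \<times> UNIV" if "z \<in> D \<times> UNIV" for z using that r by (auto simp: jr_def)
qed

text \<open>One chart of the congruence with all data on P written out in coordinates, for
  \<open>K1\<close> = 0. The manifold and its atlas no longer appear.\<close>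

locale oc_chart =
  fixes D :: "(real^3) set" and A :: "real^3 \<Rightarrow> real" and L :: "(real^3, real) form1" and Mu :: "(real^3, complex) form1"
    and Om :: "(p_space, complex) form1" and K :: "real^3 \<Rightarrow> complex" and om :: "(p_space, real) form1"
    and om1 :: "(p_space, complex) form1"
  assumes D: "open D" and smooth_L: "smooth_form D L" and smooth_Mu: "smooth_form D Mu" and smooth_A: "smooth_on D A"
    and A_nz: "\<And>x. x \<in> D \<Longrightarrow> A x \<noteq> 0" and smooth_K: "smooth_on D K"
    and smooth_Om: "smooth_form (D \<times> {0<..} \<times> UNIV) Om"
    and om: "om = (\<lambda>(x, \<rho>, \<phi>) v. \<rho>\<^sup>2 / A x * L x (fst v))"
    and om1: "om1 = (\<lambda>(x, \<rho>, \<phi>) v. of_real \<rho> * cis \<phi> * Mu x (fst v))"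
    and nondeg: "\<And>x \<rho> \<phi> v. x \<in> D \<Longrightarrow> \<rho> > 0 \<Longrightarrow> om (x, \<rho>, \<phi>) v = 0 \<Longrightarrow> om1 (x, \<rho>, \<phi>) v = 0 \<Longrightarrow> Om (x, \<rho>, \<phi>) v = 0 \<Longrightarrow> v = 0"
    and d_om: "\<And>x \<rho> \<phi> u v. x \<in> D \<Longrightarrow> \<rho> > 0 \<Longrightarrow> ext_d (cplx om) (x, \<rho>, \<phi>) u v
      = \<i> * wedge (om1 (x, \<rho>, \<phi>)) (conj_form om1 (x, \<rho>, \<phi>)) u v
        + wedge (\<lambda>z. Om (x, \<rho>, \<phi>) z + conj_form Om (x, \<rho>, \<phi>) z) (cplx om (x, \<rho>, \<phi>)) u v"
    and d_om1: "\<And>x \<rho> \<phi> u v. x \<in> D \<Longrightarrow> \<rho> > 0 \<Longrightarrow> ext_d om1 (x, \<rho>, \<phi>) u v = wedge (Om (x, \<rho>, \<phi>)) (om1 (x, \<rho>, \<phi>)) u v"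
    and d_Om: "\<And>x \<rho> \<phi> u v. x \<in> D \<Longrightarrow> \<rho> > 0 \<Longrightarrow> ext_d Om (x, \<rho>, \<phi>) u v
      = cis (- \<phi>) * K x / of_real (\<rho> ^ 3) * wedge (om1 (x, \<rho>, \<phi>)) (cplx om (x, \<rho>, \<phi>)) u v"
begin

definition w :: "(n_space, real) form1" where "w z v = L (fst z) (fst v) / A (fst z)"
definition w1 :: "(n_space, complex) form1" where "w1 z v = cis (snd z) * Mu (fst z) (fst v)"
definition Wr :: "real \<Rightarrow> (n_space, complex) form1" where "Wr \<rho> z v = Om (jr \<rho> z) (jl v)"
definition k :: "n_space \<Rightarrow> complex" where "k z = cis (- snd z) * K (fst z)"

abbreviation "N \<equiv> D \<times> (UNIV :: real set)"

lemma N: "open N" using D by (intro open_Times) auto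

lemma slice: "om (jr \<rho> z) (jl v) = \<rho>\<^sup>2 * w z v" "om1 (jr \<rho> z) (jl v) = of_real \<rho> * w1 z v"
  by (simp_all add: om om1 jr_def jl_def w_def w1_def)

lemma smooth_fst: "smooth_on D f \<Longrightarrow> smooth_on N (\<lambda>z. f (fst z))"
  by (rule smooth_on_compose[OF N smooth_on_bounded_linear[OF N bounded_linear_fst]]) auto

lemma smooth_cis: "smooth_on N (\<lambda>z. cis (c * snd z))"
  unfolding cis_conv_exp
  by (rule smooth_on_exp[OF N smooth_on_mult[OF N smooth_on_const smooth_on_of_real[OF N
        smooth_on_mult[OF N smooth_on_const smooth_on_bounded_linear[OF N bounded_linear_snd]]]]])

lemma smooth_w: "smooth_form N w"
  unfolding smooth_form_def
proof (intro conjI ballI allI)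
  show "linear (w z)" if "z \<in> N" for z
    using smooth_formD(1)[OF smooth_L, of "fst z"] that by (auto simp: w_def linear_iff add_divide_distrib)
  show "smooth_on N (\<lambda>z. w z v)" for v
    unfolding w_def by (rule smooth_on_divide[OF N smooth_fst[OF smooth_formD(2)[OF smooth_L]] smooth_fst[OF smooth_A]])
      (use A_nz in auto)
qed

lemma smooth_w1: "smooth_form N w1"
  unfolding smooth_form_def
proof (intro conjI ballI allI)
  show "linear (w1 z)" if "z \<in> N" for z
    using smooth_formD(1)[OF smooth_Mu, of "fst z"] that by (auto simp: w1_def linear_iff algebra_simps)
  show "smooth_on N (\<lambda>z. w1 z v)" for v
    unfolding w1_def using smooth_on_mult[OF N smooth_cis[of 1] smooth_fst[OF smooth_formD(2)[OF smooth_Mu]]] by simp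
qed

lemma smooth_Wr: assumes r: "\<rho> > 0" shows "smooth_form N (Wr \<rho>)"
  unfolding smooth_form_def
proof (intro conjI ballI allI)
  show "linear (Wr \<rho> z)" if z: "z \<in> N" for z
  proof -
    have "jr \<rho> z \<in> D \<times> {0<..} \<times> UNIV" using z r by (auto simp: jr_def)
    from smooth_formD(1)[OF smooth_Om this]
    have 1: "linear (Om (jr \<rho> z))" .
    have "linear jl" by (simp add: jl_def linear_iff)
    from linear_compose[OF this 1] show ?thesis by (simp add: Wr_def[abs_def] o_def)
  qed
  show "smooth_on N (\<lambda>z. Wr \<rho> z v)" for v
    unfolding Wr_def by (rule smooth_on_slice[OF D smooth_formD(2)[OF smooth_Om] r])
qed

lemma smooth_k: "smooth_on N k"
  using smooth_on_mult[OF N smooth_cis[of "-1"] smooth_fst[OF smooth_K]] by (simp add: k_def[abs_def])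

abbreviation "P \<equiv> D \<times> {0::real<..} \<times> (UNIV :: real set)"

lemma P: "open P" using D by (intro open_Times) auto

lemma smooth_P:
  "smooth_on P (\<lambda>y. om y v)" "smooth_on P (\<lambda>y. om1 y v)"
proof -
  have f: "smooth_on P (\<lambda>y. f (fst y))" if "smooth_on D f" for f :: "real^3 \<Rightarrow> 'b::real_normed_vector"
    by (rule smooth_on_compose[OF P smooth_on_bounded_linear[OF P bounded_linear_fst] that]) auto
  have b: "bounded_linear (\<lambda>y::p_space. fst (snd y))" "bounded_linear (\<lambda>y::p_space. snd (snd y))"
    by (auto simp: linear_conv_bounded_linear[symmetric] linear_iff)
  have r: "smooth_on P (\<lambda>y. fst (snd y))" "smooth_on P (\<lambda>y. snd (snd y))"
    by (rule smooth_on_bounded_linear[OF P b(1)], rule smooth_on_bounded_linear[OF P b(2)])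
  show "smooth_on P (\<lambda>y. om y v)"
    unfolding om case_prod_unfold
    by (rule smooth_on_mult[OF P smooth_on_divide[OF P smooth_on_power[OF P r(1)] f[OF smooth_A]] f[OF smooth_formD(2)[OF smooth_L]]])
      (use A_nz in auto)
  show "smooth_on P (\<lambda>y. om1 y v)"
    unfolding om1 case_prod_unfold cis_conv_exp
    by (rule smooth_on_mult[OF P smooth_on_mult[OF P smooth_on_of_real[OF P r(1)] smooth_on_exp[OF P smooth_on_mult[OF P smooth_on_const
        smooth_on_of_real[OF P r(2)]]]] f[OF smooth_formD(2)[OF smooth_Mu]]])
qed

lemma jr_P: "z \<in> N \<Longrightarrow> \<rho> > 0 \<Longrightarrow> jr \<rho> z \<in> P" by (auto simp: jr_def)

text \<open>Pulling back the structure equations to the slice of constant \<rho>. All \<rho> are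
  treated at once, because comparing two slices is what proves \<open>Wr_const\<close>.\<close>

lemma d_slice:
  assumes z: "z \<in> N" and r: "\<rho> > 0"
  shows "ext_d (cplx w) z u v = \<i> * wedge (w1 z) (conj_form w1 z) u v + wedge (\<lambda>p. Wr \<rho> z p + conj_form (Wr \<rho>) z p) (cplx w z) u v"
    and "ext_d w1 z u v = wedge (Wr \<rho> z) (w1 z) u v"
    and "ext_d (Wr \<rho>) z u v = k z / of_real (\<rho> ^ 3) * (of_real \<rho> * of_real (\<rho>\<^sup>2) * wedge (w1 z) (cplx w z) u v)"
proof -
  have z': "fst z \<in> D" using z by auto
  have rr: "complex_of_real \<rho> \<noteq> 0" using r by simp
  have dw: "(\<lambda>y. cplx w y v) differentiable at z" for v
    unfolding cplx_def using smooth_formD(3)[OF smooth_form_linear[OF N bounded_linear_of_real smooth_w] z] .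
  have dw1: "(\<lambda>y. w1 y v) differentiable at z" for v by (rule smooth_formD(3)[OF smooth_w1 z])
  have dom: "(\<lambda>y. cplx om y v) differentiable at (jr \<rho> z)" for v
    unfolding cplx_def by (rule smooth_on_differentiable[OF smooth_on_of_real[OF P smooth_P(1)] jr_P[OF z r]])
  have dom1: "(\<lambda>y. om1 y v) differentiable at (jr \<rho> z)" for v
    by (rule smooth_on_differentiable[OF smooth_P(2) jr_P[OF z r]])
  have dOm: "(\<lambda>y. Om y v) differentiable at (jr \<rho> z)" for v
    by (rule smooth_formD(3)[OF smooth_Om jr_P[OF z r]])
  have c: "cplx om (jr \<rho> z) (jl v) = of_real (\<rho>\<^sup>2) * cplx w z v" for z v by (simp add: cplx_def slice)
  have "of_real (\<rho>\<^sup>2) * ext_d (cplx w) z u v = ext_d (\<lambda>z v. of_real (\<rho>\<^sup>2) * cplx w z v) z u v"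
    by (rule ext_d_linear[OF bounded_linear_mult_right dw, symmetric])
  also have "\<dots> = ext_d (cplx om) (jr \<rho> z) (jl u) (jl v)"
    unfolding ext_d_slice[OF dom, symmetric] c ..
  also have "\<dots> = of_real (\<rho>\<^sup>2) * (\<i> * wedge (w1 z) (conj_form w1 z) u v + wedge (\<lambda>p. Wr \<rho> z p + conj_form (Wr \<rho>) z p) (cplx w z) u v)"
    using d_om[OF z' r, of "snd z" "jl u" "jl v"] slice(2)[of \<rho> z] c[of z]
    by (simp add: jr_def[symmetric] wedge_def conj_form_def Wr_def power2_eq_square algebra_simps)
  finally show "ext_d (cplx w) z u v = \<i> * wedge (w1 z) (conj_form w1 z) u v + wedge (\<lambda>p. Wr \<rho> z p + conj_form (Wr \<rho>) z p) (cplx w z) u v"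
    using rr by simp
  have "of_real \<rho> * ext_d w1 z u v = ext_d (\<lambda>z v. of_real \<rho> * w1 z v) z u v"
    by (rule ext_d_linear[OF bounded_linear_mult_right dw1, symmetric])
  also have "\<dots> = ext_d om1 (jr \<rho> z) (jl u) (jl v)"
    unfolding ext_d_slice[OF dom1, symmetric] slice ..
  also have "\<dots> = of_real \<rho> * wedge (Wr \<rho> z) (w1 z) u v"
    using d_om1[OF z' r, of "snd z" "jl u" "jl v"] slice(2)[of \<rho> z]
    by (simp add: jr_def[symmetric] wedge_def Wr_def algebra_simps)
  finally show "ext_d w1 z u v = wedge (Wr \<rho> z) (w1 z) u v" using rr by simp
  have "ext_d (Wr \<rho>) z u v = ext_d Om (jr \<rho> z) (jl u) (jl v)"
    unfolding Wr_def[abs_def] by (rule ext_d_slice[OF dOm])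
  then show "ext_d (Wr \<rho>) z u v = k z / of_real (\<rho> ^ 3) * (of_real \<rho> * of_real (\<rho>\<^sup>2) * wedge (w1 z) (cplx w z) u v)"
    using d_Om[OF z' r, of "snd z" "jl u" "jl v"] slice(2)[of \<rho> z] c[of z]
    by (simp add: jr_def[symmetric] wedge_def k_def algebra_simps)
qed

lemma linear_P:
  assumes y: "y \<in> P" shows "linear (om y)" "linear (om1 y)" "linear (Om y)"
proof -
  have "fst y \<in> D" using y by auto
  note smooth_formD(1)[OF smooth_L this] smooth_formD(1)[OF smooth_Mu this]
  then show "linear (om y)" "linear (om1 y)"
    unfolding om om1 case_prod_unfold by (simp_all add: linear_iff algebra_simps add_divide_distrib)
  show "linear (Om y)" by (rule smooth_formD(1)[OF smooth_Om y])
qed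

lemma dual_vectors_P:
  assumes y: "y \<in> P" obtains v where "om y v = p" "om1 y v = q" "Om y v = r"
proof -
  define F where "F v = (om y v, om1 y v, Om y v)" for v
  note lin = linear_P[OF y]
  have F: "linear F"
    by (rule linearI) (simp_all add: F_def linear_add[OF lin(1)] linear_add[OF lin(2)] linear_add[OF lin(3)]
        linear_scale[OF lin(1)] linear_scale[OF lin(2)] linear_scale[OF lin(3)])
  have "inj F"
    unfolding linear_injective_0[OF F]
  proof (intro allI impI)
    show "v = 0" if "F v = 0" for v
      using nondeg[of "fst y" "fst (snd y)" "snd (snd y)" v] that y by (simp add: F_def zero_prod_def mem_Times_iff)
  qed
  then have "dim (range F) = dim (UNIV :: p_space set)"
    by (intro dim_image_eq[OF F]) simp
  then have "dim (range F) = DIM(real \<times> complex \<times> complex)" by simp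
  then have "span (range F) = UNIV" by (simp only: dim_eq_full)
  moreover have "span (range F) = range F"
    by (rule span_subspace[OF subset_refl span_superset]) (rule linear_subspace_image[OF F subspace_UNIV])
  ultimately have "range F = UNIV" by simp
  then obtain v where "F v = (p, q, r)" by (metis rangeE UNIV_I)
  then show ?thesis using that[of v] by (simp add: F_def)
qed

lemma dual_vectors_N:
  assumes z: "z \<in> N" obtains v where "w z v = p" "w1 z v = q"
proof -
  obtain y where y: "om (jr 1 z) y = p" "om1 (jr 1 z) y = q" "Om (jr 1 z) y = 0"
    by (rule dual_vectors_P[OF jr_P[OF z zero_less_one]])
  show ?thesis
    by (rule that[of "(fst y, 0)"]) (use y in \<open>simp_all add: om om1 jr_def w_def w1_def\<close>)
qed

text \<open>Contract the equation for the differential of \<open>om1\<close> with the \<rho>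
  direction: \<open>om1\<close> is linear in \<rho> and annihilates that direction, so the left side
  is \<open>om1\<close> divided by \<rho> and the right side is the value of \<open>Om\<close> times
  \<open>om1\<close>.\<close>

lemma Om_rho:
  assumes y: "y \<in> P" shows "Om y (0, 1, 0) = 1 / of_real (fst (snd y))"
proof -
  obtain x r p where yy: "y = (x, r, p)" by (cases y)
  have x: "x \<in> D" and r: "r > 0" using y yy by auto
  obtain v where v: "om y v = 0" "om1 y v = 1" "Om y v = 0" by (rule dual_vectors_P[OF y])
  have d: "(\<lambda>y. om1 y v) differentiable at y" for v by (rule smooth_on_differentiable[OF smooth_P(2) y])
  have "((\<lambda>s. om1 (y + s *\<^sub>R (0, 1, 0)) v) has_vector_derivative cis p * Mu x (fst v)) (at 0)"
    unfolding om1 yy by (auto intro!: derivative_eq_intros)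
  from vector_derivative_unique_at[OF this frechet_derivative_line[OF d]]
  have 1: "frechet_derivative (\<lambda>y. om1 y v) (at y) (0, 1, 0) = cis p * Mu x (fst v)" by simp
  have "om1 y' (0, 1, 0) = 0" if "y' \<in> P" for y'
    using linear_0[OF smooth_formD(1)[OF smooth_Mu, of "fst y'"]] that by (auto simp: om1 case_prod_unfold)
  then have "frechet_derivative (\<lambda>y. om1 y (0, 1, 0)) (at y) v = frechet_derivative (\<lambda>y. 0) (at y) v"
    by (intro fun_cong[OF frechet_derivative_cong_open[OF P y]])
  then have "ext_d om1 y (0, 1, 0) v = cis p * Mu x (fst v)"
    by (simp add: ext_d_def 1 frechet_derivative_const)
  moreover have "om1 y (0, 1, 0) = 0"
    using linear_0[OF smooth_formD(1)[OF smooth_Mu x]] by (simp add: om1 yy)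
  then have "ext_d om1 y (0, 1, 0) v = Om y (0, 1, 0)"
    using d_om1[OF x r, of p "(0, 1, 0)" v] v by (simp add: yy wedge_def)
  moreover have "of_real r * (cis p * Mu x (fst v)) = 1" using v(2) by (simp add: om1 yy mult.assoc)
  ultimately show ?thesis using r by (simp add: yy field_simps)
qed

text \<open>The structure equations determine \<Omega> on a slice. The difference \<Delta> of two
  slices satisfies \<Delta> \<and> w1 = 0, so it is a multiple of \<open>w1\<close>, and its real
  part is proportional to \<open>w\<close>; a complex multiple of \<open>w1\<close> with this
  property is zero.\<close>

lemma Wr_const:
  assumes z: "z \<in> N" and r: "\<rho> > 0" shows "Wr \<rho> z v = Wr 1 z v"
proof -
  define \<Delta> where "\<Delta> v = Wr \<rho> z v - Wr 1 z v" for v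
  have 1: "\<Delta> u * w1 z v = \<Delta> v * w1 z u" for u v
    using d_slice(2)[OF z r, of u v] d_slice(2)[OF z zero_less_one, of u v]
    by (simp add: \<Delta>_def wedge_def algebra_simps)
  have 2: "(\<Delta> u + cnj (\<Delta> u)) * of_real (w z v) = (\<Delta> v + cnj (\<Delta> v)) * of_real (w z u)" for u v
    using d_slice(1)[OF z r, of u v] d_slice(1)[OF z zero_less_one, of u v]
    by (simp add: \<Delta>_def wedge_def cplx_def conj_form_def algebra_simps)
  obtain u0 where u0: "w z u0 = 0" "w1 z u0 = 1" by (rule dual_vectors_N[OF z])
  obtain u1 where u1: "w z u1 = 0" "w1 z u1 = \<i>" by (rule dual_vectors_N[OF z])
  obtain u2 where u2: "w z u2 = 1" "w1 z u2 = 0" by (rule dual_vectors_N[OF z])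
  have \<Delta>: "\<Delta> v = \<Delta> u0 * w1 z v" for v using 1[of v u0] u0 by simp
  have "\<Delta> u0 + cnj (\<Delta> u0) = 0" "\<Delta> u1 + cnj (\<Delta> u1) = 0"
    using 2[of u0 u2] 2[of u1 u2] u0 u1 u2 by simp_all
  then have "Re (\<Delta> u0) = 0" "Re (\<Delta> u1) = 0" by (simp_all add: complex_eq_iff)
  then have "\<Delta> u0 = 0" using \<Delta>[of u1] u1 by (simp add: complex_eq_iff)
  then show ?thesis using \<Delta>[of v] by (simp add: \<Delta>_def)
qed

text \<open>The structure equations are \<open>d_slice\<close> at \<rho> = 1. Independence of the
  four real forms follows from nondegeneracy on P.\<close>

lemma conf_frame_slice: "conf_frame N w w1 (Wr 1) k"
proof
  show "open N" "smooth_form N w" "smooth_form N w1" "smooth_form N (Wr 1)" "smooth_on N k"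
    by (rule N smooth_w smooth_w1 smooth_Wr[OF zero_less_one] smooth_k)+
  fix z u v assume z: "z \<in> N"
  show "ext_d (cplx w) z u v = \<i> * wedge (w1 z) (conj_form w1 z) u v + wedge (\<lambda>p. Wr 1 z p + conj_form (Wr 1) z p) (cplx w z) u v"
    by (rule d_slice(1)[OF z zero_less_one])
  show "ext_d w1 z u v = wedge (Wr 1 z) (w1 z) u v" by (rule d_slice(2)[OF z zero_less_one])
  show "ext_d (Wr 1) z u v = k z * wedge (w1 z) (cplx w z) u v" using d_slice(3)[OF z zero_less_one] by simp
next
  fix z v assume z: "z \<in> N" and h: "w z v = 0" "w1 z v = 0" "Im (Wr 1 z v) = 0"
  \<comment> \<open>A multiple of the \<rho> direction is added to cancel the real part of \<Omega>,
    without changing \<open>om\<close> and \<open>om1\<close>; nondegeneracy on the five-dimensional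
    P then applies.\<close>
  define p where "p = jl v + (- Re (Wr 1 z v)) *\<^sub>R (0, 1, 0)"
  note y = jr_P[OF z zero_less_one]
  have "Om (jr 1 z) p = 0"
    unfolding p_def linear_add[OF linear_P(3)[OF y]] linear_scale[OF linear_P(3)[OF y]] Om_rho[OF y]
    using h(3) by (simp add: jr_def Wr_def[symmetric] complex_eq_iff) (simp add: Wr_def jr_def)
  moreover have "om (jr 1 z) p = om (jr 1 z) (jl v)" "om1 (jr 1 z) p = om1 (jr 1 z) (jl v)"
    by (simp_all add: om om1 jr_def p_def jl_def)
  ultimately have "p = 0" using nondeg[of "fst z" 1 "snd z" p] z h slice[of 1 z v] by (auto simp: jr_def)
  then show "v = 0" by (simp add: p_def jl_def prod_eq_iff)
qed

text \<open>The \<rho> component of \<Omega> is real and its restriction to slices does not depend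
  on \<rho>, so the imaginary part is basic for the projection to N. This is why G descends up to
  the factor \<rho>^2.\<close>

lemma Im_Om:
  assumes y: "y \<in> P" shows "Im (Om y u) = Im (Wr 1 (proj_n y) (proj_n u))"
proof -
  obtain x r p where yy: "y = (x, r, p)" by (cases y)
  have r: "r > 0" and z: "(x, p) \<in> N" using y yy by auto
  have u: "u = jl (proj_n u) + fst (snd u) *\<^sub>R (0, 1, 0)"
    by (cases u) (simp add: jl_def proj_n_def)
  have "Om y u = Om y (jl (proj_n u) + fst (snd u) *\<^sub>R (0, 1, 0))" by (rule arg_cong[OF u])
  also have "\<dots> = Om y (jl (proj_n u)) + fst (snd u) *\<^sub>R Om y (0, 1, 0)"
    by (simp only: linear_add[OF linear_P(3)[OF y]] linear_scale[OF linear_P(3)[OF y]])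
  also have "Om y (jl (proj_n u)) = Wr r (x, p) (proj_n u)" by (simp add: Wr_def jr_def yy)
  also have "Om y (0, 1, 0) = 1 / of_real r" unfolding Om_rho[OF y] by (simp add: yy)
  finally have *: "Om y u = Wr r (x, p) (proj_n u) + fst (snd u) *\<^sub>R (1 / of_real r)" .
  have "1 / complex_of_real r = of_real (1 / r)" by simp
  then have "Im (fst (snd u) *\<^sub>R (1 / complex_of_real r)) = 0" by (simp only: scaleR_complex.simps Im_complex_of_real mult_zero_right)
  then show ?thesis unfolding * by (simp add: Wr_const[OF z r] yy proj_n_def)
qed

end

section \<open>The conformal classes\<close>

lemma smooth_on_vec4:
  fixes f :: "'a::real_normed_vector \<Rightarrow> real^4"
  assumes "open S" "smooth_on S (\<lambda>x. f x $ 1)" "smooth_on S (\<lambda>x. f x $ 2)" "smooth_on S (\<lambda>x. f x $ 3)" "smooth_on S (\<lambda>x. f x $ 4)"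
  shows "smooth_on S f"
proof (rule smooth_on_vec[OF assms(1)])
  show "smooth_on S (\<lambda>x. f x $ i)" for i
    using exhaust_4[of i] assms by auto
qed

lemma sym_prod_identity:
  "2 * ((of_real r * b * cnj (of_real r * b') + cnj (of_real r * b) * (of_real r * b')) / 2)
     + 2 * of_real t * \<i> * ((of_real (r\<^sup>2 * a) * (- 2 * \<i> * of_real p') + - 2 * \<i> * of_real p * of_real (r\<^sup>2 * a')) / 2)
   = complex_of_real (r\<^sup>2 * (2 * Re (b * cnj b') + 2 * t * (a * p' + a' * p)))"
  by (simp add: complex_eq_iff power2_eq_square field_simps)

context oc_chart
begin

definition g0 :: "real \<Rightarrow> metric" where
  "g0 t z u v = 2 * Re (w1 z u * cnj (w1 z v)) + 2 * t * (w z u * Im (Wr 1 z v) + w z v * Im (Wr 1 z u))"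

lemma G_eq:
  assumes y: "y \<in> P"
  shows "2 * sym_prod (om1 y) (conj_form om1 y) u v
      + 2 * of_real t * \<i> * sym_prod (cplx om y) (\<lambda>z. conj_form Om y z - Om y z) u v
    = of_real ((fst (snd y))\<^sup>2 * g0 t (proj_n y) (proj_n u) (proj_n v))"
proof -
  obtain x r p where yy: "y = (x, r, p)" by (cases y)
  have o: "om y u = r\<^sup>2 * w (proj_n y) (proj_n u)" "om1 y u = of_real r * w1 (proj_n y) (proj_n u)" for u
    by (simp_all add: om om1 yy proj_n_def w_def w1_def case_prod_unfold)
  have c: "conj_form Om y u - Om y u = - 2 * \<i> * of_real (Im (Wr 1 (proj_n y) (proj_n u)))" for u
    unfolding Im_Om[OF y, symmetric] by (simp add: conj_form_def complex_eq_iff)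
  have r: "fst (snd y) = r" by (simp add: yy)
  show ?thesis
    unfolding sym_prod_def c cplx_def conj_form_def[of om1] o r g0_def by (rule sym_prod_identity)
qed

lemma linear_N:
  assumes z: "z \<in> N" shows "linear (w z)" "linear (w1 z)" "linear (Wr 1 z)"
  by (rule smooth_formD(1)[OF smooth_w z], rule smooth_formD(1)[OF smooth_w1 z],
      rule smooth_formD(1)[OF smooth_Wr[OF zero_less_one] z])

lemma smooth_bilinear_g0: "smooth_bilinear_on N (g0 t)"
  unfolding smooth_bilinear_on_def
proof (intro conjI ballI allI)
  fix z assume z: "z \<in> N"
  note l = linear_N[OF z]
  note a = linear_add[OF l(1)] linear_add[OF l(2)] linear_add[OF l(3)] linear_scale[OF l(1)] linear_scale[OF l(2)] linear_scale[OF l(3)]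
  show "bilinear (g0 t z)"
    unfolding bilinear_def linear_iff g0_def a by (simp add: algebra_simps)
  show "g0 t z u v = g0 t z v u" for u v by (simp add: g0_def algebra_simps)
next
  fix u v
  note I = smooth_formD(2)[OF smooth_w] smooth_formD(2)[OF smooth_w1] smooth_on_Im[OF N smooth_formD(2)[OF smooth_Wr[OF zero_less_one]]]
  show "smooth_on N (\<lambda>z. g0 t z u v)"
    unfolding g0_def
    by (rule smooth_on_add[OF N smooth_on_mult[OF N smooth_on_const smooth_on_Re[OF N smooth_on_mult[OF N I(2) smooth_on_cnj[OF N I(2)]]]]
        smooth_on_mult[OF N smooth_on_const smooth_on_add[OF N smooth_on_mult[OF N I(1) I(3)] smooth_on_mult[OF N I(1) I(3)]]]])
qed

text \<open>Testing against the dual vectors reads off all components of v: the metric pairs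
  \<open>w\<close> with the imaginary part of \<open>W\<close> and is definite on
  \<open>w1\<close>.\<close>

lemma g0_nondegenerate:
  assumes z: "z \<in> N" and t: "t \<noteq> 0" and 0: "\<And>u. g0 t z v u = 0" shows "v = 0"
proof -
  interpret conf_frame N w w1 "Wr 1" k by (rule conf_frame_slice)
  obtain a where a: "w z a = 0" "w1 z a = w1 z v" "Im (Wr 1 z a) = 0" by (rule dual_vectors[OF z])
  obtain b where b: "w z b = 0" "w1 z b = 0" "Im (Wr 1 z b) = 1" by (rule dual_vectors[OF z])
  obtain c where c: "w z c = 1" "w1 z c = 0" "Im (Wr 1 z c) = 0" by (rule dual_vectors[OF z])
  have "2 * ((Re (w1 z v))\<^sup>2 + (Im (w1 z v))\<^sup>2) = 0" using 0[of a] a by (simp add: g0_def power2_eq_square)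
  then have "(Re (w1 z v))\<^sup>2 + (Im (w1 z v))\<^sup>2 = 0" by (metis mult_eq_0_iff zero_neq_numeral)
  then have "w1 z v = 0" by (simp add: sum_power2_eq_zero_iff complex_eq_iff)
  moreover have "w z v = 0" "Im (Wr 1 z v) = 0" using 0[of b] 0[of c] b c t by (simp_all add: g0_def)
  ultimately show "v = 0" using inj[OF z] by blast
qed

end

locale oc_class = oc_chart D A L Mu Om K om om1 for D A L Mu Om K om om1 +
  fixes t :: real and C :: "n_space set \<Rightarrow> metric set"
  assumes t: "t \<noteq> 0"
    and C: "\<And>V g. V \<subseteq> N \<Longrightarrow> g \<in> C V \<longleftrightarrow> smooth_bilinear_on V g \<and>
      (\<exists>F. \<forall>z\<in>V. F z > 0 \<and> (\<forall>u v. g z u v = F z * g0 t z u v))"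
begin

text \<open>Any metric of the class is g0 rescaled by a positive factor \<open>F\<close>, which is
  the effect of \<open>conf_frame_rescale\<close> with f = (ln F)/2. The new coframe has the same
  zeros of k and expresses exactly the given metric.\<close>

lemma gauge_adapted:
  assumes gauge: "cartan_gauge C V \<eta> \<theta> e \<Gamma>" and VN: "V \<subseteq> N"
  obtains w' w1' W' k' where "adapted_frame V w' w1' W' k' t \<eta> \<theta> e" "\<And>z. k' z = 0 \<longleftrightarrow> k z = 0" "levi_civita V \<eta> \<theta> \<Gamma>"
proof -
  from gauge obtain g where V: "open V" and g: "g \<in> C V" and ad: "adapted_coframe V g \<eta> \<theta> e" and lc: "levi_civita V \<eta> \<theta> \<Gamma>"
    unfolding cartan_gauge_def by blast
  from g[unfolded C[OF VN]] obtain F where sg: "smooth_bilinear_on V g"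
    and F: "\<And>z. z \<in> V \<Longrightarrow> F z > 0" "\<And>z u v. z \<in> V \<Longrightarrow> g z u v = F z * g0 t z u v" by blast
  have smooth_g0: "smooth_on V (\<lambda>z. g0 t z u v)" for u v
    using smooth_bilinear_g0[of t] smooth_on_subset[OF _ VN] unfolding smooth_bilinear_on_def by blast
  have smooth_F: "smooth_on V F"
  proof (rule smooth_on_local)
    fix z assume z: "z \<in> V"
    then have "z \<in> N" using VN by blast
    then obtain u where u: "w z u = 0" "w1 z u = 1" by (rule dual_vectors_N)
    \<comment> \<open>The class only provides a positive factor \<open>F\<close>; its smoothness is
      local, as the quotient of two smooth functions at a fixed vector on which g0 does not vanish
      nearby.\<close>
    define U where "U = V \<inter> (\<lambda>z. g0 t z u u) -` (- {0})"
    have U: "open U" unfolding U_def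
      by (rule continuous_open_preimage[OF smooth_on_continuous_on[OF smooth_g0] V open_Compl[OF closed_singleton]])
    have "smooth_on U F"
    proof (rule smooth_on_cong[OF U])
      have "U \<subseteq> V" by (auto simp: U_def)
      have "smooth_on V (\<lambda>z. g z u u)" using sg unfolding smooth_bilinear_on_def by blast
      then show "smooth_on U (\<lambda>z. g z u u / g0 t z u u)"
        by (rule smooth_on_divide[OF U smooth_on_subset[OF _ \<open>U \<subseteq> V\<close>] smooth_on_subset[OF smooth_g0 \<open>U \<subseteq> V\<close>]]) (simp add: U_def)
      show "g z u u / g0 t z u u = F z" if "z \<in> U" for z
        using that F(2)[of z u u] by (auto simp: U_def)
    qed
    moreover have "z \<in> U" using z u by (simp add: U_def g0_def)
    ultimately show "\<exists>U. z \<in> U \<and> smooth_on U F" by blast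
  qed
  define f where "f z = ln (F z) / 2" for z
  have f: "smooth_on V f"
    unfolding f_def divide_inverse by (rule smooth_on_mult[OF V smooth_on_ln[OF V smooth_F F(1)] smooth_on_const])
  interpret conf_frame V w w1 "Wr 1" k by (rule conf_frame.conf_frame_subset[OF conf_frame_slice V VN])
  let ?w = "\<lambda>x v. exp (2 * f x) * w x v" and ?w1 = "\<lambda>x v. of_real (exp (f x)) * w1 x v"
    and ?W = "\<lambda>x v. Wr 1 x v + of_real (frechet_derivative f (at x) v)" and ?k = "\<lambda>x. of_real (exp (- 3 * f x)) * k x"
  interpret r: conf_frame V ?w ?w1 ?W ?k by (rule conf_frame_rescale[OF f])
  have "adapted_frame V ?w ?w1 ?W ?k t \<eta> \<theta> e"
  proof
    show "t \<noteq> 0" by (rule t)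
    show "transpose \<eta> = \<eta>" "\<And>i. smooth_form V (\<theta> i)" "\<And>x i j. x \<in> V \<Longrightarrow> \<theta> i x (e j x) = (if i = j then 1 else 0)"
      using ad unfolding adapted_coframe_def by blast+
    fix x u v assume x: "x \<in> V"
    have e2: "exp (2 * f x) = F x" using F(1)[OF x] by (simp add: f_def)
    have e1: "exp (f x) * exp (f x) = F x" using e2 by (simp add: exp_add[symmetric])
    have "(\<Sum>i\<in>UNIV. \<Sum>j\<in>UNIV. \<eta> $ i $ j * \<theta> i x u * \<theta> j x v) = F x * g0 t x u v"
    proof -
      have "g x u v = (\<Sum>i\<in>UNIV. \<Sum>j\<in>UNIV. \<eta> $ i $ j * \<theta> i x u * \<theta> j x v)"
        using ad x unfolding adapted_coframe_def by blast
      with F(2)[OF x, of u v] show ?thesis by simp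
    qed
    also have "\<dots> = 2 * ((exp (f x) * exp (f x)) * Re (w1 x u * cnj (w1 x v)))
        + 2 * t * (F x * w x u * Im (Wr 1 x v) + F x * w x v * Im (Wr 1 x u))"
      unfolding e1 g0_def by (simp add: algebra_simps)
    also have "\<dots> = 2 * Re (?w1 x u * cnj (?w1 x v)) + 2 * t * (?w x u * Im (?W x v) + ?w x v * Im (?W x u))"
      unfolding e2 by (simp add: algebra_simps)
    finally show "(\<Sum>i\<in>UNIV. \<Sum>j\<in>UNIV. \<eta> $ i $ j * \<theta> i x u * \<theta> j x v)
      = 2 * Re (?w1 x u * cnj (?w1 x v)) + 2 * t * (?w x u * Im (?W x v) + ?w x v * Im (?W x u))" .
  qed
  then show ?thesis by (rule that) (simp_all add: lc)
qed

lemma bach_class: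
  assumes "t = 1 \<or> t = -1/3" shows "bach_condition C N"
  unfolding bach_condition_def Let_def
proof (intro allI impI ballI)
  fix V \<eta> \<theta> e \<Gamma> x u v z
  assume V: "V \<subseteq> N" and g: "cartan_gauge C V \<eta> \<theta> e \<Gamma>" and x: "x \<in> V"
  obtain w' w1' W' k' where a: "adapted_frame V w' w1' W' k' t \<eta> \<theta> e" and lc: "levi_civita V \<eta> \<theta> \<Gamma>"
    by (rule gauge_adapted[OF g V])
  show "cov_d2 (normal_connection \<eta> \<theta> e \<Gamma>) (hodge \<eta> \<theta> e (conn_curvature (normal_connection \<eta> \<theta> e \<Gamma>))) x u v z = 0"
    by (rule adapted_frame.bach_adapted[OF a lc x assms])
qed

lemma curvature_vanishes_class:
  assumes "\<And>z. z \<in> N \<Longrightarrow> k z = 0" shows "curvature_vanishes C N"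
  unfolding curvature_vanishes_def
proof (intro allI impI ballI)
  fix V \<eta> \<theta> e \<Gamma> x u v
  assume V: "V \<subseteq> N" and g: "cartan_gauge C V \<eta> \<theta> e \<Gamma>" and x: "x \<in> V"
  obtain w' w1' W' k' where a: "adapted_frame V w' w1' W' k' t \<eta> \<theta> e" and k: "\<And>z. k' z = 0 \<longleftrightarrow> k z = 0" and lc: "levi_civita V \<eta> \<theta> \<Gamma>"
    using gauge_adapted[OF g V] by blast
  show "conn_curvature (normal_connection \<eta> \<theta> e \<Gamma>) x u v = 0"
    by (rule adapted_frame.curvature_zero_adapted[OF a lc x]) (use k assms V in blast)
qed

lemma not_cotton_class:
  assumes t1: "t = 1 \<or> t = -1/3" and V: "open V" and VN: "V \<subseteq> N" and z: "z \<in> V" "k z \<noteq> 0"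
  shows "\<not> cotton_condition C V"
proof
  assume cotton: "cotton_condition C V"
  interpret conf_frame V w w1 "Wr 1" k by (rule conf_frame.conf_frame_subset[OF conf_frame_slice V VN])
  \<comment> \<open>An explicit gauge is needed to contradict a universally quantified condition.
    The real and imaginary parts of \<open>w1\<close> each have square 2, while \<open>w\<close> and
    the imaginary part of \<Omega> form a null pair.\<close>
  define \<eta> :: "real^4^4" where "\<eta> = (\<chi> i j. if i = 1 \<and> j = 1 \<or> i = 2 \<and> j = 2 then 2
    else if i = 3 \<and> j = 4 \<or> i = 4 \<and> j = 3 then 2 * t else 0)"
  define \<theta> :: "4 \<Rightarrow> (n_space, real) form1" where "\<theta> i = (if i = 1 then (\<lambda>x v. Re (w1 x v)) else if i = 2 then (\<lambda>x v. Im (w1 x v))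
    else if i = 3 then w else (\<lambda>x v. Im (Wr 1 x v)))" for i
  define e :: "4 \<Rightarrow> n_space \<Rightarrow> n_space" where "e j x = (SOME v. w x v = (if j = 3 then 1 else 0) \<and>
     w1 x v = (if j = 1 then 1 else if j = 2 then \<i> else 0) \<and> Im (Wr 1 x v) = (if j = 4 then 1 else 0))" for j x
  have e: "w x (e j x) = (if j = 3 then 1 else 0) \<and>
     w1 x (e j x) = (if j = 1 then 1 else if j = 2 then \<i> else 0) \<and> Im (Wr 1 x (e j x)) = (if j = 4 then 1 else 0)" if x: "x \<in> V" for j x
  proof -
    obtain v where "w x v = (if j = 3 then 1 else 0)" "w1 x v = (if j = 1 then 1 else if j = 2 then \<i> else 0)"
      "Im (Wr 1 x v) = (if j = 4 then 1 else 0)"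
      by (rule dual_vectors[OF x])
    then show ?thesis unfolding e_def by (rule someI[of _ v, OF conjI[OF _ conjI]])
  qed
  have dual: "\<theta> i x (e j x) = (if i = j then 1 else 0)" if "x \<in> V" for i j x
    using e[OF that, of j] exhaust_4[of i] exhaust_4[of j] by (auto simp: \<theta>_def)
  have s\<theta>: "smooth_form V (\<theta> i)" for i
    unfolding \<theta>_def
    using smooth_form_linear[OF V bounded_linear_Re smooth_w1] smooth_form_linear[OF V bounded_linear_Im smooth_w1]
      smooth_form_linear[OF V bounded_linear_Im smooth_W] smooth_w by simp
  have tr: "transpose \<eta> = \<eta>" by (simp add: \<eta>_def transpose_def vec_eq_iff forall_4)
  have g: "(\<Sum>i\<in>UNIV. \<Sum>j\<in>UNIV. \<eta> $ i $ j * \<theta> i x u * \<theta> j x v) = g0 t x u v" for x u v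
    by (simp add: sum_4 \<eta>_def \<theta>_def g0_def algebra_simps)
  have a: "adapted_frame V w w1 (Wr 1) k t \<eta> \<theta> e"
  proof
    show "t \<noteq> 0" by (rule t)
    show "transpose \<eta> = \<eta>" "\<And>i. smooth_form V (\<theta> i)" "\<And>x i j. x \<in> V \<Longrightarrow> \<theta> i x (e j x) = (if i = j then 1 else 0)"
      by (rule tr s\<theta> dual)+
    show "(\<Sum>i\<in>UNIV. \<Sum>j\<in>UNIV. \<eta> $ i $ j * \<theta> i x u * \<theta> j x v)
      = 2 * Re (w1 x u * cnj (w1 x v)) + 2 * t * (w x u * Im (Wr 1 x v) + w x v * Im (Wr 1 x u))" for x u v
      unfolding g g0_def ..
  qed
  define \<Gamma> where "\<Gamma> i j x v = Re (adapted_frame.Gam w w1 (Wr 1) k t \<eta> \<theta> i j x v)" for i j x v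
  have lc: "levi_civita V \<eta> \<theta> \<Gamma>"
    using adapted_frame.levi_civita_Re_Gam[OF a] unfolding \<Gamma>_def[abs_def] .
  have "smooth_bilinear_on V (g0 t)"
    using smooth_bilinear_g0[of t] VN smooth_on_subset[OF _ VN] unfolding smooth_bilinear_on_def by blast
  then have "g0 t \<in> C V" unfolding C[OF VN] by (intro conjI exI[of _ "\<lambda>_. 1"] ballI allI) simp_all
  moreover have "adapted_coframe V (g0 t) \<eta> \<theta> e"
    unfolding adapted_coframe_def by (intro conjI ballI allI tr s\<theta> dual g[symmetric])
  ultimately have "open V \<and> (\<exists>g\<in>C V. adapted_coframe V g \<eta> \<theta> e) \<and> levi_civita V \<eta> \<theta> \<Gamma>" by (intro conjI bexI V lc)
  then have "cartan_gauge C V \<eta> \<theta> e \<Gamma>" by (simp only: cartan_gauge_def)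
  note gauge = this
  let ?F = "conn_curvature (normal_connection \<eta> \<theta> e \<Gamma>)"
  show False
  proof (rule adapted_frame.cotton_adapted[OF a lc z(1) t1 z(2)])
    fix i j m l
    have "dual_part 1 \<eta> \<theta> e ?F z (e i z) (e j z) ** dual_part (-1) \<eta> \<theta> e ?F z (e m z) (e l z)
      - dual_part (-1) \<eta> \<theta> e ?F z (e m z) (e l z) ** dual_part 1 \<eta> \<theta> e ?F z (e i z) (e j z) = 0"
      by (rule cotton[unfolded cotton_condition_def Let_def, rule_format, OF subset_refl gauge z(1)])
    then show "dual_part 1 \<eta> \<theta> e ?F z (e i z) (e j z) ** dual_part (-1) \<eta> \<theta> e ?F z (e m z) (e l z)
      = dual_part (-1) \<eta> \<theta> e ?F z (e m z) (e l z) ** dual_part 1 \<eta> \<theta> e ?F z (e i z) (e j z)"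
      by (simp only: right_minus_eq)
  qed
qed

end

section \<open>Curvature of a closed coframe\<close>

lemma flat_connection_curvature:
  assumes V: "open V" and x: "x \<in> V" and \<eta>: "transpose \<eta> = \<eta>" and \<theta>: "\<And>i. smooth_form V (\<theta> i)"
    and closed: "\<And>i x u v. x \<in> V \<Longrightarrow> ext_d (\<theta> i) x u v = 0"
  shows "conn_curvature (normal_connection \<eta> \<theta> e (\<lambda>i j x v. 0)) x u v = 0"
proof -
  let ?\<Gamma> = "\<lambda>i j x v. 0 :: real"
  have "ext_d (\<lambda>x v. 0 :: real) x u v = 0" for x :: n_space and u v by (simp add: ext_d_def frechet_derivative_const)
  then have "ricci e ?\<Gamma> j l x = 0" for j l x
    by (simp add: ricci_def curv_form_def wedge_def)
  then have "schouten \<eta> \<theta> e ?\<Gamma> j x v = 0" for j x v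
    by (simp add: schouten_def scalar_curv_def)
  then have A: "normal_connection \<eta> \<theta> e ?\<Gamma> = (\<lambda>x v. blk 0 0 0 (\<chi> i. of_real (\<theta> i x v)) 0 0 0 (\<chi> j. \<Sum>i\<in>UNIV. of_real (\<eta> $ i $ j * \<theta> i x v)) 0)"
    by (simp add: fun_eq_iff mat6_eq_iff all_idx6 normal_connection_def)
  let ?A = "\<lambda>x v. blk 0 0 0 (\<chi> i. of_real (\<theta> i x v)) 0 0 0 (\<chi> j. \<Sum>i\<in>UNIV. of_real (\<eta> $ i $ j * \<theta> i x v)) 0"
  have c\<theta>: "smooth_form V (\<lambda>x v. complex_of_real (\<theta> i x v))" for i
    by (rule smooth_form_linear[OF V bounded_linear_of_real \<theta>])
  have l\<theta>: "smooth_form V (\<lambda>x v. \<Sum>i\<in>UNIV. complex_of_real (\<eta> $ i $ j * \<theta> i x v))" for j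
    unfolding of_real_mult by (rule smooth_form_sum[OF V], rule smooth_form_const_mult[OF V c\<theta>])
  have "\<forall>r s. smooth_form V (\<lambda>x v. ?A x v $ r $ s)"
    by (simp add: all_idx6 c\<theta> l\<theta>[simplified] smooth_form_zero[OF V])
  then have sA: "smooth_form V ?A"
    by (intro smooth_form_vec[OF V]) blast
  have e1: "ext_d (\<lambda>x v. complex_of_real (\<theta> i x v)) x u v = 0" for i
    by (simp only: ext_d_linear[OF bounded_linear_of_real smooth_formD(3)[OF \<theta> x]] closed[OF x] of_real_0)
  have "ext_d (\<lambda>x v. \<Sum>i\<in>UNIV. complex_of_real (\<eta> $ i $ j * \<theta> i x v)) x u v = 0" for j
  proof -
    have "frechet_derivative (\<lambda>x. \<Sum>i\<in>UNIV. complex_of_real (\<eta> $ i $ j * \<theta> i x v)) (at x) u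
        = (\<Sum>i\<in>UNIV. of_real (\<eta> $ i $ j * frechet_derivative (\<lambda>x. \<theta> i x v) (at x) u))" for u v
    proof (rule fun_cong[OF frechet_derivative_at[symmetric]], rule has_derivative_sum)
      fix i
      have "((\<lambda>x. \<theta> i x v) has_derivative frechet_derivative (\<lambda>x. \<theta> i x v) (at x)) (at x)"
        by (rule smooth_on_has_derivative[OF smooth_formD(2)[OF \<theta>] x])
      then show "((\<lambda>x. complex_of_real (\<eta> $ i $ j * \<theta> i x v)) has_derivative
          (\<lambda>u. of_real (\<eta> $ i $ j * frechet_derivative (\<lambda>x. \<theta> i x v) (at x) u))) (at x)"
        by (intro bounded_linear.has_derivative[OF bounded_linear_of_real] has_derivative_mult_right)
    qed
    moreover have "frechet_derivative (\<lambda>x. \<theta> i x v) (at x) u = frechet_derivative (\<lambda>x. \<theta> i x u) (at x) v" for i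
      using closed[OF x, of i u v] by (simp add: ext_d_def)
    ultimately show ?thesis by (simp add: ext_d_def)
  qed
  note e2 = this
  have e0: "ext_d (\<lambda>x v. 0 :: complex) x u v = 0" by (simp add: ext_d_def frechet_derivative_const)
  have "\<eta> $ i $ j = \<eta> $ j $ i" for i j
    using arg_cong[OF \<eta>, of "\<lambda>M. M $ j $ i"] by (simp add: transpose_def)
  note eta = this
  have sym: "(\<Sum>j\<in>UNIV. (\<Sum>i\<in>UNIV. of_real (\<eta> $ i $ j * \<theta> i x u)) * complex_of_real (\<theta> j x v))
      = (\<Sum>j\<in>UNIV. (\<Sum>i\<in>UNIV. of_real (\<eta> $ i $ j * \<theta> i x v)) * complex_of_real (\<theta> j x u))"
    unfolding sum_distrib_right
  proof (subst sum.swap, intro sum.cong refl)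
    show "of_real (\<eta> $ i $ j * \<theta> i x u) * complex_of_real (\<theta> j x v) = of_real (\<eta> $ j $ i * \<theta> j x v) * complex_of_real (\<theta> i x u)" for i j
      by (simp add: eta[of i j] mult_ac)
  qed
  have "\<forall>r s. conn_curvature ?A x u v $ r $ s = 0"
    unfolding conn_curvature_nth[OF sA x] all_idx6
    by (simp add: blk_mult dot_def e0 e1 e2[simplified] sym[simplified])
  then show ?thesis unfolding A by (simp add: vec_eq_iff)
qed

section \<open>Conformal flatness\<close>

text \<open>A flattening map would provide the closed adapted coframe dy with vanishing Levi-Civita
  connection, hence vanishing curvature near z. The general formula for the curvature excludes this
  where k is nonzero.\<close>

lemma (in oc_class) not_flat_class:
  assumes t1: "t = 1 \<or> t = -1/3" and S: "S \<subseteq> N" and z: "z \<in> S" "k z \<noteq> 0"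
  shows "\<not> conformally_flat C S"
proof
  assume "conformally_flat C S"
  then obtain V and y :: "n_space \<Rightarrow> real^4" where V: "open V" and zV: "z \<in> V" and VS: "V \<subseteq> S" and y: "smooth_on V y"
    and g: "(\<lambda>x u v. minkowski (frechet_derivative y (at x) u) (frechet_derivative y (at x) v)) \<in> C V"
    using z(1) unfolding conformally_flat_def by blast
  have VN: "V \<subseteq> N" using VS S by (rule subset_trans)
  define dy where "dy x = frechet_derivative y (at x)" for x
  have g': "(\<lambda>x u v. minkowski (dy x u) (dy x v)) \<in> C V" using g unfolding dy_def .
  from g'[unfolded C[OF VN]] obtain F where F: "\<forall>x\<in>V. F x > 0 \<and> (\<forall>u v. minkowski (dy x u) (dy x v) = F x * g0 t x u v)" by blast
  have fd: "(y has_derivative dy x) (at x)" if "x \<in> V" for x unfolding dy_def by (rule smooth_on_has_derivative[OF y that])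
  note lin = has_derivative_linear[OF fd]
  \<comment> \<open>The definition of conformal flatness demands only a smooth map. It is a local
    diffeomorphism because a kernel vector of dy would be degenerate for g0.\<close>
  have surj: "\<exists>v. dy x v = a" if x: "x \<in> V" for x a
  proof -
    have "inj (dy x)" unfolding linear_injective_0[OF lin[OF x]]
    proof (intro allI impI)
      fix v assume 0: "dy x v = 0"
      show "v = 0"
      proof (rule g0_nondegenerate[OF subsetD[OF VN x] t])
        fix u
        have "minkowski (dy x v) (dy x u) = F x * g0 t x v u" "F x > 0" using F x by blast+
        then show "g0 t x v u = 0" unfolding 0 by (simp add: minkowski_def)
      qed
    qed
    then have "dim (range (dy x)) = dim (UNIV :: n_space set)" by (intro dim_image_eq[OF lin[OF x]]) simp
    then have "dim (range (dy x)) = DIM(real^4)" by simp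
    then have "span (range (dy x)) = UNIV" by (simp only: dim_eq_full)
    moreover have "span (range (dy x)) = range (dy x)"
      by (rule span_subspace[OF subset_refl span_superset]) (rule linear_subspace_image[OF lin[OF x] subspace_UNIV])
    ultimately have "range (dy x) = UNIV" by simp
    then show ?thesis by (metis rangeE UNIV_I)
  qed
  define \<theta> :: "4 \<Rightarrow> (n_space, real) form1" where "\<theta> i x v = dy x v $ i" for i x v
  define e :: "4 \<Rightarrow> n_space \<Rightarrow> n_space" where "e j x = (SOME v. dy x v = axis j 1)" for j x
  have e: "dy x (e j x) = axis j 1" if "x \<in> V" for j x unfolding e_def by (rule someI_ex[OF surj[OF that]])
  have dual: "\<theta> i x (e j x) = (if i = j then 1 else 0)" if "x \<in> V" for i j x
    by (simp add: \<theta>_def e[OF that] axis_def)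
  have \<theta>eq: "\<theta> i = (\<lambda>x v. frechet_derivative y (at x) v $ i)" for i by (simp add: \<theta>_def dy_def fun_eq_iff)
  have s\<theta>: "smooth_form V (\<theta> i)" for i
    unfolding \<theta>eq by (rule smooth_form_linear[OF V bounded_linear_vec_nth smooth_form_exact[OF y]])
  have closed: "ext_d (\<theta> i) x u v = 0" if x: "x \<in> V" for i x u v
  proof -
    have "ext_d (\<theta> i) x u v = ext_d (\<lambda>x v. frechet_derivative y (at x) v) x u v $ i"
      unfolding \<theta>eq by (rule ext_d_linear[OF bounded_linear_vec_nth smooth_formD(3)[OF smooth_form_exact[OF y] x]])
    then show ?thesis by (simp add: ext_d_exact[OF V x y])
  qed
  \<comment> \<open>The time direction has index 0, which is the same element as 4;
    \<open>ix\<close> makes this visible to \<open>sum_4\<close>.\<close>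
  define \<eta> :: "real^4^4" where "\<eta> = (\<chi> i j. if i = j then (if i = 0 then - 1 else 1) else 0)"
  have tr: "transpose \<eta> = \<eta>" by (auto simp: \<eta>_def transpose_def vec_eq_iff)
  have ix: "(0::4) = 4" by simp
  have sum: "(\<Sum>i\<in>UNIV. \<Sum>j\<in>UNIV. \<eta> $ i $ j * \<theta> i x u * \<theta> j x v) = minkowski (dy x u) (dy x v)" for x u v
    unfolding minkowski_def ix by (simp add: sum_4 \<eta>_def \<theta>_def)
  have lc: "levi_civita V \<eta> \<theta> (\<lambda>i j x v. 0)"
    unfolding levi_civita_def by (simp add: smooth_form_zero[OF V] closed wedge_def)
  have "adapted_coframe V (\<lambda>x u v. minkowski (dy x u) (dy x v)) \<eta> \<theta> e"
    unfolding adapted_coframe_def by (intro conjI ballI allI tr s\<theta> dual sum[symmetric])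
  then have "open V \<and> (\<exists>g\<in>C V. adapted_coframe V g \<eta> \<theta> e) \<and> levi_civita V \<eta> \<theta> (\<lambda>i j x v. 0)"
    by (intro conjI bexI[OF _ g'] V lc)
  then have gauge: "cartan_gauge C V \<eta> \<theta> e (\<lambda>i j x v. 0)" by (simp only: cartan_gauge_def)
  obtain w' w1' W' k' where a: "adapted_frame V w' w1' W' k' t \<eta> \<theta> e" and kk: "\<And>z. k' z = 0 \<longleftrightarrow> k z = 0"
    by (rule gauge_adapted[OF gauge VN]) (rule that, assumption, simp only:)
  have "k' z \<noteq> 0" using kk z(2) by blast
  then obtain u v where "conn_curvature (normal_connection \<eta> \<theta> e (\<lambda>i j x v. 0)) z u v \<noteq> 0"
    by (rule adapted_frame.curvature_nonzero_adapted[OF a lc zV t1])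
  moreover have "conn_curvature (normal_connection \<eta> \<theta> e (\<lambda>i j x v. 0)) z u v = 0"
    by (rule flat_connection_curvature[OF V zV tr]) (rule s\<theta>, rule closed)
  ultimately show False by (rule notE)
qed

text \<open>With Z = R + i I the left side is the polarisation of 2 dU1 dT + |d((1 + i T) Z)|^2.
  Here \<open>s\<close>, \<open>s'\<close> are values of dT, and subtracting T |Z|^2 / 2 from U
  absorbs both the terms in dT^2 and those in d|Z|^2.\<close>

lemma flat_coordinates_identity:
  fixes E w w' I X X' R Y Y' T s s' :: real
  shows "(E * w + (I * X + - (R * Y)) - 1/2 * (T * ((R * X + X * R) + (I * Y + Y * I)) + s * (R * R + I * I))) * s'
    + (E * w' + (I * X' + - (R * Y')) - 1/2 * (T * ((R * X' + X' * R) + (I * Y' + Y' * I)) + s' * (R * R + I * I))) * s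
    + (X - (T * Y + s * I)) * (X' - (T * Y' + s' * I)) + (Y + (T * X + s * R)) * (Y' + (T * X' + s' * R))
    = (1 + T * T) * (X * X' + Y * Y') + E * (w * s' + w' * s)"
  by (simp add: field_simps)

text \<open>For closed \<Omega> the congruence becomes a Heisenberg model: in coordinates Z, U and
  Im f the metric is conformal to 2 |dZ|^2 + 4t (dU + Re Z d(Im Z) - Im Z d(Re Z)) d(Im f). The
  twist is removed by multiplying Z by 1 + i tan(t Im f), which costs a conformal factor.\<close>

lemma (in oc_class) flat_class:
  assumes k0: "\<And>z. z \<in> N \<Longrightarrow> k z = 0" shows "conformally_flat C N"
  unfolding conformally_flat_def
proof
  fix z0 assume z0: "z0 \<in> N"
  obtain r where r: "r > 0" "ball z0 r \<subseteq> N" using N z0 open_contains_ball by blast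
  define B where "B = ball z0 r"
  have B: "open B" "convex B" "z0 \<in> B" and BN: "B \<subseteq> N" using r by (auto simp: B_def)
  note o = B(1)
  interpret c: conf_frame B w w1 "Wr 1" k by (rule conf_frame.conf_frame_subset[OF conf_frame_slice o BN])
  have dW: "ext_d (Wr 1) x u v = 0" if "x \<in> B" for x u v
    using c.ext_d_W[OF that] by (simp add: k0[OF subsetD[OF BN that]])
  \<comment> \<open>The choice f(z0) = 0 makes the cosine in the definition of \<open>V\<close>
    nonzero at z0.\<close>
  obtain f where f: "\<And>x. x \<in> B \<Longrightarrow> (f has_derivative Wr 1 x) (at x)" and f0: "f z0 = 0"
    by (rule poincare_lemma[OF B c.smooth_W dW]) (assumption, rule that, blast+)
  have sf: "smooth_on B f" by (rule smooth_onI_deriv[OF o f smooth_formD(2)[OF c.smooth_W]])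
  \<comment> \<open>The integrating factor e^(-f) makes \<open>w1\<close> closed, because d w1 = df
    \<and> w1.\<close>
  define be where "be x v = exp (- f x) * w1 x v" for x v
  have sbe: "smooth_form B be"
    unfolding be_def[abs_def] by (rule smooth_form_mult[OF o smooth_on_exp[OF o smooth_on_minus[OF o sf]] c.smooth_w1])
  have dbe: "ext_d be x u v = 0" if x: "x \<in> B" for x u v
  proof -
    have d: "((\<lambda>x. exp (- f x)) has_derivative (\<lambda>v. exp (- f x) * (- Wr 1 x v))) (at x)"
      by (rule has_derivative_compose[OF has_derivative_minus[OF f[OF x]] DERIV_exp[unfolded has_field_derivative_def]])
    show ?thesis
      unfolding be_def[abs_def] ext_d_mult[OF differentiableI[OF d] smooth_formD(3)[OF c.smooth_w1 x]] c.ext_d_w1[OF x]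
        frechet_derivative_at[OF d, symmetric] wedge_def by (simp add: algebra_simps)
  qed
  obtain Z where Z: "\<And>x. x \<in> B \<Longrightarrow> (Z has_derivative be x) (at x)"
    by (rule poincare_lemma[OF B sbe dbe]) (assumption, rule that, blast+)
  have sZ: "smooth_on B Z" by (rule smooth_onI_deriv[OF o Z smooth_formD(2)[OF sbe]])
  \<comment> \<open>The squared modulus of the integrating factor; with it d(E w) = i be \<and>
    conj(be), the standard area form up to a factor.\<close>
  define E where "E x = exp (- 2 * Re (f x))" for x
  have E: "(E has_derivative (\<lambda>u. E x * (- 2 * Re (Wr 1 x u)))) (at x)" if x: "x \<in> B" for x
    unfolding E_def[abs_def]
    by (rule has_derivative_compose[OF has_derivative_mult_right[OF bounded_linear.has_derivative[OF bounded_linear_Re f[OF x]]]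
          DERIV_exp[unfolded has_field_derivative_def]])
  have sE: "smooth_on B E"
    unfolding E_def[abs_def] by (rule smooth_on_exp[OF o smooth_on_mult[OF o smooth_on_const smooth_on_Re[OF o sf]]])
  have ee: "exp (- f x) * cnj (exp (- f x)) = of_real (E x)" for x
    unfolding complex_norm_square[symmetric] norm_exp_eq_Re E_def using exp_double[of "- Re (f x)"] by simp
  have bb: "be x u * cnj (be x v) = E x *\<^sub>R (w1 x u * cnj (w1 x v))" for x u v
    unfolding scaleR_conv_of_real ee[symmetric] be_def complex_cnj_mult by (simp only: mult_ac)
  have imbb: "Im (be x u * cnj (be x v)) = E x * Im (w1 x u * cnj (w1 x v))"
    and rebb: "Re (be x u * cnj (be x v)) = E x * Re (w1 x u * cnj (w1 x v))" for x u v
    unfolding bb by (simp_all only: scaleR_complex.sel)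
  \<comment> \<open>The added terms form a primitive of minus twice the area form in the Z-plane, so
    \<open>nu\<close> is closed.\<close>
  define nu where "nu x v = E x * w x v + (Im (Z x) * Re (be x v) + - (Re (Z x) * Im (be x v)))" for x v
  have reb: "smooth_form B (\<lambda>x v. Re (be x v))" and imb: "smooth_form B (\<lambda>x v. Im (be x v))"
    by (rule smooth_form_linear[OF o bounded_linear_Re sbe], rule smooth_form_linear[OF o bounded_linear_Im sbe])
  have snu: "smooth_form B nu"
    unfolding nu_def[abs_def]
    by (rule smooth_form_add[OF o smooth_form_mult[OF o sE c.smooth_w] smooth_form_add[OF o smooth_form_mult[OF o smooth_on_Im[OF o sZ] reb]
          smooth_form_minus[OF o smooth_form_mult[OF o smooth_on_Re[OF o sZ] imb]]]])
  have dnu: "ext_d nu x u v = 0" if x: "x \<in> B" for x u v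
  proof -
    define Dw where "Dw v = frechet_derivative (\<lambda>y. w y v) (at x)" for v
    define Db where "Db v = frechet_derivative (\<lambda>y. be y v) (at x)" for v
    have hw: "((\<lambda>y. w y v) has_derivative Dw v) (at x)" for v
      unfolding Dw_def by (rule smooth_on_has_derivative[OF smooth_formD(2)[OF c.smooth_w] x])
    have hb: "((\<lambda>y. be y v) has_derivative Db v) (at x)" for v
      unfolding Db_def by (rule smooth_on_has_derivative[OF smooth_formD(2)[OF sbe] x])
    note RZ = bounded_linear.has_derivative[OF bounded_linear_Re Z[OF x]]
    note IZ = bounded_linear.has_derivative[OF bounded_linear_Im Z[OF x]]
    have hn: "((\<lambda>y. nu y v) has_derivative (\<lambda>u. E x * Dw v u + E x * (- 2 * Re (Wr 1 x u)) * w x v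
      + ((Im (Z x) * Re (Db v u) + Im (be x u) * Re (be x v)) + - (Re (Z x) * Im (Db v u) + Re (be x u) * Im (be x v))))) (at x)" for v
      unfolding nu_def
      by (rule has_derivative_add[OF has_derivative_mult[OF E[OF x] hw] has_derivative_add[OF
            has_derivative_mult[OF IZ bounded_linear.has_derivative[OF bounded_linear_Re hb]]
            has_derivative_minus[OF has_derivative_mult[OF RZ bounded_linear.has_derivative[OF bounded_linear_Im hb]]]]])
    have sb: "Db v u = Db u v" using dbe[OF x, of u v] by (simp add: ext_d_def Db_def)
    have "complex_of_real (ext_d w x u v) = ext_d (cplx w) x u v"
      unfolding cplx_def[abs_def] by (rule ext_d_linear[OF bounded_linear_of_real smooth_formD(3)[OF c.smooth_w x], symmetric])
    then have "ext_d w x u v = Re (ext_d (cplx w) x u v)" by (metis Re_complex_of_real)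
    then have sw: "Dw v u - Dw u v = - 2 * Im (w1 x u * cnj (w1 x v)) + 2 * (Re (Wr 1 x u) * w x v - Re (Wr 1 x v) * w x u)"
      unfolding c.ext_d_w[OF x] by (simp add: ext_d_def Dw_def wedge_def conj_form_def cplx_def algebra_simps)
    have "ext_d nu x u v = E x * (Dw v u - Dw u v) - 2 * E x * (Re (Wr 1 x u) * w x v - Re (Wr 1 x v) * w x u)
      + 2 * Im (be x u * cnj (be x v))"
      unfolding ext_d_def frechet_derivative_at[OF hn, symmetric] sb by (simp add: algebra_simps)
    then show ?thesis unfolding sw imbb by (simp add: algebra_simps)
  qed
  obtain U where U: "\<And>x. x \<in> B \<Longrightarrow> (U has_derivative nu x) (at x)"
    by (rule poincare_lemma[OF B snu dnu]) (assumption, rule that, blast+)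
  have sU: "smooth_on B U" by (rule smooth_onI_deriv[OF o U smooth_formD(2)[OF snu]])
  \<comment> \<open>The domain on which T = tan(t Im f) is defined; the coordinates exist only
    locally.\<close>
  define V where "V = B \<inter> (\<lambda>x. cos (t * Im (f x))) -` (- {0})"
  have VB: "V \<subseteq> B" by (auto simp: V_def)
  have V: "open V"
    unfolding V_def by (rule continuous_open_preimage[OF _ o open_Compl[OF closed_singleton]])
      (intro continuous_intros smooth_on_continuous_on[OF sf])
  define T where "T x = tan (t * Im (f x))" for x
  have sT: "smooth_on V T"
    unfolding T_def[abs_def]
    by (rule smooth_on_compose[OF V smooth_on_mult[OF V smooth_on_const smooth_on_Im[OF V smooth_on_subset[OF sf VB]]] smooth_on_tan_cos_nonzero])
      (simp add: V_def)
  \<comment> \<open>The factor 1 + T^2 matches the factor by which (1 + i T) stretches |dZ|^2, so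
    the same conformal factor serves both parts of the metric.\<close>
  define dT where "dT x u = (1 + T x * T x) * (t * Im (Wr 1 x u))" for x u
  have hT: "(T has_derivative dT x) (at x)" if x: "x \<in> V" for x
  proof -
    have "cos (t * Im (f x)) \<noteq> 0" using x by (simp add: V_def)
    then have "(tan has_derivative (\<lambda>v. (1 + tan (t * Im (f x)) * tan (t * Im (f x))) * v)) (at (t * Im (f x)))"
      using DERIV_tan[of "t * Im (f x)"] tan_sec[of "t * Im (f x)"] by (simp add: has_field_derivative_def power2_eq_square)
    from has_derivative_compose[OF has_derivative_mult_right[OF bounded_linear.has_derivative[OF bounded_linear_Im f]] this]
    show ?thesis using x VB by (auto simp: T_def[abs_def] dT_def[abs_def])
  qed
  define U1 where "U1 x = U x - 1/2 * (T x * (Re (Z x) * Re (Z x) + Im (Z x) * Im (Z x)))" for x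
  define dU1 where "dU1 x u = nu x u - 1/2 * (T x * ((Re (Z x) * Re (be x u) + Re (be x u) * Re (Z x)) + (Im (Z x) * Im (be x u) + Im (be x u) * Im (Z x)))
    + dT x u * (Re (Z x) * Re (Z x) + Im (Z x) * Im (Z x)))" for x u
  \<comment> \<open>Normalises U1 + T and U1 - T so that the difference of the squares of the
    corresponding differentials is 2 dU1 dT.\<close>
  define s where "s = 1 / sqrt 2"
  have s: "s * s = 1/2" by (simp add: s_def)
  define y :: "n_space \<Rightarrow> real^4" where "y x = (\<chi> i. if i = 1 then s * (U1 x + T x) else if i = 2 then Re (Z x) - T x * Im (Z x)
    else if i = 3 then Im (Z x) + T x * Re (Z x) else s * (U1 x - T x))" for x
  have yi: "y x $ 1 = s * (U1 x + T x)" "y x $ 2 = Re (Z x) - T x * Im (Z x)" "y x $ 3 = Im (Z x) + T x * Re (Z x)"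
    "y x $ 4 = s * (U1 x - T x)" for x by (simp_all add: y_def)
  note sub = smooth_on_subset[OF _ VB]
  note RZ = smooth_on_Re[OF V sub[OF sZ]] and IZ = smooth_on_Im[OF V sub[OF sZ]]
  have sU1: "smooth_on V U1"
    unfolding U1_def[abs_def]
    by (rule smooth_on_diff[OF V sub[OF sU] smooth_on_mult[OF V smooth_on_const smooth_on_mult[OF V sT
          smooth_on_add[OF V smooth_on_mult[OF V RZ RZ] smooth_on_mult[OF V IZ IZ]]]]])
  have sy: "smooth_on V y"
    by (rule smooth_on_vec4[OF V]; unfold yi;
        intro smooth_on_add[OF V] smooth_on_diff[OF V] smooth_on_mult[OF V] smooth_on_const sU1 sT RZ IZ)
  have dyi: "frechet_derivative y (at x) u $ 1 = s * (dU1 x u + dT x u)"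
    "frechet_derivative y (at x) u $ 2 = Re (be x u) - (T x * Im (be x u) + dT x u * Im (Z x))"
    "frechet_derivative y (at x) u $ 3 = Im (be x u) + (T x * Re (be x u) + dT x u * Re (Z x))"
    "frechet_derivative y (at x) u $ 4 = s * (dU1 x u - dT x u)" if x: "x \<in> V" for x u
  proof -
    have xB: "x \<in> B" using x VB by blast
    have n: "frechet_derivative y (at x) u $ i = D u" if "((\<lambda>x. y x $ i) has_derivative D) (at x)" for i D
    proof -
      have "((\<lambda>x. y x $ i) has_derivative (\<lambda>u. frechet_derivative y (at x) u $ i)) (at x)"
        by (rule bounded_linear.has_derivative[OF bounded_linear_vec_nth smooth_on_has_derivative[OF sy x]])
      from fun_cong[OF has_derivative_unique[OF this that]] show ?thesis .
    qed
    note RZ = bounded_linear.has_derivative[OF bounded_linear_Re Z[OF xB]]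
    note IZ = bounded_linear.has_derivative[OF bounded_linear_Im Z[OF xB]]
    note T = hT[OF x]
    have hU1: "(U1 has_derivative dU1 x) (at x)"
      unfolding U1_def[abs_def] dU1_def[abs_def]
      by (rule has_derivative_diff[OF U[OF xB] has_derivative_mult_right[OF has_derivative_mult[OF T
            has_derivative_add[OF has_derivative_mult[OF RZ RZ] has_derivative_mult[OF IZ IZ]]]]])
    show "frechet_derivative y (at x) u $ 1 = s * (dU1 x u + dT x u)"
      by (rule n, unfold yi, rule has_derivative_mult_right[OF has_derivative_add[OF hU1 T]])
    show "frechet_derivative y (at x) u $ 2 = Re (be x u) - (T x * Im (be x u) + dT x u * Im (Z x))"
      by (rule n, unfold yi, rule has_derivative_diff[OF RZ has_derivative_mult[OF T IZ]])
    show "frechet_derivative y (at x) u $ 3 = Im (be x u) + (T x * Re (be x u) + dT x u * Re (Z x))"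
      by (rule n, unfold yi, rule has_derivative_add[OF IZ has_derivative_mult[OF T RZ]])
    show "frechet_derivative y (at x) u $ 4 = s * (dU1 x u - dT x u)"
      by (rule n, unfold yi, rule has_derivative_mult_right[OF has_derivative_diff[OF hU1 T]])
  qed
  let ?g = "\<lambda>x u v. minkowski (frechet_derivative y (at x) u) (frechet_derivative y (at x) v)"
  have g: "?g x u v = ((1 + T x * T x) / 2 * E x) * g0 t x u v" if x: "x \<in> V" for x u v
  proof -
    have ix: "(0::4) = 4" by simp
    have sq: "- (s * (a - b) * (s * (a' - b'))) + s * (a + b) * (s * (a' + b')) = a * b' + a' * b" for a b a' b'
    proof -
      have "- (s * (a - b) * (s * (a' - b'))) + s * (a + b) * (s * (a' + b')) = (s * s) * (2 * (a * b' + a' * b))"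
        by (simp add: algebra_simps)
      then show ?thesis unfolding s by simp
    qed
    have "?g x u v = dU1 x u * dT x v + dU1 x v * dT x u
      + (Re (be x u) - (T x * Im (be x u) + dT x u * Im (Z x))) * (Re (be x v) - (T x * Im (be x v) + dT x v * Im (Z x)))
      + (Im (be x u) + (T x * Re (be x u) + dT x u * Re (Z x))) * (Im (be x v) + (T x * Re (be x v) + dT x v * Re (Z x)))"
      unfolding minkowski_def ix dyi[OF x] sq ..
    also have "\<dots> = (1 + T x * T x) * (Re (be x u) * Re (be x v) + Im (be x u) * Im (be x v)) + E x * (w x u * dT x v + w x v * dT x u)"
      unfolding dU1_def nu_def by (rule flat_coordinates_identity)
    also have "Re (be x u) * Re (be x v) + Im (be x u) * Im (be x v) = E x * Re (w1 x u * cnj (w1 x v))"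
      unfolding rebb[symmetric] by simp
    also have "(1 + T x * T x) * (E x * Re (w1 x u * cnj (w1 x v))) + E x * (w x u * dT x v + w x v * dT x u)
      = ((1 + T x * T x) / 2 * E x) * (2 * Re (w1 x u * cnj (w1 x v)) + 2 * t * (w x u * Im (Wr 1 x v) + w x v * Im (Wr 1 x u)))"
      unfolding dT_def by (simp add: field_simps)
    finally show ?thesis unfolding g0_def .
  qed
  have VN: "V \<subseteq> N" using VB BN by blast
  have sb: "smooth_bilinear_on V ?g"
    unfolding smooth_bilinear_on_def
  proof (intro conjI ballI allI)
    fix x assume x: "x \<in> V"
    note L = has_derivative_linear[OF smooth_on_has_derivative[OF sy x]]
    show "bilinear (\<lambda>u v. ?g x u v)"
      unfolding bilinear_def linear_iff minkowski_def linear_add[OF L] linear_scale[OF L] by (simp add: algebra_simps)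
    show "?g x u v = ?g x v u" for u v by (simp add: minkowski_def mult.commute)
  next
    fix u v
    note n = smooth_on_vec_nth[OF V smooth_on_frechet_derivative[OF sy]]
    show "smooth_on V (\<lambda>x. ?g x u v)"
      unfolding minkowski_def by (intro smooth_on_add[OF V] smooth_on_mult[OF V] smooth_on_minus[OF V] n)
  qed
  have pos: "(1 + T x * T x) / 2 * E x > 0" for x
    by (simp add: E_def add_pos_nonneg)
  have "?g \<in> C V"
    unfolding C[OF VN] by (intro conjI sb exI[of _ "\<lambda>x. (1 + T x * T x) / 2 * E x"] ballI allI pos g)
  moreover have "z0 \<in> V" using B(3) f0 by (simp add: V_def)
  ultimately show "\<exists>V (y :: n_space \<Rightarrow> real^4). open V \<and> z0 \<in> V \<and> V \<subseteq> N \<and> smooth_on V y \<and>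
      (\<lambda>x u v. minkowski (frechet_derivative y (at x) u) (frechet_derivative y (at x) v)) \<in> C V"
    using V VN sy by blast
qed

text \<open>The factor on P is allowed to depend on \<rho>, whereas the metric on N does not. A
  factor on N is obtained by evaluating at \<rho> = 1; conversely it is divided by \<rho>^2.\<close>

lemma (in oc_chart) conformal_class_iff:
  assumes V: "V \<subseteq> N"
    and G: "\<And>y u v. y \<in> P \<Longrightarrow> G y u v = complex_of_real ((fst (snd y))\<^sup>2 * g0 t (proj_n y) (proj_n u) (proj_n v))"
  shows "(\<exists>f. \<forall>y\<in>P. proj_n y \<in> V \<longrightarrow> f y > 0 \<and>
        (\<forall>u v. complex_of_real (g (proj_n y) (proj_n u) (proj_n v)) = of_real (f y) * G y u v))
    \<longleftrightarrow> (\<exists>F. \<forall>z\<in>V. F z > 0 \<and> (\<forall>u v. g z u v = F z * g0 t z u v))" (is "?L \<longleftrightarrow> ?R")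
proof
  assume ?L
  then obtain f where f: "\<And>y. y \<in> P \<Longrightarrow> proj_n y \<in> V \<Longrightarrow> f y > 0"
    "\<And>y u v. y \<in> P \<Longrightarrow> proj_n y \<in> V \<Longrightarrow> complex_of_real (g (proj_n y) (proj_n u) (proj_n v)) = of_real (f y) * G y u v"
    by blast
  show ?R
  proof (intro exI[of _ "\<lambda>z. f (jr 1 z)"] ballI conjI allI)
    fix z u v assume z: "z \<in> V"
    have y: "jr 1 z \<in> P" by (rule jr_P[OF subsetD[OF V z] zero_less_one])
    have p: "proj_n (jr 1 z) = z" "proj_n (jl u) = u" "proj_n (jl v) = v" "fst (snd (jr 1 z)) = 1"
      by (simp_all add: proj_n_def jr_def jl_def)
    show "f (jr 1 z) > 0" using f(1)[OF y] z p by simp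
    have "complex_of_real (g z u v) = of_real (f (jr 1 z)) * of_real (g0 t z u v)"
      using f(2)[OF y, of "jl u" "jl v"] z unfolding G[OF y] p by simp
    then show "g z u v = f (jr 1 z) * g0 t z u v" by (simp only: of_real_mult[symmetric] of_real_eq_iff)
  qed
next
  assume ?R
  then obtain F where F: "\<And>z. z \<in> V \<Longrightarrow> F z > 0" "\<And>z u v. z \<in> V \<Longrightarrow> g z u v = F z * g0 t z u v" by blast
  show ?L
  proof (intro exI[of _ "\<lambda>y. F (proj_n y) / (fst (snd y))\<^sup>2"] ballI impI conjI allI)
    fix y u v assume y: "y \<in> P" and z: "proj_n y \<in> V"
    have r: "fst (snd y) > 0" using y by auto
    then show "F (proj_n y) / (fst (snd y))\<^sup>2 > 0" using F(1)[OF z] by simp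
    have "F (proj_n y) * g0 t (proj_n y) (proj_n u) (proj_n v)
        = F (proj_n y) / (fst (snd y))\<^sup>2 * ((fst (snd y))\<^sup>2 * g0 t (proj_n y) (proj_n u) (proj_n v))"
      using r by simp
    then show "complex_of_real (g (proj_n y) (proj_n u) (proj_n v)) = of_real (F (proj_n y) / (fst (snd y))\<^sup>2) * G y u v"
      unfolding G[OF y] F(2)[OF z] of_real_mult[symmetric] by (simp only:)
  qed
qed

theorem theorem10p3:
  fixes X :: "'p topology"
    and \<A> :: "'p chart set"
    and S :: "(('p, real) mform \<times> ('p, complex) mform) set"
    and lam :: "('p, real) mform" and \<mu> :: "('p, complex) mform"
    and a :: "'p \<Rightarrow> real" and b p q s :: "'p \<Rightarrow> complex"
    and \<Omega> :: "'p chart \<Rightarrow> (p_space, complex) form1"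
    and k1 :: "'p \<Rightarrow> real" and k2 :: "'p \<Rightarrow> complex"
    and t :: real
  assumes "smooth_3manifold X \<A>"
    and "oriented_congruence \<A> S" and "(lam, \<mu>) \<in> S"
    and "structure_functions \<A> lam \<mu> a b p q s"
    and twist: "\<forall>z\<in>topspace X. a z \<noteq> 0"
    and shear: "\<forall>z\<in>topspace X. s z = 0"
    and "invariant_coframe \<A> a lam \<mu> \<Omega> k1 k2"
    and "t = -1/3 \<or> t = 1"
    and K1: "\<forall>z\<in>topspace X. k1 z = 0"
  shows "(\<forall>c\<in>\<A>. bach_condition (g_class t c a lam \<mu> \<Omega>) (ndom c)) \<and>
     (\<forall>c\<in>\<A>. \<forall>W. open W \<longrightarrow> W \<subseteq> ndom c \<longrightarrow> (\<exists>(x, \<phi>)\<in>W. k2 (cinv c x) \<noteq> 0) \<longrightarrow>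
        \<not> conformally_flat (g_class t c a lam \<mu> \<Omega>) W \<and>
        \<not> cotton_condition (g_class t c a lam \<mu> \<Omega>) W) \<and>
     ((\<forall>z\<in>topspace X. k2 z = 0) \<longrightarrow>
        (\<forall>c\<in>\<A>. curvature_vanishes (g_class t c a lam \<mu> \<Omega>) (ndom c) \<and>
                conformally_flat (g_class t c a lam \<mu> \<Omega>) (ndom c)))"
proof -
  have t0: "t \<noteq> 0" and t1: "t = 1 \<or> t = -1/3" using assms(8) by auto
  have pair: "oc_pair \<A> (lam, \<mu>)"
    using assms(2,3) unfolding oriented_congruence_def quotient_def oc_rel_def by blast
  have inv: "cinv c x \<in> topspace X" if c: "c \<in> \<A>" and x: "x \<in> img c" for c x
  proof -
    have "cinv c x \<in> cdom c" using x unfolding cinv_def img_def by (rule inv_into_into)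
    then show ?thesis using assms(1) c unfolding smooth_3manifold_def by blast
  qed
  have chart: "oc_chart (img c) (\<lambda>x. a (cinv c x)) (lam c) (\<mu> c) (\<Omega> c) (\<lambda>x. k2 (cinv c x)) (omega c a lam) (omega1 c \<mu>)"
    if c: "c \<in> \<A>" for c
  proof
    show "open (img c)" using assms(1) c unfolding smooth_3manifold_def by blast
    show "smooth_form (img c) (lam c)" "smooth_form (img c) (\<mu> c)"
      using pair c unfolding oc_pair_def manifold_form_def by blast+
    have "smooth_fun \<A> a" "smooth_fun \<A> k2"
      using assms(4,7) unfolding structure_functions_def invariant_coframe_def by blast+
    then have "smooth_on (img c) (a \<circ> cinv c)" "smooth_on (img c) (k2 \<circ> cinv c)" using c unfolding smooth_fun_def by blast+
    then show "smooth_on (img c) (\<lambda>x. a (cinv c x))" "smooth_on (img c) (\<lambda>x. k2 (cinv c x))" by (simp_all only: o_def)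
    show "a (cinv c x) \<noteq> 0" if "x \<in> img c" for x using twist inv[OF c that] by blast
    note H = assms(7)[unfolded invariant_coframe_def Let_def, THEN conjunct2, THEN conjunct2, THEN bspec, OF c]
    show "smooth_form (img c \<times> {0<..} \<times> UNIV) (\<Omega> c)" using conjunct1[OF H] unfolding pdom_def .
    show "omega c a lam = (\<lambda>(x, \<rho>, \<phi>) v. \<rho>\<^sup>2 / a (cinv c x) * lam c x (fst v))" by (rule omega_def)
    show "omega1 c \<mu> = (\<lambda>(x, \<rho>, \<phi>) v. of_real \<rho> * cis \<phi> * \<mu> c x (fst v))" by (rule omega1_def)
    fix x and \<rho> \<phi> :: real and u v assume x: "x \<in> img c" and \<rho>: "\<rho> > 0"
    have y: "(x, \<rho>, \<phi>) \<in> pdom c" using x \<rho> by (simp add: pdom_def)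
    \<comment> \<open>The conjuncts of the definition at one point of P: nondegeneracy and the three
      structure equations.\<close>
    note ic = bspec[OF conjunct2[OF H] y, unfolded prod.case]
    show "ext_d (cplx (omega c a lam)) (x, \<rho>, \<phi>) u v
      = \<i> * wedge (omega1 c \<mu> (x, \<rho>, \<phi>)) (conj_form (omega1 c \<mu>) (x, \<rho>, \<phi>)) u v
        + wedge (\<lambda>z. \<Omega> c (x, \<rho>, \<phi>) z + conj_form (\<Omega> c) (x, \<rho>, \<phi>) z) (cplx (omega c a lam) (x, \<rho>, \<phi>)) u v"
      using ic by blast
    show "ext_d (omega1 c \<mu>) (x, \<rho>, \<phi>) u v = wedge (\<Omega> c (x, \<rho>, \<phi>)) (omega1 c \<mu> (x, \<rho>, \<phi>)) u v"
      using ic by blast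
    have "k1 (cinv c x) = 0" using K1 inv[OF c x] by blast
    then show "ext_d (\<Omega> c) (x, \<rho>, \<phi>) u v
      = cis (- \<phi>) * k2 (cinv c x) / of_real (\<rho> ^ 3) * wedge (omega1 c \<mu> (x, \<rho>, \<phi>)) (cplx (omega c a lam) (x, \<rho>, \<phi>)) u v"
      using ic[THEN conjunct2, THEN conjunct2, THEN conjunct2, THEN spec, THEN spec, of u v] by (simp del: split_paired_All)
    assume "omega c a lam (x, \<rho>, \<phi>) v = 0" "omega1 c \<mu> (x, \<rho>, \<phi>) v = 0" "\<Omega> c (x, \<rho>, \<phi>) v = 0"
    then show "v = 0" using conjunct1[OF ic, THEN spec, of v] by (simp add: cplx_def)
  qed
  have cls: "oc_class (img c) (\<lambda>x. a (cinv c x)) (lam c) (\<mu> c) (\<Omega> c) (\<lambda>x. k2 (cinv c x)) (omega c a lam) (omega1 c \<mu>)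
    t (g_class t c a lam \<mu> \<Omega>)" if c: "c \<in> \<A>" for c
  proof -
    interpret o: oc_chart "img c" "\<lambda>x. a (cinv c x)" "lam c" "\<mu> c" "\<Omega> c" "\<lambda>x. k2 (cinv c x)" "omega c a lam" "omega1 c \<mu>"
      by (rule chart[OF c])
    show ?thesis
    proof
      show "t \<noteq> 0" by (rule t0)
      fix V g assume V: "V \<subseteq> img c \<times> (UNIV :: real set)"
      have G: "G_form t c a lam \<mu> \<Omega> y u v = complex_of_real ((fst (snd y))\<^sup>2 * o.g0 t (proj_n y) (proj_n u) (proj_n v))"
        if "y \<in> img c \<times> {0<..} \<times> UNIV" for y u v
        unfolding G_form_def by (rule o.G_eq[OF that])
      show "g \<in> g_class t c a lam \<mu> \<Omega> V \<longleftrightarrow> smooth_bilinear_on V g \<and>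
          (\<exists>F. \<forall>z\<in>V. F z > 0 \<and> (\<forall>u v. g z u v = F z * o.g0 t z u v))"
        unfolding g_class_def mem_Collect_eq pdom_def
        by (rule conj_cong[OF refl], rule o.conformal_class_iff[OF V]) (rule G)
    qed
  qed
  show ?thesis
  proof (intro conjI ballI allI impI)
    fix c assume c: "c \<in> \<A>"
    show "bach_condition (g_class t c a lam \<mu> \<Omega>) (ndom c)"
      unfolding ndom_def by (rule oc_class.bach_class[OF cls[OF c] t1])
  next
    fix c W assume c: "c \<in> \<A>" and W: "open W" "W \<subseteq> ndom c" and "\<exists>(x, \<phi>)\<in>W. k2 (cinv c x) \<noteq> 0"
    then obtain x \<phi> where z: "(x, \<phi>) \<in> W" "k2 (cinv c x) \<noteq> 0" by blast
    \<comment> \<open>On the slice k differs from the coefficient \<open>k2\<close> only by a phase,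
      so the two have the same zeros.\<close>
    have k: "oc_chart.k (\<lambda>x. k2 (cinv c x)) (x, \<phi>) \<noteq> 0"
      unfolding oc_chart.k_def[OF chart[OF c]] using z(2) by simp
    show "\<not> conformally_flat (g_class t c a lam \<mu> \<Omega>) W"
      by (rule oc_class.not_flat_class[OF cls[OF c] t1 W(2)[unfolded ndom_def] z(1) k])
    show "\<not> cotton_condition (g_class t c a lam \<mu> \<Omega>) W"
      by (rule oc_class.not_cotton_class[OF cls[OF c] t1 W(1) W(2)[unfolded ndom_def] z(1) k])
  next
    fix c assume k2: "\<forall>z\<in>topspace X. k2 z = 0" and c: "c \<in> \<A>"
    have k: "oc_chart.k (\<lambda>x. k2 (cinv c x)) z = 0" if "z \<in> img c \<times> UNIV" for z
      unfolding oc_chart.k_def[OF chart[OF c]] using k2 inv[OF c, of "fst z"] that by auto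
    show "curvature_vanishes (g_class t c a lam \<mu> \<Omega>) (ndom c)"
      unfolding ndom_def by (rule oc_class.curvature_vanishes_class[OF cls[OF c] k])
    show "conformally_flat (g_class t c a lam \<mu> \<Omega>) (ndom c)"
      unfolding ndom_def by (rule oc_class.flat_class[OF cls[OF c] k])
  qed
qed

end
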